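(* Consider the exponential model and suppose that $\underline{\alpha}+\underline{\beta}>0$. Then the shape function $g$ satisfies $$g(s,t)=\inf_{z\in(-\underline{\alpha},\,\underline{\beta})}\left\{s\,E\left[\frac{1}{a+z}\right]+t\,E\left[\frac{1}{b-z}\right]\right\}\quad\text{for all } s,t>0.$$
   Context: $\mathbb{N}=\{1,2,\dots\}$, $\mathbb{Z}_+=\{0,1,2,\dots\}$, $\mathbb{R}_+=[0,\infty)$; $\lfloor x\rfloor$ is the integer part; $x\vee y=\max\{x,y\}$; by convention $1/0=\infty$ and $1/\infty=0$. Environment. Let $\mathbf{a}=(a_n)_{n\in\mathbb{N}}$ and $\mathbf{b}=(b_n)_{n\in\mathbb{N}}$ be stationary random sequences in $(0,\infty)$, and let $\mu$ be the distribution of $(\mathbf{a},\mathbf{b})$. For $k\in\mathbb{Z}_+$ let $\tau_k$ be the shift $(c_n)_{n\in\mathbb{N}}\mapsto(c_{n+k})_{n\in\mathbb{N}}$. It is assumed that $\mu$ is (stationary and) ergodic under the map $\tau_k\times\tau_l:(\mathbf{a},\mathbf{b})\mapsto(\tau_k\mathbf{a},\tau_l\mathbf{b})$ for each $k,l\in\mathbb{N}$. Write $E$ for expectation under $\mu$, $a=a_1$, $b=b_1$, and let $\alpha,\beta$ be the distributions of $a,b$. For a Borel measure $\eta$ on $\mathbb{R}$, $\underline{\eta}$ is the left endpoint of the support of $\eta$. Exponential model. Given $(\mathbf{a},\mathbf{b})$, the weights $W(i,j)$, $i,j\in\mathbb{N}$, are (conditionally) independent and $W(i,j)$ is exponentially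 distributed with rate $a_i+b_j$. Their conditional joint law (a product measure on $\mathbb{R}_+^{\mathbb{N}^2}$) is $\mathbf{P}_{\mathbf{a},\mathbf{b}}$, and $\mathbb{P}(\cdot)=\int\mathbf{P}_{\mathbf{a},\mathbf{b}}(\cdot)\,\mu(d\mathbf{a},d\mathbf{b})$ is the joint law of the weights. Last-passage times. $G(i,j)=G(i-1,j)\vee G(i,j-1)+W(i,j)$ for $i,j\in\mathbb{N}$, with $G(i,0)=G(0,j)=0$. Equivalently, $G(m,n)$ is the maximum over all directed paths $\pi$ from $(1,1)$ to $(m,n)$ with steps $(1,0)$ or $(0,1)$ of $\sum_{(i,j)\in\pi}W(i,j)$. Shape function. There is a deterministic function $g:(0,\infty)^2\to[0,\infty]$, called the shape function, such that $\mathbb{P}$-a.s. $\lim_{n\to\infty}G(\lfloor ns\rfloor,\lfloor nt\rfloor)/n=g(s,t)$ for all $s,t>0$. *)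

theory Defs
  imports "HOL-Probability.Probability"
begin

(* Sequences indexed by {1, 2, ...} are elements of a product space over the index set {1..} and
   hence undefined at index 0; the shifts are restricted to {1..} accordingly. *)

definition pos_seq_space :: "(nat \<Rightarrow> real) measure" where
  "pos_seq_space = (\<Pi>\<^sub>M n\<in>{1..}. restrict_space borel {0<..})"

definition env_space :: "((nat \<Rightarrow> real) \<times> (nat \<Rightarrow> real)) measure" where
  "env_space = pos_seq_space \<Otimes>\<^sub>M pos_seq_space"

definition seq_shift :: "nat \<Rightarrow> (nat \<Rightarrow> real) \<Rightarrow> (nat \<Rightarrow> real)" where
  "seq_shift k c = (\<lambda>n\<in>{1..}. c (n + k))"

definition shift2 ::
    "nat \<Rightarrow> nat \<Rightarrow> (nat \<Rightarrow> real) \<times> (nat \<Rightarrow> real) \<Rightarrow> (nat \<Rightarrow> real) \<times> (nat \<Rightarrow> real)" where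
  "shift2 k l = map_prod (seq_shift k) (seq_shift l)"

definition stationary_map :: "'a measure \<Rightarrow> ('a \<Rightarrow> 'a) \<Rightarrow> bool" where
  "stationary_map M T \<longleftrightarrow> T \<in> measurable M M \<and> distr M M T = M"

definition ergodic_map :: "'a measure \<Rightarrow> ('a \<Rightarrow> 'a) \<Rightarrow> bool" where
  "ergodic_map M T \<longleftrightarrow> stationary_map M T \<and>
     (\<forall>A\<in>sets M. T -` A \<inter> space M = A \<longrightarrow> measure M A = 0 \<or> measure M A = 1)"

definition law_a :: "((nat \<Rightarrow> real) \<times> (nat \<Rightarrow> real)) measure \<Rightarrow> real measure" where
  "law_a \<mu> = distr \<mu> borel (\<lambda>(a, b). a 1)"

definition law_b :: "((nat \<Rightarrow> real) \<times> (nat \<Rightarrow> real)) measure \<Rightarrow> real measure" where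
  "law_b \<mu> = distr \<mu> borel (\<lambda>(a, b). b 1)"

definition measure_support :: "real measure \<Rightarrow> real set" where
  "measure_support \<eta> = {x. \<forall>U. open U \<longrightarrow> x \<in> U \<longrightarrow> emeasure \<eta> U > 0}"

(* Meaningful only if the support is nonempty and bounded below, as it is for
   probability measures on the positive half-line. *)
definition left_endpoint :: "real measure \<Rightarrow> real" where
  "left_endpoint \<eta> = Inf (measure_support \<eta>)"

definition quenched_law :: "(nat \<Rightarrow> real) \<times> (nat \<Rightarrow> real) \<Rightarrow> (nat \<times> nat \<Rightarrow> real) measure" where
  "quenched_law = (\<lambda>(a, b). \<Pi>\<^sub>M (i, j)\<in>{1..} \<times> {1..}.
     density lborel (exponential_density (a i + b j)))"

definition annealed_law ::
    "((nat \<Rightarrow> real) \<times> (nat \<Rightarrow> real)) measure \<Rightarrow> (nat \<times> nat \<Rightarrow> real) measure" where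
  "annealed_law \<mu> = \<mu> \<bind> quenched_law"

fun last_passage :: "(nat \<times> nat \<Rightarrow> real) \<Rightarrow> nat \<Rightarrow> nat \<Rightarrow> real" where
  "last_passage W 0 j = 0"
| "last_passage W (Suc i) 0 = 0"
| "last_passage W (Suc i) (Suc j) =
     max (last_passage W i (Suc j)) (last_passage W (Suc i) j) + W (Suc i, Suc j)"

(* Only the values of g at positive arguments matter. *)
definition is_shape_function ::
    "((nat \<Rightarrow> real) \<times> (nat \<Rightarrow> real)) measure \<Rightarrow> (real \<Rightarrow> real \<Rightarrow> ennreal) \<Rightarrow> bool" where
  "is_shape_function \<mu> g \<longleftrightarrow>
     (AE W in annealed_law \<mu>. \<forall>s>0. \<forall>t>0.
        (\<lambda>n. ereal (last_passage W (nat \<lfloor>real n * s\<rfloor>) (nat \<lfloor>real n * t\<rfloor>) / real n))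
          \<longlonglongrightarrow> enn2ereal (g s t))"

end

theory Submission
  imports Defs
begin

text \<open>
  Write \<open>A z = E[1 / (a + z)]\<close>, \<open>B z = E[1 / (b - z)]\<close> and \<open>D z s t = s A z + t B z\<close> (called \<open>drift\<close>
  below) for \<open>z\<close> in the open interval \<open>(- \<alpha>, \<beta>)\<close> between the two left endpoints.

  The upper bound \<open>g \<le> D z\<close> comes from an increment-stationary extension of the model.  Add a row and a
  column of weights with index \<open>0\<close>, of rates \<open>a\<^sub>i + z\<close> and \<open>b\<^sub>j - z\<close>; this amounts to the convention
  \<open>a\<^sub>0 = - z\<close>, \<open>b\<^sub>0 = z\<close>.  If \<open>I\<close>, \<open>J\<close>, \<open>W\<close> are independent exponentials of rates \<open>u\<close>, \<open>v\<close>, \<open>u + v\<close>, then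
  so are \<open>W + (I - J)\<^sup>+\<close>, \<open>W + (J - I)\<^sup>+\<close>, \<open>min I J\<close> (Burke property, lemma \<open>exp_law_burke\<close>).  The first two are
  how a horizontal and a vertical increment of the last-passage times change across a cell, so all
  increments of the extended model keep the laws prescribed on the axes, and its passage time to \<open>(m, n)\<close>
  has mean exactly \<open>m A z + n B z\<close> (lemma \<open>boundary_mean\<close>).  It dominates the original passage time, and
  Fatou's lemma gives \<open>g_le\<close>.

  For the lower bound, an optimal path of the extended model leaves the axes somewhere.  Cutting the axes
  into \<open>M\<close> blocks and using the law of large numbers for the weights on the axes, this shows that
  \<open>D z s t\<close> is, up to a small error, at most \<open>x A z + g (s - x) t\<close> or \<open>y B z + g s (t - y)\<close> for some \<open>x\<close> or \<open>y\<close>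
  (lemma \<open>drift_le_exit_value\<close>).  A bound on the second moment of the extended passage time suffices to
  pass from its mean to a statement in probability.  Consequently \<open>D z\<close> nearly touches \<open>g\<close> at some point
  \<open>(p, t)\<close> with \<open>p \<le> s\<close>, or at some point \<open>(s, q)\<close> with \<open>q \<le> t\<close>: in a direction to the left or to the right
  of \<open>(s, t)\<close> (lemma \<open>left_or_right_touch\<close>).

  If two nearby parameters touch on opposite sides of \<open>(s, t)\<close>, superadditivity and homogeneity of \<open>g\<close>
  transport the two near-equalities to \<open>(s, t)\<close> itself (lemma \<open>opposite_touches\<close>).  As the interval of
  parameters is connected, the only other possibility is that all parameters touch on the same side.
  Then a parameter close to the relevant end of the interval is combined with a single row, or column,
  whose rate is nearly minimal, along which the passage time grows at speed \<open>A \<beta>\<close>, or \<open>B (- \<alpha>)\<close>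
  (lemmas \<open>row_bound\<close> and \<open>column_bound\<close>).
\<close>

section \<open>Last-passage percolation on the grid\<close>

definition shift_weights :: "nat \<Rightarrow> nat \<Rightarrow> (nat \<times> nat \<Rightarrow> real) \<Rightarrow> (nat \<times> nat \<Rightarrow> real)" where
  "shift_weights k l w = (\<lambda>(i, j). w (i + k, j + l))"

lemma last_passage_cong:
  assumes "\<And>i j. 1 \<le> i \<Longrightarrow> i \<le> m \<Longrightarrow> 1 \<le> j \<Longrightarrow> j \<le> n \<Longrightarrow> v (i, j) = w (i, j)"
  shows "last_passage v m n = last_passage w m n"
  using assms by (induction v m n rule: last_passage.induct) auto

lemma last_passage_0_right [simp]: "last_passage w m 0 = 0"
  by (cases m) auto

lemma last_passage_nonneg:
  assumes "\<And>k. 0 \<le> w k"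
  shows "0 \<le> last_passage w m n"
  using assms by (induction w m n rule: last_passage.induct) (auto intro!: add_nonneg_nonneg simp: le_max_iff_disj)

lemma last_passage_mono:
  assumes "\<And>k. 0 \<le> w k" and "m \<le> m'" and "n \<le> n'"
  shows "last_passage w m n \<le> last_passage w m' n'"
proof -
  have right: "last_passage w i j \<le> last_passage w (Suc i) j" for i j
    by (cases j) (auto intro: order_trans[OF _ le_add_same_cancel1[THEN iffD2, OF assms(1)]])
  have up: "last_passage w i j \<le> last_passage w i (Suc j)" for i j
    by (cases i) (auto intro: order_trans[OF _ le_add_same_cancel1[THEN iffD2, OF assms(1)]])
  have "last_passage w m n \<le> last_passage w m' n"
    by (rule lift_Suc_mono_le[of "\<lambda>i. last_passage w i n"]) (use right assms in auto)
  also have "\<dots> \<le> last_passage w m' n'"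
    by (rule lift_Suc_mono_le[of "\<lambda>j. last_passage w m' j"]) (use up assms in auto)
  finally show ?thesis .
qed

text \<open>
  Concatenate an optimal path to \<open>(m, n)\<close> with an optimal path in the quadrant whose first cell is
  \<open>(m + 1, n + 1)\<close>.  The step that joins them crosses one further cell, which can only help as
  the weights are nonnegative.
\<close>

lemma last_passage_superadditive:
  assumes "\<And>k. 0 \<le> w k"
  shows "last_passage w m n + last_passage (shift_weights m n w) m' n' \<le> last_passage w (m + m') (n + n')"
proof (induction "shift_weights m n w" m' n' rule: last_passage.induct)
  case (1 j)
  then show ?case using last_passage_mono[OF assms] by simp
next
  case (2 i)
  then show ?case using last_passage_mono[OF assms] by simp
next
  case (3 i j)
  then show ?case by (auto simp: shift_weights_def ac_simps max_def split: if_splits)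
qed

lemma last_passage_shift_le:
  assumes "\<And>k. 0 \<le> w k" and "k + m \<le> m'" and "l + n \<le> n'"
  shows "last_passage (shift_weights k l w) m n \<le> last_passage w m' n'"
  using last_passage_superadditive[where w = w and m = k and n = l and m' = m and n' = n, OF assms(1)] last_passage_nonneg[where w = w and m = k and n = l, OF assms(1)]
    last_passage_mono[where w = w, OF assms] by linarith

lemma row_le_last_passage:
  "(\<Sum>i = 1..m. w (i, 1)) \<le> last_passage w m 1"
  by (induction m) (auto)

lemma column_le_last_passage:
  "(\<Sum>j = 1..n. w (1, j)) \<le> last_passage w 1 n"
  by (induction n) (auto)

text \<open>
  Last-passage times that also collect the weights on the two axes, started at the origin with value \<open>0\<close>.
\<close>

fun boundary_passage :: "(nat \<times> nat \<Rightarrow> real) \<Rightarrow> nat \<Rightarrow> nat \<Rightarrow> real" where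
  "boundary_passage w 0 0 = 0"
| "boundary_passage w (Suc i) 0 = boundary_passage w i 0 + w (Suc i, 0)"
| "boundary_passage w 0 (Suc j) = boundary_passage w 0 j + w (0, Suc j)"
| "boundary_passage w (Suc i) (Suc j) =
     max (boundary_passage w i (Suc j)) (boundary_passage w (Suc i) j) + w (Suc i, Suc j)"

lemma boundary_passage_bottom: "boundary_passage w m 0 = (\<Sum>i = 1..m. w (i, 0))"
  by (induction m) auto

lemma boundary_passage_left: "boundary_passage w 0 n = (\<Sum>j = 1..n. w (0, j))"
  by (induction n) auto

lemma last_passage_le_boundary_passage:
  assumes "\<And>k. 0 \<le> w k"
  shows "last_passage w m n \<le> boundary_passage w m n"
  using assms
  by (induction w m n rule: last_passage.induct)
     (auto simp: boundary_passage_bottom boundary_passage_left sum_nonneg intro: max.coboundedI1 max.coboundedI2)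

text \<open>
  Reflection in the diagonal exchanges the two axes; it halves the case distinctions below.
\<close>

definition transpose_weights :: "(nat \<times> nat \<Rightarrow> real) \<Rightarrow> (nat \<times> nat \<Rightarrow> real)" where
  "transpose_weights w = (\<lambda>(i, j). w (j, i))"

lemma transpose_weights_apply [simp]: "transpose_weights w (i, j) = w (j, i)"
  by (simp add: transpose_weights_def)

lemma transpose_transpose [simp]: "transpose_weights (transpose_weights w) = w"
  by (auto simp: transpose_weights_def)

lemma last_passage_transpose: "last_passage (transpose_weights w) n m = last_passage w m n"
  by (induction w m n rule: last_passage.induct) (auto simp: transpose_weights_def max.commute)

lemma boundary_passage_transpose: "boundary_passage (transpose_weights w) n m = boundary_passage w m n"
  by (induction w m n rule: boundary_passage.induct) (auto simp: transpose_weights_def max.commute)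

lemma shift_weights_transpose:
  "shift_weights l k (transpose_weights w) = transpose_weights (shift_weights k l w)"
  by (auto simp: shift_weights_def transpose_weights_def)

definition exits_bottom :: "(nat \<times> nat \<Rightarrow> real) \<Rightarrow> nat \<Rightarrow> nat \<Rightarrow> bool" where
  "exits_bottom w m n \<longleftrightarrow> (\<exists>k\<in>{1..m}. boundary_passage w m n
     \<le> (\<Sum>i = 1..k. w (i, 0)) + last_passage (shift_weights (k - 1) 0 w) (m - k + 1) n)"

text \<open>
  An optimal path first follows one of the axes, up to the cell \<open>k\<close> where it steps inside; from there on it
  is a path for \<open>last_passage\<close> in a shifted quadrant.  In the induction, a last step that is vertical becomes
  horizontal by transposition.
\<close>

lemma boundary_passage_exit:
  assumes "\<And>k. 0 \<le> w k" and "1 \<le> m" and "1 \<le> n"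
  shows "exits_bottom w m n \<or> exits_bottom (transpose_weights w) n m"
  using assms
proof (induction "m + n" arbitrary: w m n rule: less_induct)
  case less
  have horizontal: "exits_bottom v (Suc i) n' \<or> exits_bottom (transpose_weights v) n' (Suc i)"
    if v: "\<And>k. 0 \<le> v k" and size: "Suc i + n' = m + n" and n': "1 \<le> n'"
      and last: "boundary_passage v (Suc i) n' = boundary_passage v i n' + v (Suc i, n')" for v i n'
  proof (cases "i = 0")
    case True
    then have "exits_bottom (transpose_weights v) n' (Suc i)"
      using last n' unfolding exits_bottom_def boundary_passage_transpose
      by (intro bexI[of _ n'])
        (auto simp: boundary_passage_left transpose_weights_def shift_weights_def)
    then show ?thesis ..
  next
    case False
    have step: "last_passage x i' n' + x (Suc i', n') \<le> last_passage x (Suc i') n'" for x i'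
      using n' by (cases n') auto
    have "exits_bottom v i n' \<or> exits_bottom (transpose_weights v) n' i"
      using less(1)[of i n' v] size False v n' by simp
    then show ?thesis
    proof
      assume "exits_bottom v i n'"
      then obtain k where k: "k \<in> {1..i}" "boundary_passage v i n'
          \<le> (\<Sum>i = 1..k. v (i, 0)) + last_passage (shift_weights (k - 1) 0 v) (i - k + 1) n'"
        by (auto simp: exits_bottom_def)
      have "exits_bottom v (Suc i) n'"
        unfolding exits_bottom_def
        by (rule bexI[of _ k])
          (use k last step[of "shift_weights (k - 1) 0 v" "i - k + 1"] in
            \<open>auto simp: shift_weights_def Suc_diff_le simp del: last_passage.simps\<close>)
      then show ?thesis ..
    next
      assume "exits_bottom (transpose_weights v) n' i"
      then obtain k where k: "k \<in> {1..n'}" "boundary_passage v i n' \<le> (\<Sum>j = 1..k. transpose_weights v (j, 0))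
          + last_passage (shift_weights (k - 1) 0 (transpose_weights v)) (n' - k + 1) i"
        by (auto simp: exits_bottom_def boundary_passage_transpose)
      have "last_passage x l i + x (l, Suc i) \<le> last_passage x l (Suc i)" if "1 \<le> l" for x l
        using that by (cases l) auto
      from this[of "n' - k + 1" "shift_weights (k - 1) 0 (transpose_weights v)"]
      have "exits_bottom (transpose_weights v) n' (Suc i)"
        unfolding exits_bottom_def boundary_passage_transpose
        by (intro bexI[of _ k])
          (use k last in \<open>auto simp: shift_weights_def transpose_weights_def simp del: last_passage.simps\<close>)
      then show ?thesis ..
    qed
  qed
  obtain i j where ij: "m = Suc i" "n = Suc j" using less(3,4) by (metis Suc_le_D One_nat_def)
  consider "boundary_passage w m n = boundary_passage w i n + w (m, n)"
    | "boundary_passage w m n = boundary_passage w m j + w (m, n)"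
    by (cases "boundary_passage w i n \<le> boundary_passage w m j") (auto simp: ij)
  then show ?case
  proof cases
    case 1
    then show ?thesis using horizontal[of w i n] less(2,4) ij by simp
  next
    case 2
    have "0 \<le> transpose_weights w k" for k by (cases k) (simp add: less(2))
    moreover have "boundary_passage (transpose_weights w) n m
        = boundary_passage (transpose_weights w) j m + transpose_weights w (n, m)"
      using 2 by (simp add: boundary_passage_transpose)
    ultimately show ?thesis
      using horizontal[of "transpose_weights w" j m] less(3) ij by auto
  qed
qed

lemma shift_weights_shift_weights: "shift_weights k l (shift_weights k' l' w) = shift_weights (k + k') (l + l') w"
  by (auto simp: shift_weights_def fun_eq_iff ac_simps)

lemma exits_bottom_block:
  assumes w: "\<And>k. 0 \<le> w k" and ex: "exits_bottom w (M * u) n" and "1 \<le> u"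
  shows "\<exists>l<M. boundary_passage w (M * u) n
    \<le> (\<Sum>i = 1..(l + 1) * u. w (i, 0)) + last_passage (shift_weights (l * u) 0 w) ((M - l) * u) n"
proof -
  obtain k where k: "k \<in> {1..M * u}" "boundary_passage w (M * u) n
      \<le> (\<Sum>i = 1..k. w (i, 0)) + last_passage (shift_weights (k - 1) 0 w) (M * u - k + 1) n"
    using ex by (auto simp: exits_bottom_def)
  \<comment> \<open>Block \<open>l\<close> consists of the indices \<open>l u + 1, \<dots>, (l + 1) u\<close>.\<close>
  define l where "l = (k - 1) div u"
  have "k - 1 < M * u" using k by auto
  then have "l < M" unfolding l_def by (rule less_mult_imp_div_less)
  have lu: "l * u \<le> k - 1" by (simp add: l_def)
  have "k - 1 < (l + 1) * u" using \<open>1 \<le> u\<close> by (simp add: l_def dividend_less_div_times add.commute)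
  then have "k \<le> (l + 1) * u" by linarith
  then have "(\<Sum>i = 1..k. w (i, 0)) \<le> (\<Sum>i = 1..(l + 1) * u. w (i, 0))"
    using w by (intro sum_mono2) auto
  moreover have "last_passage (shift_weights (k - 1) 0 w) (M * u - k + 1) n
      \<le> last_passage (shift_weights (l * u) 0 w) ((M - l) * u) n"
  proof -
    have "shift_weights (k - 1) 0 w = shift_weights (k - 1 - l * u) 0 (shift_weights (l * u) 0 w)"
      by (simp only: shift_weights_shift_weights le_add_diff_inverse2[OF lu] add_0)
    moreover have "(k - 1 - l * u) + (M * u - k + 1) \<le> (M - l) * u"
      unfolding diff_mult_distrib using lu k(1) by (simp only: atLeastAtMost_iff) arith
    moreover have "0 \<le> shift_weights (l * u) 0 w k" for k by (cases k) (simp add: shift_weights_def w)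
    ultimately show ?thesis by (simp only:) (intro last_passage_shift_le, auto)
  qed
  ultimately show ?thesis using k(2) \<open>l < M\<close> by (intro exI[of _ l]) auto
qed

text \<open>
  A coarse version of the previous decomposition, with \<open>2 M\<close> alternatives however large \<open>u\<close> and
  \<open>v\<close> are: the exit point is rounded up to a multiple of \<open>u\<close> in the sum over the axis, and down in the
  passage time, which increases both terms.
\<close>

lemma boundary_passage_exit_block:
  assumes w: "\<And>k. 0 \<le> w k" and "1 \<le> M" "1 \<le> u" "1 \<le> v"
  shows "\<exists>l<M. boundary_passage w (M * u) (M * v)
        \<le> (\<Sum>i = 1..(l + 1) * u. w (i, 0)) + last_passage (shift_weights (l * u) 0 w) ((M - l) * u) (M * v) \<or>
      boundary_passage w (M * u) (M * v)
        \<le> (\<Sum>j = 1..(l + 1) * v. w (0, j)) + last_passage (shift_weights 0 (l * v) w) (M * u) ((M - l) * v)"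
proof -
  have w': "0 \<le> transpose_weights w k" for k by (cases k) (simp add: w)
  have "1 \<le> M * u" "1 \<le> M * v" using assms by (simp_all add: Suc_le_eq)
  from boundary_passage_exit[of w, OF w this] show ?thesis
  proof
    assume "exits_bottom w (M * u) (M * v)"
    from exits_bottom_block[of w, OF w this assms(3)] show ?thesis by blast
  next
    assume "exits_bottom (transpose_weights w) (M * v) (M * u)"
    from exits_bottom_block[of "transpose_weights w", OF w' this assms(4)]
    obtain l where "l < M" "boundary_passage w (M * u) (M * v) \<le> (\<Sum>j = 1..(l + 1) * v. w (0, j))
        + last_passage (shift_weights 0 (l * v) w) (M * u) ((M - l) * v)"
      by (auto simp: shift_weights_transpose last_passage_transpose boundary_passage_transpose)
    then show ?thesis by blast
  qed
qed

section \<open>The Burke property of exponential weights\<close>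

abbreviation exp_law :: "real \<Rightarrow> real measure" where
  "exp_law r \<equiv> density lborel (exponential_density r)"

lemma nn_integral_exp_law:
  assumes [measurable]: "f \<in> borel_measurable borel"
  shows "(\<integral>\<^sup>+x. f x \<partial>exp_law r) = (\<integral>\<^sup>+x. ennreal (exponential_density r x) * f x \<partial>lborel)"
  by (subst nn_integral_density) auto

text \<open>
  The minimum and the difference of independent exponentials of rates \<open>u\<close> and \<open>v\<close> are independent: the
  minimum is exponential of rate \<open>u + v\<close>, and the difference has the two-sided exponential density that
  appears as a factor.  The change of variables is carried out as two translations, one per variable.
\<close>

lemma exp_law_min_diff:
  fixes H :: "real \<times> real \<Rightarrow> ennreal"
  assumes [measurable]: "H \<in> borel_measurable (borel \<Otimes>\<^sub>M borel)" and u: "0 < u" and v: "0 < v"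
  shows "(\<integral>\<^sup>+y. \<integral>\<^sup>+x. H (min x y, x - y) \<partial>exp_law u \<partial>exp_law v) =
    (\<integral>\<^sup>+d. \<integral>\<^sup>+m. ennreal (u * v / (u + v) * exp (- u * max d 0 - v * max (- d) 0)) * H (m, d)
       \<partial>exp_law (u + v) \<partial>lborel)"
proof -
  let ?e = "\<lambda>r x. ennreal (exponential_density r x)"
  have dens: "?e v (m - min d 0) * ?e u (m - min d 0 + d)
      = ennreal (u * v / (u + v) * exp (- u * max d 0 - v * max (- d) 0)) * ?e (u + v) m" for m d
  proof (cases "m < 0")
    case True
    then show ?thesis by (auto simp: exponential_density_def min_def)
  next
    case False
    have e: "- (m - min d 0) * v + - (m - min d 0 + d) * u = (- u * max d 0 - v * max (- d) 0) + - m * (u + v)"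
      by (simp add: max_def min_def algebra_simps)
    have nn: "\<not> m - min d 0 < 0" "\<not> m - min d 0 + d < 0" using False by (auto simp: min_def)
    have "v * exp (- (m - min d 0) * v) * (u * exp (- (m - min d 0 + d) * u))
        = u * v * exp (- (m - min d 0) * v + - (m - min d 0 + d) * u)"
      by (simp only: exp_add) (simp add: ac_simps)
    also have "\<dots> = u * v / (u + v) * exp (- u * max d 0 - v * max (- d) 0) * ((u + v) * exp (- m * (u + v)))"
      unfolding e exp_add using u v by (simp add: field_simps)
    finally show ?thesis
      using u v False nn by (simp add: exponential_density_def ennreal_mult[symmetric])
  qed
  have "(\<integral>\<^sup>+y. \<integral>\<^sup>+x. H (min x y, x - y) \<partial>exp_law u \<partial>exp_law v)
      = (\<integral>\<^sup>+y. \<integral>\<^sup>+x. ?e v y * (?e u x * H (min x y, x - y)) \<partial>lborel \<partial>lborel)"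
    by (simp add: nn_integral_exp_law nn_integral_cmult)
  also have "\<dots> = (\<integral>\<^sup>+y. \<integral>\<^sup>+d. ?e v y * (?e u (y + d) * H (min (y + d) y, d)) \<partial>lborel \<partial>lborel)"
  proof (rule nn_integral_cong)
    fix y :: real
    show "(\<integral>\<^sup>+x. ?e v y * (?e u x * H (min x y, x - y)) \<partial>lborel)
      = (\<integral>\<^sup>+d. ?e v y * (?e u (y + d) * H (min (y + d) y, d)) \<partial>lborel)"
      by (subst nn_integral_real_affine[where c = 1 and t = y]) auto
  qed
  also have "\<dots> = (\<integral>\<^sup>+d. \<integral>\<^sup>+y. ?e v y * (?e u (y + d) * H (min (y + d) y, d)) \<partial>lborel \<partial>lborel)"
    by (rule lborel_pair.Fubini') measurable
  also have "\<dots> = (\<integral>\<^sup>+d. \<integral>\<^sup>+m. ?e v (m - min d 0) * (?e u (m - min d 0 + d) * H (m, d)) \<partial>lborel \<partial>lborel)"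
  proof (rule nn_integral_cong)
    fix d :: real
    have "(\<integral>\<^sup>+y. ?e v y * (?e u (y + d) * H (min (y + d) y, d)) \<partial>lborel)
      = (\<integral>\<^sup>+m. ?e v (- min d 0 + m) * (?e u (- min d 0 + m + d) * H (min (- min d 0 + m + d) (- min d 0 + m), d)) \<partial>lborel)"
      by (subst nn_integral_real_affine[where c = 1 and t = "- min d 0"]) auto
    also have "\<dots> = (\<integral>\<^sup>+m. ?e v (m - min d 0) * (?e u (m - min d 0 + d) * H (m, d)) \<partial>lborel)"
      by (intro nn_integral_cong) (auto simp: min_def algebra_simps)
    finally show "(\<integral>\<^sup>+y. ?e v y * (?e u (y + d) * H (min (y + d) y, d)) \<partial>lborel)
      = (\<integral>\<^sup>+m. ?e v (m - min d 0) * (?e u (m - min d 0 + d) * H (m, d)) \<partial>lborel)" .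
  qed
  also have "\<dots> = (\<integral>\<^sup>+d. \<integral>\<^sup>+m. ?e (u + v) m * (ennreal (u * v / (u + v) * exp (- u * max d 0 - v * max (- d) 0)) * H (m, d))
       \<partial>lborel \<partial>lborel)"
    unfolding mult.assoc[symmetric] dens by (simp add: ac_simps)
  also have "\<dots> = (\<integral>\<^sup>+d. \<integral>\<^sup>+m. ennreal (u * v / (u + v) * exp (- u * max d 0 - v * max (- d) 0)) * H (m, d)
       \<partial>exp_law (u + v) \<partial>lborel)"
    by (subst nn_integral_exp_law) auto
  finally show ?thesis .
qed

text \<open>
  In terms of minimum and difference, the map \<open>(x, y, w) \<mapsto> (w + (x - y)\<^sup>+, w + (y - x)\<^sup>+, min x y)\<close> keeps
  \<open>x - y\<close> and exchanges \<open>min x y\<close> with \<open>w\<close>.  By \<open>exp_law_min_diff\<close> these last two are independent of the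
  difference and have the same exponential law of rate \<open>u + v\<close>, so that exchanging them does not
  change the joint law.
\<close>

lemma exp_law_burke:
  fixes \<Phi> :: "real \<times> real \<times> real \<Rightarrow> ennreal"
  assumes [measurable]: "\<Phi> \<in> borel_measurable (borel \<Otimes>\<^sub>M borel \<Otimes>\<^sub>M borel)" and u: "0 < u" and v: "0 < v"
  shows "(\<integral>\<^sup>+w. \<integral>\<^sup>+y. \<integral>\<^sup>+x. \<Phi> (w + max (x - y) 0, w + max (y - x) 0, min x y)
            \<partial>exp_law u \<partial>exp_law v \<partial>exp_law (u + v))
       = (\<integral>\<^sup>+w. \<integral>\<^sup>+y. \<integral>\<^sup>+x. \<Phi> (x, y, w) \<partial>exp_law u \<partial>exp_law v \<partial>exp_law (u + v))"
proof -
  let ?E = "exp_law (u + v)"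
  let ?K = "\<lambda>d. ennreal (u * v / (u + v) * exp (- u * max d 0 - v * max (- d) 0))"
  interpret E: prob_space ?E using u v by (intro prob_space_exponential_density) auto
  interpret EE: pair_sigma_finite ?E ?E ..
  interpret LE: pair_sigma_finite lborel ?E ..
  have "(\<integral>\<^sup>+w. \<integral>\<^sup>+y. \<integral>\<^sup>+x. \<Phi> (w + max (x - y) 0, w + max (y - x) 0, min x y)
            \<partial>exp_law u \<partial>exp_law v \<partial>?E)
      = (\<integral>\<^sup>+w. \<integral>\<^sup>+d. \<integral>\<^sup>+m. ?K d * \<Phi> (w + max d 0, w + max (- d) 0, m) \<partial>?E \<partial>lborel \<partial>?E)"
    using exp_law_min_diff[OF _ u v, of "\<lambda>(m, d). \<Phi> (w + max d 0, w + max (- d) 0, m)" for w] by simp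
  also have "\<dots> = (\<integral>\<^sup>+d. \<integral>\<^sup>+w. \<integral>\<^sup>+m. ?K d * \<Phi> (w + max d 0, w + max (- d) 0, m) \<partial>?E \<partial>?E \<partial>lborel)"
    by (rule LE.Fubini') measurable
  also have "\<dots> = (\<integral>\<^sup>+d. \<integral>\<^sup>+m. \<integral>\<^sup>+w. ?K d * \<Phi> (w + max d 0, w + max (- d) 0, m) \<partial>?E \<partial>?E \<partial>lborel)"
    by (intro nn_integral_cong EE.Fubini') measurable
  also have "\<dots> = (\<integral>\<^sup>+m. \<integral>\<^sup>+d. \<integral>\<^sup>+w. ?K d * \<Phi> (w + max d 0, w + max (- d) 0, m) \<partial>?E \<partial>lborel \<partial>?E)"
    by (rule LE.Fubini'[symmetric]) measurable
  also have "\<dots> = (\<integral>\<^sup>+w. \<integral>\<^sup>+y. \<integral>\<^sup>+x. \<Phi> (min x y + max (x - y) 0, min x y + max (y - x) 0, w)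
            \<partial>exp_law u \<partial>exp_law v \<partial>?E)"
    using exp_law_min_diff[OF _ u v, of "\<lambda>(m, d). \<Phi> (m + max d 0, m + max (- d) 0, w)" for w] by simp
  also have "\<dots> = (\<integral>\<^sup>+w. \<integral>\<^sup>+y. \<integral>\<^sup>+x. \<Phi> (x, y, w) \<partial>exp_law u \<partial>exp_law v \<partial>?E)"
  proof -
    have "min x y + max (x - y) 0 = x" "min x y + max (y - x) 0 = y" for x y :: real by auto
    then show ?thesis by simp
  qed
  finally show ?thesis .
qed

lemma nn_integral_PiM_insert:
  fixes M :: "'i \<Rightarrow> 'a measure"
  assumes M: "\<And>i. i \<in> insert k I \<Longrightarrow> prob_space (M i)"
    and [measurable]: "f \<in> borel_measurable (PiM (insert k I) M)"
  shows "(\<integral>\<^sup>+\<omega>. f \<omega> \<partial>PiM (insert k I) M) = (\<integral>\<^sup>+X. \<integral>\<^sup>+x. f (X(k := x)) \<partial>M k \<partial>PiM I M)"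
proof -
  interpret K: prob_space "M k" using M by auto
  interpret I: prob_space "PiM I M" using M by (intro prob_space_PiM) auto
  interpret P: pair_sigma_finite "M k" "PiM I M" ..
  have [measurable]: "(\<lambda>(x, X). X(k := x)) \<in> measurable (M k \<Otimes>\<^sub>M PiM I M) (PiM (insert k I) M)"
    by measurable
  have "(\<integral>\<^sup>+\<omega>. f \<omega> \<partial>PiM (insert k I) M)
      = (\<integral>\<^sup>+\<omega>. f \<omega> \<partial>distr (M k \<Otimes>\<^sub>M PiM I M) (PiM (insert k I) M) (\<lambda>(x, X). X(k := x)))"
    using M by (subst distr_pair_PiM_eq_PiM) auto
  also have "\<dots> = (\<integral>\<^sup>+z. f ((snd z)(k := fst z)) \<partial>(M k \<Otimes>\<^sub>M PiM I M))"
    by (subst nn_integral_distr) (auto simp: case_prod_beta)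
  also have "\<dots> = (\<integral>\<^sup>+X. \<integral>\<^sup>+x. f (X(k := x)) \<partial>M k \<partial>PiM I M)"
    by (subst P.nn_integral_snd[symmetric]) auto
  finally show ?thesis .
qed

lemma PiM_UNIV_insert3:
  fixes r :: "'i \<Rightarrow> real" and f :: "('i \<Rightarrow> real) \<Rightarrow> ennreal"
  assumes r: "\<And>k. 0 < r k" and ne: "p \<noteq> q" "p \<noteq> s" "q \<noteq> s"
    and f: "f \<in> borel_measurable (PiM UNIV (\<lambda>_. borel))"
  shows "(\<integral>\<^sup>+\<omega>. f \<omega> \<partial>PiM UNIV (\<lambda>k. exp_law (r k))) =
    (\<integral>\<^sup>+X. \<integral>\<^sup>+w. \<integral>\<^sup>+y. \<integral>\<^sup>+x. f (X(s := w, q := y, p := x)) \<partial>exp_law (r p) \<partial>exp_law (r q) \<partial>exp_law (r s)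
      \<partial>PiM (- {p, q, s}) (\<lambda>k. exp_law (r k)))"
proof -
  let ?M = "\<lambda>k. exp_law (r k)"
  have M: "\<And>k. prob_space (?M k)" using r by (intro prob_space_exponential_density)
  have s: "sets (PiM I ?M) = sets (PiM I (\<lambda>_. borel))" for I by (intro sets_PiM_cong) auto
  have ins: "UNIV = insert p (- {p})" "- {p} = insert q (- {p, q})" "- {p, q} = insert s (- {p, q, s})"
    using ne by auto
  have f': "f \<in> borel_measurable (PiM UNIV ?M)" using f s measurable_cong_sets by blast
  have m1: "f \<in> borel_measurable (PiM (insert p (- {p})) ?M)" using f' ins(1) by metis
  have "(\<lambda>(X, x). X(p := x)) \<in> measurable (PiM (- {p}) ?M \<Otimes>\<^sub>M ?M p) (PiM (insert p (- {p})) ?M)"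
    by measurable
  from measurable_compose[OF this m1]
  have m1': "(\<lambda>(X, x). f (X(p := x))) \<in> borel_measurable (PiM (- {p}) ?M \<Otimes>\<^sub>M ?M p)"
    by (simp add: case_prod_beta')
  interpret p: sigma_finite_measure "?M p" using M by (simp add: prob_space_imp_sigma_finite)
  interpret q: sigma_finite_measure "?M q" using M by (simp add: prob_space_imp_sigma_finite)
  have m2: "(\<lambda>X. \<integral>\<^sup>+x. f (X(p := x)) \<partial>?M p) \<in> borel_measurable (PiM (insert q (- {p, q})) ?M)"
    using p.borel_measurable_nn_integral[OF m1'] ins(2) by metis
  have "(\<lambda>(X, x). X(q := x)) \<in> measurable (PiM (- {p, q}) ?M \<Otimes>\<^sub>M ?M q) (PiM (insert q (- {p, q})) ?M)"
    by measurable
  from measurable_compose[OF this m2]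
  have m2': "(\<lambda>(X, y). \<integral>\<^sup>+x. f (X(q := y, p := x)) \<partial>?M p) \<in> borel_measurable (PiM (- {p, q}) ?M \<Otimes>\<^sub>M ?M q)"
    by (simp add: case_prod_beta')
  have m3: "(\<lambda>X. \<integral>\<^sup>+y. \<integral>\<^sup>+x. f (X(q := y, p := x)) \<partial>?M p \<partial>?M q) \<in> borel_measurable (PiM (insert s (- {p, q, s})) ?M)"
    using q.borel_measurable_nn_integral[OF m2'] ins(3) by metis
  have "(\<integral>\<^sup>+\<omega>. f \<omega> \<partial>PiM UNIV ?M) = (\<integral>\<^sup>+X. \<integral>\<^sup>+x. f (X(p := x)) \<partial>?M p \<partial>PiM (- {p}) ?M)"
    using nn_integral_PiM_insert[OF M m1] ins(1) by metis
  also have "\<dots> = (\<integral>\<^sup>+X. \<integral>\<^sup>+y. \<integral>\<^sup>+x. f (X(q := y, p := x)) \<partial>?M p \<partial>?M q \<partial>PiM (- {p, q}) ?M)"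
    using nn_integral_PiM_insert[OF M m2] ins(2) by metis
  also have "\<dots> = (\<integral>\<^sup>+X. \<integral>\<^sup>+w. \<integral>\<^sup>+y. \<integral>\<^sup>+x. f (X(s := w, q := y, p := x)) \<partial>?M p \<partial>?M q \<partial>?M s \<partial>PiM (- {p, q, s}) ?M)"
    using nn_integral_PiM_insert[OF M m3] ins(3) by metis
  finally show ?thesis .
qed

text \<open>
  Storing the minimum in the coordinate \<open>s\<close>, instead of forgetting it, makes this a measure-preserving map
  of the whole product space; such maps can simply be composed.
\<close>

definition burke_flip :: "'i \<Rightarrow> 'i \<Rightarrow> 'i \<Rightarrow> ('i \<Rightarrow> real) \<Rightarrow> ('i \<Rightarrow> real)" where
  "burke_flip p q s X =
    (X(s := min (X p) (X q), q := X s + max (X q - X p) 0, p := X s + max (X p - X q) 0))"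

lemma measurable_burke_flip [measurable]:
  "burke_flip p q s \<in> measurable (PiM UNIV (\<lambda>_. borel)) (PiM UNIV (\<lambda>_. borel))"
  unfolding burke_flip_def
  by (rule measurable_PiM_single') (auto simp: fun_upd_def)

lemma distr_burke_flip:
  fixes r :: "'i \<Rightarrow> real"
  assumes r: "\<And>k. 0 < r k" and ne: "p \<noteq> q" "p \<noteq> s" "q \<noteq> s" and rs: "r s = r p + r q"
  shows "distr (PiM UNIV (\<lambda>k. exp_law (r k))) (PiM UNIV (\<lambda>_. borel)) (burke_flip p q s)
       = PiM UNIV (\<lambda>k. exp_law (r k))" (is "distr ?P ?B _ = _")
proof (rule measure_eqI)
  have sP [measurable_cong]: "sets ?P = sets ?B" by (intro sets_PiM_cong) auto
  then show "sets (distr ?P ?B (burke_flip p q s)) = sets ?P" by simp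
  fix A assume "A \<in> sets (distr ?P ?B (burke_flip p q s))"
  then have A [measurable]: "A \<in> sets ?B" by simp
  let ?f = "indicator A :: ('i \<Rightarrow> real) \<Rightarrow> ennreal"
  have upd: "(\<lambda>(x, y, w). X(s := w, q := y, p := x)) \<in> measurable (borel \<Otimes>\<^sub>M borel \<Otimes>\<^sub>M borel) ?B" for X :: "'i \<Rightarrow> real"
    by (rule measurable_PiM_single') (auto simp: fun_upd_def case_prod_beta')
  have "emeasure (distr ?P ?B (burke_flip p q s)) A = (\<integral>\<^sup>+\<omega>. ?f (burke_flip p q s \<omega>) \<partial>?P)"
    by (subst nn_integral_indicator[symmetric], simp, subst nn_integral_distr) auto
  also have "\<dots> = (\<integral>\<^sup>+X. \<integral>\<^sup>+w. \<integral>\<^sup>+y. \<integral>\<^sup>+x. ?f (X(s := min x y, q := w + max (y - x) 0, p := w + max (x - y) 0))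
      \<partial>exp_law (r p) \<partial>exp_law (r q) \<partial>exp_law (r s) \<partial>PiM (- {p, q, s}) (\<lambda>k. exp_law (r k)))"
  proof -
    have m: "(\<lambda>\<omega>. ?f (burke_flip p q s \<omega>)) \<in> borel_measurable ?B" by measurable
    have "burke_flip p q s (X(s := w, q := y, p := x))
        = X(s := min x y, q := w + max (y - x) 0, p := w + max (x - y) 0)" for X x y w
      using ne by (auto simp: burke_flip_def)
    then show ?thesis by (subst PiM_UNIV_insert3[OF r ne m]) simp
  qed
  also have "\<dots> = (\<integral>\<^sup>+X. \<integral>\<^sup>+w. \<integral>\<^sup>+y. \<integral>\<^sup>+x. ?f (X(s := w, q := y, p := x))
      \<partial>exp_law (r p) \<partial>exp_law (r q) \<partial>exp_law (r s) \<partial>PiM (- {p, q, s}) (\<lambda>k. exp_law (r k)))"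
  proof -
    have "(\<integral>\<^sup>+w. \<integral>\<^sup>+y. \<integral>\<^sup>+x. ?f (X(s := min x y, q := w + max (y - x) 0, p := w + max (x - y) 0))
        \<partial>exp_law (r p) \<partial>exp_law (r q) \<partial>exp_law (r s))
      = (\<integral>\<^sup>+w. \<integral>\<^sup>+y. \<integral>\<^sup>+x. ?f (X(s := w, q := y, p := x)) \<partial>exp_law (r p) \<partial>exp_law (r q) \<partial>exp_law (r s))" for X
      using exp_law_burke[OF measurable_compose[OF upd borel_measurable_indicator[OF A]] r[of p] r[of q]]
      unfolding rs by simp
    then show ?thesis by simp
  qed
  also have "\<dots> = (\<integral>\<^sup>+\<omega>. ?f \<omega> \<partial>?P)"
    by (subst PiM_UNIV_insert3[OF r ne]) auto
  also have "\<dots> = emeasure ?P A" by simp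
  finally show "emeasure (distr ?P ?B (burke_flip p q s)) A = emeasure ?P A" .
qed

text \<open>
  The increments of \<open>boundary_passage\<close> are computed in place.  Coordinate \<open>(i, 0)\<close> carries the latest
  horizontal increment of column \<open>i\<close>, coordinate \<open>(0, j)\<close> the latest vertical increment of row \<open>j\<close>, and
  cell \<open>(i, j)\<close> is processed by one \<open>burke_flip\<close>.  All coordinates thereby keep the rate that belongs to
  their index.
\<close>

primrec column_sweep :: "nat \<Rightarrow> nat \<Rightarrow> (nat \<times> nat \<Rightarrow> real) \<Rightarrow> (nat \<times> nat \<Rightarrow> real)" where
  "column_sweep i 0 w = w"
| "column_sweep i (Suc j) w = burke_flip (i, 0) (0, Suc j) (i, Suc j) (column_sweep i j w)"

primrec sweep :: "nat \<Rightarrow> nat \<Rightarrow> (nat \<times> nat \<Rightarrow> real) \<Rightarrow> (nat \<times> nat \<Rightarrow> real)" where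
  "sweep n 0 w = w"
| "sweep n (Suc i) w = column_sweep (Suc i) n (sweep n i w)"

lemma column_sweep_increments:
  assumes old: "\<And>j. 1 \<le> j \<Longrightarrow> j \<le> n \<Longrightarrow> v (0, j) = boundary_passage w i j - boundary_passage w i (j - 1)"
    and fresh: "\<And>k j. i < k \<Longrightarrow> v (k, j) = w (k, j)"
    and "j \<le> n"
  shows "(\<forall>j'. 1 \<le> j' \<longrightarrow> j' \<le> j \<longrightarrow> column_sweep (Suc i) j v (0, j')
            = boundary_passage w (Suc i) j' - boundary_passage w (Suc i) (j' - 1)) \<and>
         (\<forall>j'>j. column_sweep (Suc i) j v (0, j') = v (0, j')) \<and>
         column_sweep (Suc i) j v (Suc i, 0) = boundary_passage w (Suc i) j - boundary_passage w i j \<and>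
         (\<forall>j'>j. column_sweep (Suc i) j v (Suc i, j') = w (Suc i, j')) \<and>
         (\<forall>k j'. Suc i < k \<longrightarrow> column_sweep (Suc i) j v (k, j') = w (k, j'))"
  using \<open>j \<le> n\<close>
proof (induction j)
  case 0
  then show ?case using fresh by simp
next
  case (Suc j)
  let ?u = "column_sweep (Suc i) j v"
  have IH: "\<And>j'. 1 \<le> j' \<Longrightarrow> j' \<le> j \<Longrightarrow> ?u (0, j') = boundary_passage w (Suc i) j' - boundary_passage w (Suc i) (j' - 1)"
    "\<And>j'. j < j' \<Longrightarrow> ?u (0, j') = v (0, j')"
    "?u (Suc i, 0) = boundary_passage w (Suc i) j - boundary_passage w i j"
    "\<And>j'. j < j' \<Longrightarrow> ?u (Suc i, j') = w (Suc i, j')"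
    "\<And>k j'. Suc i < k \<Longrightarrow> ?u (k, j') = w (k, j')"
    using Suc by auto
  have J: "?u (0, Suc j) = boundary_passage w i (Suc j) - boundary_passage w i j"
    using IH(2)[of "Suc j"] old[of "Suc j"] Suc(2) by simp
  have J': "burke_flip (Suc i, 0) (0, Suc j) (Suc i, Suc j) ?u (0, Suc j)
      = boundary_passage w (Suc i) (Suc j) - boundary_passage w (Suc i) j"
    unfolding burke_flip_def using J IH(3) IH(4)[of "Suc j"] by (auto simp: max_def)
  have I': "burke_flip (Suc i, 0) (0, Suc j) (Suc i, Suc j) ?u (Suc i, 0)
      = boundary_passage w (Suc i) (Suc j) - boundary_passage w i (Suc j)"
    unfolding burke_flip_def using J IH(3) IH(4)[of "Suc j"] by (auto simp: max_def)
  have rest: "burke_flip (Suc i, 0) (0, Suc j) (Suc i, Suc j) ?u k = ?u k"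
    if "k \<noteq> (Suc i, 0)" "k \<noteq> (0, Suc j)" "k \<noteq> (Suc i, Suc j)" for k
    using that by (simp add: burke_flip_def)
  show ?case
    unfolding column_sweep.simps
  proof (intro conjI allI impI)
    fix j' assume "1 \<le> j'" "j' \<le> Suc j"
    then show "burke_flip (Suc i, 0) (0, Suc j) (Suc i, Suc j) ?u (0, j')
      = boundary_passage w (Suc i) j' - boundary_passage w (Suc i) (j' - 1)"
      using J' IH(1)[of j'] rest[of "(0, j')"] by (cases "j' = Suc j") auto
  qed (use I' IH rest in auto)
qed

lemma sweep_increments:
  "(\<forall>j. 1 \<le> j \<longrightarrow> j \<le> n \<longrightarrow> sweep n i w (0, j) = boundary_passage w i j - boundary_passage w i (j - 1)) \<and>
   (\<forall>k j. i < k \<longrightarrow> sweep n i w (k, j) = w (k, j))"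
proof (induction i)
  case 0
  have "boundary_passage w 0 j - boundary_passage w 0 (j - 1) = w (0, j)" if "1 \<le> j" for j
    using that by (cases j) auto
  then show ?case by simp
next
  case (Suc i)
  then show ?case using column_sweep_increments[of n "sweep n i w" w i n] by simp
qed

text \<open>
  The increments along the path that runs right on the axis and then up column \<open>m\<close>.
\<close>

lemma boundary_passage_sweep:
  "boundary_passage w m n = (\<Sum>i = 1..m. w (i, 0)) + (\<Sum>j = 1..n. sweep n m w (0, j))"
proof -
  have "(\<Sum>j = 1..n. sweep n m w (0, j)) = (\<Sum>j = 1..n. boundary_passage w m j - boundary_passage w m (j - 1))"
    using sweep_increments[of n m w] by (intro sum.cong) auto
  also have "\<dots> = boundary_passage w m n - boundary_passage w m 0"
    by (induction n) auto
  finally show ?thesis by (simp add: boundary_passage_bottom)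
qed

lemma measurable_boundary_passage [measurable]:
  assumes [measurable]: "\<And>k. (\<lambda>x. w x k) \<in> borel_measurable M"
  shows "(\<lambda>x. boundary_passage (w x) m n) \<in> borel_measurable M"
proof (induction "m + n" arbitrary: m n rule: less_induct)
  case less
  then have [measurable]: "m' + n' < m + n \<Longrightarrow> (\<lambda>x. boundary_passage (w x) m' n') \<in> borel_measurable M" for m' n' by blast
  show ?case by (cases m; cases n) (auto intro!: borel_measurable_add borel_measurable_max assms)
qed

lemma measurable_last_passage [measurable]:
  assumes [measurable]: "\<And>i j. 1 \<le> i \<Longrightarrow> 1 \<le> j \<Longrightarrow> (\<lambda>x. w x (i, j)) \<in> borel_measurable M"
  shows "(\<lambda>x. last_passage (w x) m n) \<in> borel_measurable M"
proof (induction "m + n" arbitrary: m n rule: less_induct)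
  case less
  then have [measurable]: "m' + n' < m + n \<Longrightarrow> (\<lambda>x. last_passage (w x) m' n') \<in> borel_measurable M" for m' n' by blast
  show ?case by (cases m; cases n) (auto intro!: borel_measurable_add borel_measurable_max assms)
qed

lemma distr_sweep:
  assumes r: "\<And>k. 0 < r k" and add: "\<And>i j. 1 \<le> i \<Longrightarrow> 1 \<le> j \<Longrightarrow> r (i, j) = r (i, 0) + r (0, j)"
  shows "sweep n m \<in> measurable (PiM UNIV (\<lambda>_. borel)) (PiM UNIV (\<lambda>_. borel)) \<and>
    distr (PiM UNIV (\<lambda>k. exp_law (r k))) (PiM UNIV (\<lambda>_. borel)) (sweep n m) = PiM UNIV (\<lambda>k. exp_law (r k))"
    (is "_ \<in> measurable ?B ?B \<and> distr ?P ?B _ = ?P")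
proof -
  define good where "good f \<longleftrightarrow> f \<in> measurable ?B ?B \<and> distr ?P ?B f = ?P" for f
  have sP [measurable_cong]: "sets ?P = sets ?B" by (intro sets_PiM_cong) auto
  have comp: "good (\<lambda>w. f (g w))" if "good f" "good g" for f g
  proof -
    have [measurable]: "f \<in> measurable ?B ?B" "g \<in> measurable ?B ?B" using that by (auto simp: good_def)
    have "distr ?P ?B (\<lambda>w. f (g w)) = distr (distr ?P ?B g) ?B f"
      by (subst distr_distr) (auto simp: comp_def)
    then show ?thesis using that by (simp add: good_def)
  qed
  have id: "good (\<lambda>w. w)"
    unfolding good_def using distr_id2[OF sP[symmetric]] by simp
  have col: "good (column_sweep (Suc i) j)" for i j
  proof (induction j)
    case 0
    show ?case using id by (simp add: good_def)
  next
    case (Suc j)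
    have "good (burke_flip (Suc i, 0) (0, Suc j) (Suc i, Suc j))"
      unfolding good_def using add[of "Suc i" "Suc j"]
      by (auto intro!: distr_burke_flip r)
    from comp[OF this Suc] show ?case by (simp add: good_def)
  qed
  have "good (sweep n m)"
  proof (induction m)
    case 0
    show ?case using id by (simp add: good_def)
  next
    case (Suc m)
    from comp[OF col this] show ?case by (simp add: good_def)
  qed
  then show ?thesis by (simp add: good_def)
qed

lemma distributed_component:
  fixes r :: "'i \<Rightarrow> real"
  assumes r: "\<And>k. 0 < r k"
  shows "distributed (PiM UNIV (\<lambda>k. exp_law (r k))) lborel (\<lambda>\<omega>. \<omega> k) (exponential_density (r k))"
proof -
  let ?P = "PiM UNIV (\<lambda>k. exp_law (r k))"
  have "distr ?P lborel (\<lambda>\<omega>. \<omega> k) = distr ?P (exp_law (r k)) (\<lambda>\<omega>. \<omega> k)"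
    by (rule distr_cong) auto
  also have "\<dots> = exp_law (r k)"
    using r by (intro distr_PiM_component prob_space_exponential_density) auto
  finally show ?thesis
    by (auto simp: distributed_def)
qed

lemma distributed_sweep:
  assumes r: "\<And>k. 0 < r k" and add: "\<And>i j. 1 \<le> i \<Longrightarrow> 1 \<le> j \<Longrightarrow> r (i, j) = r (i, 0) + r (0, j)"
  shows "distributed (PiM UNIV (\<lambda>k. exp_law (r k))) lborel (\<lambda>\<omega>. sweep n m \<omega> k) (exponential_density (r k))"
proof -
  let ?P = "PiM UNIV (\<lambda>k. exp_law (r k))" and ?B = "PiM UNIV (\<lambda>_. borel) :: (nat \<times> nat \<Rightarrow> real) measure"
  have sP [measurable_cong]: "sets ?P = sets ?B" by (intro sets_PiM_cong) auto
  have [measurable]: "sweep n m \<in> measurable ?B ?B"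
    and eq: "distr ?P ?B (sweep n m) = ?P" using distr_sweep[where r = r, OF assms] by auto
  have "distr ?P lborel (\<lambda>\<omega>. sweep n m \<omega> k) = distr (distr ?P ?B (sweep n m)) lborel (\<lambda>\<omega>. \<omega> k)"
    by (subst distr_distr) (auto simp: comp_def)
  also have "\<dots> = exp_law (r k)"
    unfolding eq using distributed_component[where r = r and k = k, OF r] by (auto simp: distributed_def)
  finally show ?thesis
    by (auto simp: distributed_def)
qed

text \<open>
  By \<open>boundary_passage_sweep\<close> the passage time is a sum of \<open>m + n\<close> variables whose individual laws are known
  exponentials; the mean and the Cauchy--Schwarz bound are functions of these laws alone.
\<close>

lemma boundary_passage_moments:
  fixes r :: "nat \<times> nat \<Rightarrow> real"
  assumes r: "\<And>k. 0 < r k" and add: "\<And>i j. 1 \<le> i \<Longrightarrow> 1 \<le> j \<Longrightarrow> r (i, j) = r (i, 0) + r (0, j)"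
  defines "P \<equiv> PiM UNIV (\<lambda>k. exp_law (r k))"
  shows "has_bochner_integral P (\<lambda>\<omega>. boundary_passage \<omega> m n) ((\<Sum>i = 1..m. 1 / r (i, 0)) + (\<Sum>j = 1..n. 1 / r (0, j)))"
    and "integrable P (\<lambda>\<omega>. (boundary_passage \<omega> m n)\<^sup>2)"
    and "(\<integral>\<omega>. (boundary_passage \<omega> m n)\<^sup>2 \<partial>P)
      \<le> real (m + n) * ((\<Sum>i = 1..m. 2 / (r (i, 0))\<^sup>2) + (\<Sum>j = 1..n. 2 / (r (0, j))\<^sup>2))"
proof -
  interpret P: prob_space P
    unfolding P_def using r by (intro prob_space_PiM prob_space_exponential_density)
  note D1 = distributed_component[where r = r, OF r, folded P_def]
  note D2 = distributed_sweep[where r = r, OF assms(1,2), folded P_def]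
  have I1: "has_bochner_integral P (\<lambda>\<omega>. \<omega> k) (1 / r k)"
    and S1: "has_bochner_integral P (\<lambda>\<omega>. (\<omega> k)\<^sup>2) (2 / (r k)\<^sup>2)"
    and I2: "has_bochner_integral P (\<lambda>\<omega>. sweep n m \<omega> k) (1 / r k)"
    and S2: "has_bochner_integral P (\<lambda>\<omega>. (sweep n m \<omega> k)\<^sup>2) (2 / (r k)\<^sup>2)" for k
    using P.has_bochner_integral_erlang_ith_moment[OF r D1, of k 1]
      P.has_bochner_integral_erlang_ith_moment[OF r D1, of k 2]
      P.has_bochner_integral_erlang_ith_moment[OF r D2, of n m k 1]
      P.has_bochner_integral_erlang_ith_moment[OF r D2, of n m k 2]
    by (auto simp: numeral_2_eq_2)
  show hb: "has_bochner_integral P (\<lambda>\<omega>. boundary_passage \<omega> m n) ((\<Sum>i = 1..m. 1 / r (i, 0)) + (\<Sum>j = 1..n. 1 / r (0, j)))"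
    unfolding boundary_passage_sweep
    by (intro has_bochner_integral_add has_bochner_integral_sum I1 I2)
  let ?S = "\<lambda>\<omega>. real (m + n) * ((\<Sum>i = 1..m. (\<omega> (i, 0))\<^sup>2) + (\<Sum>j = 1..n. (sweep n m \<omega> (0, j))\<^sup>2))"
  have bd: "has_bochner_integral P ?S
      (real (m + n) * ((\<Sum>i = 1..m. 2 / (r (i, 0))\<^sup>2) + (\<Sum>j = 1..n. 2 / (r (0, j))\<^sup>2)))"
    by (intro has_bochner_integral_mult_right has_bochner_integral_add has_bochner_integral_sum S1 S2)
  have le: "(boundary_passage \<omega> m n)\<^sup>2 \<le> ?S \<omega>" for \<omega>
  proof -
    let ?x = "\<lambda>k. case k of Inl i \<Rightarrow> \<omega> (i, 0) | Inr j \<Rightarrow> sweep n m \<omega> (0, j)"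
    let ?K = "{1..m} <+> {1..n}"
    have "boundary_passage \<omega> m n = (\<Sum>k\<in>?K. ?x k)"
      unfolding boundary_passage_sweep by (subst sum.Plus) auto
    moreover have "real (card ?K) * (\<Sum>k\<in>?K. (?x k)\<^sup>2) = ?S \<omega>"
      by (subst sum.Plus) (auto simp: card_Plus)
    ultimately show ?thesis using sum_squared_le_sum_of_squares[of ?x ?K] by (simp add: mult.commute)
  qed
  show int2: "integrable P (\<lambda>\<omega>. (boundary_passage \<omega> m n)\<^sup>2)"
    by (rule Bochner_Integration.integrable_bound[OF integrable.intros[OF bd]])
       (use hb order_trans[OF le abs_ge_self] in auto)
  show "(\<integral>\<omega>. (boundary_passage \<omega> m n)\<^sup>2 \<partial>P)
      \<le> real (m + n) * ((\<Sum>i = 1..m. 2 / (r (i, 0))\<^sup>2) + (\<Sum>j = 1..n. 2 / (r (0, j))\<^sup>2))"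
    by (rule order_trans[OF integral_mono[OF int2 integrable.intros[OF bd] le] eq_refl[OF has_bochner_integral_integral_eq[OF bd]]])
qed

section \<open>Ergodic averages\<close>

text \<open>
  The argument of Katznelson and Weiss.  The set of points whose averages exceed some \<open>q > c\<close> infinitely
  often is invariant.  If it had probability one, almost every orbit could be cut into bounded blocks on which the
  average is at least \<open>c\<close>, except on a set of small measure where \<open>f\<close> is raised by \<open>c\<close> so that blocks of length
  one suffice; integrating over a long stretch of the orbit then contradicts \<open>\<integral> f < c\<close>.
\<close>

lemma ergodic_sums_eventually_le:
  fixes f :: "'a \<Rightarrow> real"
  assumes "prob_space M" and erg: "ergodic_map M T" and int: "integrable M f"
    and nonneg: "\<And>x. x \<in> space M \<Longrightarrow> 0 \<le> f x" and c: "(\<integral>x. f x \<partial>M) < c"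
  shows "AE x in M. \<forall>q. c < q \<longrightarrow> (\<forall>\<^sub>F n in sequentially. (\<Sum>i<n. f ((T ^^ i) x)) < q * real n)"
proof -
  interpret prob_space M by fact
  define S where "S h n x = (\<Sum>i<n. h ((T ^^ i) x) :: real)" for h n x
  have T [measurable]: "T \<in> measurable M M" and dT: "distr M M T = M"
    using erg by (auto simp: ergodic_map_def stationary_map_def)
  have Tn [measurable]: "(\<lambda>x. (T ^^ i) x) \<in> measurable M M" for i
    by (induction i) (auto intro: measurable_compose[OF _ T])
  have dTn: "distr M M (T ^^ i) = M" for i
  proof (induction i)
    case (Suc i)
    have "distr M M (T ^^ Suc i) = distr (distr M M (T ^^ i)) M T"
      by (subst distr_distr) (auto simp: comp_def)
    then show ?case using Suc dT by (simp add: comp_def)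
  qed (simp add: distr_id2)
  have T_space: "(T ^^ i) x \<in> space M" if "x \<in> space M" for i x
    using measurable_space[OF Tn that] .
  have fm [measurable]: "f \<in> borel_measurable M" using int by simp
  have Sm [measurable]: "S f n \<in> borel_measurable M" for n
    unfolding S_def by measurable
  have S_Suc: "S h (Suc n) x = h x + S h n (T x)" for h n x
    unfolding S_def by (simp add: sum.lessThan_Suc_shift funpow_swap1 del: sum.lessThan_Suc)
  have S_add: "S h (n + m) x = S h n x + S h m ((T ^^ n) x)" for h n m x
    by (induction n arbitrary: x) (simp_all add: S_Suc funpow_swap1, simp add: S_def)
  define A where "A = {x \<in> space M. \<exists>q\<in>\<rat>. c < q \<and> (\<exists>\<^sub>F n in sequentially. q * real n \<le> S f n x)}"
  have [measurable]: "A \<in> sets M"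
    unfolding A_def frequently_sequentially by (measurable; auto intro: countable_rat)
  have "T -` A \<inter> space M = A"
  proof (intro set_eqI iffI)
    fix x assume "x \<in> T -` A \<inter> space M"
    then obtain q where q: "q \<in> \<rat>" "c < q" "\<exists>\<^sub>F n in sequentially. q * real n \<le> S f n (T x)" and x: "x \<in> space M"
      by (auto simp: A_def)
    obtain q' where q': "q' \<in> \<rat>" "c < q'" "q' < q" using Rats_dense_in_real[OF q(2)] by auto
    have "\<exists>n\<ge>N. q' * real n \<le> S f n x" for N
    proof -
      obtain N0 where N0: "q' / (q - q') \<le> real N0" using real_arch_simple by blast
      obtain n where n: "max N N0 \<le> n" "q * real n \<le> S f n (T x)"
        using q(3) unfolding frequently_sequentially by blast
      have "q' / (q - q') \<le> real n" using N0 n by linarith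
      then have "q' * real (Suc n) \<le> q * real n" using q' by (simp add: field_simps)
      then have "q' * real (Suc n) \<le> S f (Suc n) x"
        using n(2) nonneg[OF x] by (simp add: S_Suc)
      then show ?thesis using n(1) by (intro exI[of _ "Suc n"]) simp
    qed
    then have "\<exists>\<^sub>F n in sequentially. q' * real n \<le> S f n x"
      unfolding frequently_sequentially by blast
    then show "x \<in> A" using q' x by (auto simp: A_def)
  next
    fix x assume "x \<in> A"
    then obtain q where q: "q \<in> \<rat>" "c < q" "\<exists>\<^sub>F n in sequentially. q * real n \<le> S f n x" and x: "x \<in> space M"
      by (auto simp: A_def)
    obtain q' where q': "q' \<in> \<rat>" "c < q'" "q' < q" using Rats_dense_in_real[OF q(2)] by auto
    have "\<exists>n\<ge>N. q' * real n \<le> S f n (T x)" for N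
    proof -
      obtain N0 where N0: "(f x - q) / (q - q') \<le> real N0" using real_arch_simple by blast
      obtain n where n: "Suc (max N N0) \<le> n" "q * real n \<le> S f n x"
        using q(3) unfolding frequently_sequentially by blast
      then obtain k where k: "n = Suc k" "max N N0 \<le> k" by (metis Suc_le_D Suc_le_mono)
      have "(f x - q) / (q - q') \<le> real k" using N0 k by linarith
      then have "f x - q \<le> real k * (q - q')" using q' by (simp add: field_simps)
      then have "q' * real k \<le> S f k (T x)"
        using n(2) unfolding k S_Suc by (simp add: algebra_simps)
      then show ?thesis using k(2) by (intro exI[of _ k]) simp
    qed
    then have "\<exists>\<^sub>F n in sequentially. q' * real n \<le> S f n (T x)"
      unfolding frequently_sequentially by blast
    then show "x \<in> T -` A \<inter> space M" using q' x T_space[OF x, of 1] by (auto simp: A_def)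
  qed
  with erg have "prob A = 0 \<or> prob A = 1" by (auto simp: ergodic_map_def)
  moreover have "prob A \<noteq> 1"
  proof
    assume A1: "prob A = 1"
    have "0 \<le> (\<integral>x. f x \<partial>M)" by (intro integral_nonneg_AE AE_I2 nonneg)
    then have c0: "0 < c" using c by simp
    define G where "G L = {x \<in> space M. \<exists>n\<in>{1..L}. c * real n < S f n x}" for L
    have Gm [measurable]: "G L \<in> sets M" for L unfolding G_def by measurable
    have "A \<subseteq> (\<Union>L. G L)"
    proof
      fix x assume "x \<in> A"
      then obtain q where q: "c < q" "\<exists>\<^sub>F n in sequentially. q * real n \<le> S f n x" and x: "x \<in> space M"
        by (auto simp: A_def)
      from q(2) obtain n where n: "1 \<le> n" "q * real n \<le> S f n x"
        unfolding frequently_sequentially by auto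
      have "c * real n < q * real n" using q(1) n(1) by simp
      then have "c * real n < S f n x" using n(2) by linarith
      then have "x \<in> G n" using n x by (auto simp: G_def intro!: bexI[of _ n])
      then show "x \<in> (\<Union>L. G L)" by auto
    qed
    then have "prob A \<le> prob (\<Union>L. G L)" by (intro finite_measure_mono) auto
    then have U1: "prob (\<Union>L. G L) = 1" using A1 prob_le_1[of "\<Union>L. G L"] by linarith
    have "(\<lambda>L. prob (G L)) \<longlonglongrightarrow> prob (\<Union>L. G L)"
    proof (rule finite_Lim_measure_incseq)
      show "incseq G"
      proof (rule incseq_SucI)
        fix L show "G L \<le> G (Suc L)" unfolding G_def by (auto intro!: bexI)
      qed
    qed auto
    define \<eta> where "\<eta> = (c - (\<integral>x. f x \<partial>M)) / (2 * c)"
    have \<eta>: "0 < \<eta>" using c c0 by (simp add: \<eta>_def)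
    have "\<forall>\<^sub>F L in sequentially. 1 - \<eta> < prob (G L)"
      using \<open>(\<lambda>L. prob (G L)) \<longlonglongrightarrow> prob (\<Union>L. G L)\<close> \<eta> unfolding U1 by (intro order_tendstoD(1)) auto
    then obtain L where L: "1 - \<eta> < prob (G L)" "1 \<le> L"
      using eventually_happens'[OF _ eventually_conj[OF _ eventually_ge_at_top[of 1]]] sequentially_bot by blast
    \<comment> \<open>Off \<open>G L\<close>, where no block of length at most \<open>L\<close> works for \<open>f\<close>, the block of length one works for \<open>h\<close>.\<close>
    define h where "h x = f x + c * indicator (space M - G L) x" for x
    have hf: "f x \<le> h x" for x using c0 by (auto simp: h_def indicator_def)
    have h_int: "integrable M h" unfolding h_def using int
      by (intro Bochner_Integration.integrable_add integrable_mult_right integrable_real_indicator) (auto simp: emeasure_eq_measure)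
    have ret: "\<exists>n\<in>{1..L}. c * real n \<le> S h n x" if x: "x \<in> space M" for x
    proof (cases "x \<in> G L")
      case True
      then obtain n where n: "n \<in> {1..L}" "c * real n < S f n x" by (auto simp: G_def)
      have "S f n x \<le> S h n x" unfolding S_def by (intro sum_mono hf)
      then show ?thesis using n by force
    next
      case False
      then have "c * real 1 \<le> S h 1 x" using x nonneg[OF x] by (simp add: S_def h_def)
      then show ?thesis using L by (intro bexI[of _ 1]) auto
    qed
    \<comment> \<open>Only the last block, of length at most \<open>L\<close>, may be incomplete.\<close>
    have low: "c * (real m - real L) \<le> S h m x" if "x \<in> space M" for m x
      using that
    proof (induction m arbitrary: x rule: less_induct)
      case (less m)
      show ?case
      proof (cases "m \<le> L")
        case True
        have "0 \<le> S h m x" unfolding S_def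
          using order_trans[OF nonneg hf] T_space less(2) by (intro sum_nonneg) blast
        moreover have "c * (real m - real L) \<le> 0" using True c0 by (simp add: mult_nonneg_nonpos)
        ultimately show ?thesis by linarith
      next
        case False
        obtain n where n: "n \<in> {1..L}" "c * real n \<le> S h n x" using ret[OF less(2)] by blast
        have "c * (real (m - n) - real L) \<le> S h (m - n) ((T ^^ n) x)"
          using less(1)[of "m - n"] n False T_space[OF less(2)] by auto
        moreover have "S h m x = S h n x + S h (m - n) ((T ^^ n) x)"
          using S_add[of h n "m - n" x] n False by simp
        moreover have "real (m - n) = real m - real n" using n False by auto
        ultimately show ?thesis using n(2) by (simp add: algebra_simps)
      qed
    qed
    have S_int: "has_bochner_integral M (S h m) (real m * (\<integral>x. h x \<partial>M))" for m
    proof -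
      have "has_bochner_integral M (\<lambda>x. h ((T ^^ i) x)) (\<integral>x. h x \<partial>M)" for i
      proof -
        have hm [measurable]: "h \<in> borel_measurable M" using h_int by simp
        have "integrable (distr M M (T ^^ i)) h" unfolding dTn by (rule h_int)
        then have "integrable M (\<lambda>x. h ((T ^^ i) x))" by (rule integrable_distr[OF Tn])
        moreover have "(\<integral>x. h ((T ^^ i) x) \<partial>M) = (\<integral>x. h x \<partial>M)"
          using integral_distr[OF Tn hm, of i] unfolding dTn by simp
        ultimately show ?thesis by (simp add: has_bochner_integral_iff)
      qed
      then have "has_bochner_integral M (\<lambda>x. \<Sum>i<m. h ((T ^^ i) x)) (\<Sum>i<m. \<integral>x. h x \<partial>M)"
        by (rule has_bochner_integral_sum)
      then show ?thesis by (simp add: S_def[abs_def])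
    qed
    have hc: "c \<le> (\<integral>x. h x \<partial>M)"
    proof (rule ccontr)
      assume "\<not> ?thesis"
      then obtain m where m: "c * real L < real m * (c - (\<integral>x. h x \<partial>M))"
        using reals_Archimedean3[of "c - (\<integral>x. h x \<partial>M)"] by auto
      have "(\<integral>x. c * (real m - real L) \<partial>M) \<le> (\<integral>x. S h m x \<partial>M)"
        using S_int[of m] low by (intro integral_mono) (auto simp: has_bochner_integral_iff)
      then show False using m S_int[of m] by (simp add: has_bochner_integral_iff prob_space algebra_simps)
    qed
    have "(\<integral>x. h x \<partial>M) = (\<integral>x. f x \<partial>M) + c * prob (space M - G L)"
      unfolding h_def using int by (subst Bochner_Integration.integral_add) (auto simp: emeasure_eq_measure)
    also have "prob (space M - G L) < \<eta>" using L prob_compl[OF Gm] by simp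
    then have "(\<integral>x. f x \<partial>M) + c * prob (space M - G L) < (\<integral>x. f x \<partial>M) + c * \<eta>" using c0 by simp
    also have "\<dots> < c" using c c0 by (simp add: \<eta>_def field_simps)
    finally show False using hc by simp
  qed
  ultimately have "prob A = 0" by simp
  then have "A \<in> null_sets M" by (auto simp: null_sets_def emeasure_eq_measure)
  then have "AE x in M. x \<notin> A" by (rule AE_not_in)
  with AE_space show ?thesis
  proof eventually_elim
    fix x assume x: "x \<in> space M" "x \<notin> A"
    show "\<forall>q. c < q \<longrightarrow> (\<forall>\<^sub>F n in sequentially. (\<Sum>i<n. f ((T ^^ i) x)) < q * real n)"
    proof (intro allI impI)
      fix q assume "c < q"
      then obtain q' where q': "q' \<in> \<rat>" "c < q'" "q' < q" using Rats_dense_in_real by blast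
      then have "\<forall>\<^sub>F n in sequentially. S f n x < q' * real n"
        using x unfolding A_def by (auto simp: frequently_def not_le)
      then show "\<forall>\<^sub>F n in sequentially. (\<Sum>i<n. f ((T ^^ i) x)) < q * real n"
        unfolding S_def
      proof eventually_elim
        case (elim n)
        have "q' * real n \<le> q * real n" using q' by (intro mult_right_mono) auto
        then show ?case using elim by linarith
      qed
    qed
  qed
qed

text \<open>
  Both halves follow from the upper bound, applied to \<open>f\<close> and to \<open>K - f\<close>.
\<close>

theorem ergodic_averages_tendsto:
  fixes f :: "'a \<Rightarrow> real"
  assumes "prob_space M" and erg: "ergodic_map M T" and [measurable]: "f \<in> borel_measurable M"
    and nonneg: "\<And>x. x \<in> space M \<Longrightarrow> 0 \<le> f x" and bound: "\<And>x. x \<in> space M \<Longrightarrow> f x \<le> K"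
  shows "AE x in M. (\<lambda>n. (\<Sum>i<n. f ((T ^^ i) x)) / real n) \<longlonglongrightarrow> (\<integral>x. f x \<partial>M)"
proof -
  interpret prob_space M by fact
  let ?I = "\<integral>x. f x \<partial>M"
  have int: "integrable M f"
    by (rule integrable_const_bound[of _ K]) (use nonneg bound in auto)
  have int': "(\<integral>x. K - f x \<partial>M) = K - ?I" "integrable M (\<lambda>x. K - f x)"
    using int by (auto simp: prob_space)
  have up: "AE x in M. \<forall>q. ?I + 1 / real (Suc k) < q \<longrightarrow>
      (\<forall>\<^sub>F n in sequentially. (\<Sum>i<n. f ((T ^^ i) x)) < q * real n)" for k
    by (rule ergodic_sums_eventually_le[OF assms(1) erg int nonneg]) auto
  have lo: "AE x in M. \<forall>q. K - ?I + 1 / real (Suc k) < q \<longrightarrow>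
      (\<forall>\<^sub>F n in sequentially. (\<Sum>i<n. K - f ((T ^^ i) x)) < q * real n)" for k
    by (rule ergodic_sums_eventually_le[OF assms(1) erg int'(2)]) (use bound int' in auto)
  have "AE x in M. \<forall>k. (\<forall>q. ?I + 1 / real (Suc k) < q \<longrightarrow>
      (\<forall>\<^sub>F n in sequentially. (\<Sum>i<n. f ((T ^^ i) x)) < q * real n)) \<and>
    (\<forall>q. K - ?I + 1 / real (Suc k) < q \<longrightarrow>
      (\<forall>\<^sub>F n in sequentially. (\<Sum>i<n. K - f ((T ^^ i) x)) < q * real n))"
    unfolding AE_all_countable using up lo by (auto intro: AE_conjI)
  then show ?thesis
  proof eventually_elim
    case (elim x)
    show ?case
    proof (rule tendstoI)
      fix e :: real assume "0 < e"
      then obtain k where k: "1 / real (Suc k) < e" using nat_approx_posE by blast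
      have "\<forall>\<^sub>F n in sequentially. (\<Sum>i<n. f ((T ^^ i) x)) < (?I + e) * real n"
        "\<forall>\<^sub>F n in sequentially. (\<Sum>i<n. K - f ((T ^^ i) x)) < (K - ?I + e) * real n"
        using elim[THEN spec, of k] k by auto
      then show "\<forall>\<^sub>F n in sequentially. dist ((\<Sum>i<n. f ((T ^^ i) x)) / real n) ?I < e"
        using eventually_gt_at_top[of 0]
      proof eventually_elim
        case (elim n)
        have "(\<Sum>i<n. K - f ((T ^^ i) x)) = real n * K - (\<Sum>i<n. f ((T ^^ i) x))"
          by (simp add: sum_subtractf)
        then show ?case using elim
          by (auto simp: dist_real_def abs_less_iff field_simps)
      qed
    qed
  qed
qed

section \<open>Independent exponential noise\<close>

lemma distr_PiM_componentwise:
  fixes M N :: "'i \<Rightarrow> 'a measure"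
  assumes M: "\<And>i. prob_space (M i)" and f: "\<And>i. f i \<in> measurable (M i) (N i)"
  shows "distr (PiM UNIV M) (PiM UNIV N) (\<lambda>\<omega> i. f i (\<omega> i)) = PiM UNIV (\<lambda>i. distr (M i) (N i) (f i))"
    (is "?L = ?R")
proof (rule measure_eqI_PiM_infinite[symmetric])
  have P: "prob_space (distr (M i) (N i) (f i))" for i
    using M f by (rule prob_space.prob_space_distr)
  interpret R: prob_space ?R by (intro prob_space_PiM P)
  show "finite_measure ?R" by unfold_locales
  show "sets ?R = sets (PiM UNIV N)" by (intro sets_PiM_cong) auto
  have m [measurable]: "(\<lambda>\<omega> i. f i (\<omega> i)) \<in> measurable (PiM UNIV M) (PiM UNIV N)"
    by (rule measurable_PiM_single')
       (auto intro: measurable_compose[OF _ f] dest: measurable_space[OF f] simp: space_PiM)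
  fix A :: "'i \<Rightarrow> 'a set" and J assume J: "finite J" "J \<subseteq> UNIV" and A: "\<And>i. i \<in> J \<Longrightarrow> A i \<in> sets (N i)"
  have pre: "prod_emb UNIV M J (\<Pi>\<^sub>E j\<in>J. f j -` A j \<inter> space (M j))
      = (\<lambda>\<omega> i. f i (\<omega> i)) -` prod_emb UNIV N J (Pi\<^sub>E J A) \<inter> space (PiM UNIV M)"
    using measurable_space[OF f] by (auto simp: prod_emb_def space_PiM PiE_iff)
  have "?R (prod_emb UNIV N J (Pi\<^sub>E J A)) = ?R (prod_emb UNIV (\<lambda>i. distr (M i) (N i) (f i)) J (Pi\<^sub>E J A))"
    by (simp add: prod_emb_def)
  also have "\<dots> = (\<Prod>j\<in>J. distr (M j) (N j) (f j) (A j))"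
    using J A by (intro emeasure_PiM_emb P) auto
  also have "\<dots> = (\<Prod>j\<in>J. M j (f j -` A j \<inter> space (M j)))"
    using f A by (intro prod.cong) (auto simp: emeasure_distr)
  also have "\<dots> = PiM UNIV M (prod_emb UNIV M J (\<Pi>\<^sub>E j\<in>J. f j -` A j \<inter> space (M j)))"
    using J A by (intro emeasure_PiM_emb[symmetric] M) (auto intro: measurable_sets[OF f])
  also have "\<dots> = ?L (prod_emb UNIV N J (Pi\<^sub>E J A))"
    unfolding pre using J A by (intro emeasure_distr[symmetric] sets_PiM_I m) auto
  finally show "?R (prod_emb UNIV N J (Pi\<^sub>E J A)) = ?L (prod_emb UNIV N J (Pi\<^sub>E J A))" .
qed auto

lemma distr_exp_law_scale:
  assumes r: "0 < r"
  shows "distr (exp_law 1) borel (\<lambda>x. x / r) = exp_law r"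
proof (rule measure_eqI)
  fix A assume "A \<in> sets (distr (exp_law 1) borel (\<lambda>x. x / r))"
  then have [measurable]: "A \<in> sets borel" by simp
  have "emeasure (exp_law r) A = (\<integral>\<^sup>+x. ennreal (exponential_density r x) * indicator A x \<partial>lborel)"
    by (simp add: emeasure_density)
  also have "\<dots> = ennreal \<bar>1 / r\<bar> * (\<integral>\<^sup>+x. ennreal (exponential_density r (0 + 1 / r * x)) * indicator A (0 + 1 / r * x) \<partial>lborel)"
    using r by (intro nn_integral_real_affine) auto
  also have "\<dots> = (\<integral>\<^sup>+x. ennreal (1 / r) * ennreal (exponential_density r (x / r)) * indicator A (x / r) \<partial>lborel)"
    using r by (subst nn_integral_cmult[symmetric]) (auto simp: mult.assoc)
  also have "\<dots> = (\<integral>\<^sup>+x. ennreal (exponential_density 1 x) * indicator A (x / r) \<partial>lborel)"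
    using r by (intro nn_integral_cong arg_cong2[where f = "(*)"] refl)
      (auto simp: exponential_density_def ennreal_mult[symmetric] divide_less_0_iff)
  also have "\<dots> = (\<integral>\<^sup>+x. indicator A (x / r) \<partial>exp_law 1)"
    by (subst nn_integral_density) auto
  also have "\<dots> = (\<integral>\<^sup>+x. indicator A x \<partial>distr (exp_law 1) borel (\<lambda>x. x / r))"
    by (subst nn_integral_distr) auto
  also have "\<dots> = emeasure (distr (exp_law 1) borel (\<lambda>x. x / r)) A" by simp
  finally show "emeasure (distr (exp_law 1) borel (\<lambda>x. x / r)) A = emeasure (exp_law r) A" ..
qed simp

text \<open>
  All weights are obtained by dividing the same i.i.d. standard exponentials by their rates.  This puts
  the environments, the boundary models for all \<open>z\<close> and the shifted models on a single probability space.
\<close>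

abbreviation noise :: "(nat \<times> nat \<Rightarrow> real) measure" where
  "noise \<equiv> PiM UNIV (\<lambda>_. exp_law 1)"

lemma sets_noise [measurable_cong]: "sets noise = sets (PiM UNIV (\<lambda>_. borel))"
  by (intro sets_PiM_cong) auto

lemma prob_space_noise: "prob_space noise"
  by (intro prob_space_PiM prob_space_exponential_density) simp

interpretation noise: prob_space noise by (rule prob_space_noise)

lemma distr_noise_scale:
  fixes r :: "nat \<times> nat \<Rightarrow> real"
  assumes r: "\<And>k. 0 < r k"
  shows "distr noise (PiM UNIV (\<lambda>_. borel)) (\<lambda>\<xi> k. \<xi> k / r k) = PiM UNIV (\<lambda>k. exp_law (r k))"
  by (subst distr_PiM_componentwise)
     (auto intro: prob_space_exponential_density simp: distr_exp_law_scale[OF r])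

lemma distr_noise_shift:
  "distr noise noise (shift_weights k l) = noise"
proof -
  let ?s = "\<lambda>(i, j). (i + k, j + l)"
  have "distr noise (PiM UNIV (\<lambda>_. exp_law 1)) (\<lambda>\<omega>. \<lambda>n\<in>UNIV. \<omega> (?s n)) = PiM UNIV (\<lambda>_. exp_law 1)"
    by (rule distr_PiM_reindex) (auto simp: inj_on_def intro: prob_space_exponential_density)
  moreover have "(\<lambda>\<omega>. \<lambda>n\<in>UNIV. \<omega> (?s n)) = shift_weights k l"
    by (auto simp: shift_weights_def fun_eq_iff)
  ultimately show ?thesis by simp
qed

lemma measurable_shift_weights [measurable]: "shift_weights k l \<in> measurable noise noise"
proof -
  have "shift_weights k l \<in> measurable noise (PiM UNIV (\<lambda>_. borel))"
    by (rule measurable_PiM_single') (auto simp: shift_weights_def split_beta)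
  then show ?thesis using sets_noise measurable_cong_sets by blast
qed

lemma AE_noise_nonneg: "AE \<xi> in noise. \<forall>k. 0 \<le> \<xi> k"
proof -
  have "AE x in exp_law 1. 0 \<le> x"
    by (subst AE_density) (auto simp: exponential_density_def)
  then have "AE \<xi> in noise. 0 \<le> \<xi> k" for k
    by (intro AE_PiM_component[where P = "\<lambda>x. 0 \<le> x"]) (auto intro: prob_space_exponential_density)
  then show ?thesis by (simp add: AE_all_countable)
qed

lemma noise_component:
  shows "has_bochner_integral noise (\<lambda>\<xi>. \<xi> k) 1"
    and "has_bochner_integral noise (\<lambda>\<xi>. (\<xi> k)\<^sup>2) 2"
proof -
  have D: "distributed noise lborel (\<lambda>\<xi>. \<xi> k) (exponential_density 1)"
    using distributed_component[of "\<lambda>_. 1" k] by simp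
  show "has_bochner_integral noise (\<lambda>\<xi>. \<xi> k) 1" "has_bochner_integral noise (\<lambda>\<xi>. (\<xi> k)\<^sup>2) 2"
    using noise.has_bochner_integral_erlang_ith_moment[OF _ D, of 1]
      noise.has_bochner_integral_erlang_ith_moment[OF _ D, of 2] by (auto simp: numeral_2_eq_2)
qed

lemma noise_covariance:
  "has_bochner_integral noise (\<lambda>\<xi>. (\<xi> k - 1) * (\<xi> l - 1)) (if k = l then 1 else 0)"
proof (cases "k = l")
  case True
  have "has_bochner_integral noise (\<lambda>\<xi>. (\<xi> k)\<^sup>2 - 2 * \<xi> k + 1) (2 - 2 * 1 + 1)"
    by (intro has_bochner_integral_add has_bochner_integral_diff has_bochner_integral_mult_right noise_component)
       (simp add: has_bochner_integral_iff noise.prob_space)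
  then show ?thesis using True by (simp add: power2_eq_square algebra_simps)
next
  case False
  have "distr noise borel (\<lambda>\<xi>. \<xi> i) = exp_law 1" for i
  proof -
    have "distr noise borel (\<lambda>\<xi>. \<xi> i) = distr noise (exp_law 1) (\<lambda>\<xi>. \<xi> i)" by (rule distr_cong) auto
    also have "\<dots> = exp_law 1" by (rule distr_PiM_component) (auto intro: prob_space_exponential_density)
    finally show ?thesis .
  qed
  moreover have "distr noise (PiM UNIV (\<lambda>_. borel)) (\<lambda>x. x) = noise"
    by (rule distr_id2) (rule sets_noise[symmetric])
  ultimately have "noise.indep_vars (\<lambda>_. borel) (\<lambda>i \<xi>. \<xi> i) UNIV"
    by (subst noise.indep_vars_iff_distr_eq_PiM') (auto simp: restrict_UNIV)
  then have "noise.indep_var borel (\<lambda>\<xi>. \<xi> k) borel (\<lambda>\<xi>. \<xi> l)"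
    using noise.indep_vars_sum[of "{l}" k "\<lambda>i \<xi>. \<xi> i"] False
      noise.indep_vars_subset[of "\<lambda>_. borel" "\<lambda>i \<xi>. \<xi> i" UNIV "{k, l}"] by simp
  then have "noise.indep_var borel ((\<lambda>x. x - 1) \<circ> (\<lambda>\<xi>. \<xi> k)) borel ((\<lambda>x. x - 1) \<circ> (\<lambda>\<xi>. \<xi> l))"
    by (rule noise.indep_var_compose) auto
  then have ind: "noise.indep_var borel (\<lambda>\<xi>. \<xi> k - 1) borel (\<lambda>\<xi>. \<xi> l - 1)" by (simp add: comp_def)
  have c: "has_bochner_integral noise (\<lambda>\<xi>. \<xi> i - 1) (1 - 1)" for i
    by (intro has_bochner_integral_diff noise_component)
       (simp add: has_bochner_integral_iff noise.prob_space)
  show ?thesis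
    using noise.indep_var_integrable[OF ind] noise.indep_var_lebesgue_integral[OF ind] c[of k] c[of l] False
    by (auto simp: has_bochner_integral_iff)
qed

text \<open>
  Chebyshev's inequality.  The bound is uniform over all coefficients in \<open>[0, C]\<close>, so it can be applied
  with the environment held fixed.
\<close>

lemma noise_weighted_sum_deviation:
  fixes c :: "nat \<Rightarrow> real"
  assumes "inj k" and c: "\<And>i. 1 \<le> i \<Longrightarrow> 0 \<le> c i \<and> c i \<le> C" and "0 < \<epsilon>" and "1 \<le> n"
  shows "noise.prob {\<xi> \<in> space noise. \<epsilon> * real n \<le> \<bar>\<Sum>i = 1..n. c i * (\<xi> (k i) - 1)\<bar>} \<le> C\<^sup>2 / (\<epsilon>\<^sup>2 * real n)"
proof -
  let ?X = "\<lambda>\<xi>. \<Sum>i = 1..n. c i * (\<xi> (k i) - 1)"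
  have sq: "(?X \<xi>)\<^sup>2 = (\<Sum>i = 1..n. \<Sum>j = 1..n. c i * c j * ((\<xi> (k i) - 1) * (\<xi> (k j) - 1)))" for \<xi>
    unfolding power2_eq_square sum_product by (simp add: ac_simps)
  have "has_bochner_integral noise (\<lambda>\<xi>. (?X \<xi>)\<^sup>2)
      (\<Sum>i = 1..n. \<Sum>j = 1..n. c i * c j * (if k i = k j then 1 else 0))"
    unfolding sq by (intro has_bochner_integral_sum has_bochner_integral_mult_right noise_covariance)
  moreover have "(\<Sum>i = 1..n. \<Sum>j = 1..n. c i * c j * (if k i = k j then 1 else 0)) = (\<Sum>i = 1..n. (c i)\<^sup>2)"
    using \<open>inj k\<close> by (simp add: inj_eq if_distrib power2_eq_square cong: if_cong)
  ultimately have hb: "has_bochner_integral noise (\<lambda>\<xi>. (?X \<xi>)\<^sup>2) (\<Sum>i = 1..n. (c i)\<^sup>2)" by simp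
  have le: "(\<Sum>i = 1..n. (c i)\<^sup>2) \<le> real n * C\<^sup>2"
    using c sum_bounded_above[of "{1..n}" "\<lambda>i. (c i)\<^sup>2" "C\<^sup>2"] by (auto intro: power_mono)
  have "{\<xi> \<in> space noise. \<epsilon> * real n \<le> \<bar>?X \<xi>\<bar>} = {\<xi> \<in> space noise. (\<epsilon> * real n)\<^sup>2 \<le> (?X \<xi>)\<^sup>2}"
    using \<open>0 < \<epsilon>\<close> abs_le_square_iff[of "\<epsilon> * real n"] by (auto simp: abs_mult)
  also have "noise.prob \<dots> \<le> noise.expectation (\<lambda>\<xi>. (?X \<xi>)\<^sup>2) / (\<epsilon> * real n)\<^sup>2"
    using hb assms by (intro integral_Markov_inequality_measure[where A = "space noise"]) (auto simp: has_bochner_integral_iff)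
  also have "\<dots> \<le> real n * C\<^sup>2 / (\<epsilon> * real n)\<^sup>2"
    using le hb by (intro divide_right_mono) (auto simp: has_bochner_integral_iff)
  also have "\<dots> = C\<^sup>2 / (\<epsilon>\<^sup>2 * real n)"
    using assms by (simp add: power2_eq_square field_simps)
  finally show ?thesis .
qed

section \<open>Convergence in probability and rescaled grid points\<close>

abbreviation scaled :: "nat \<Rightarrow> real \<Rightarrow> nat" where
  "scaled n s \<equiv> nat \<lfloor>real n * s\<rfloor>"

lemma scaled_le: "0 \<le> s \<Longrightarrow> real (scaled n s) \<le> real n * s"
  by simp

lemma scaled_tendsto: "(\<lambda>n. real (scaled n s) / real n) \<longlonglongrightarrow> s" if "0 \<le> s"
proof -
  have "(\<lambda>n. real_of_int \<lfloor>real n * s\<rfloor> / real n) \<longlonglongrightarrow> s"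
    by real_asymp
  then show ?thesis using that by simp
qed

lemma (in prob_space) exists_outside_event:
  assumes "AE \<omega> in M. P \<omega>" and "E \<in> events" and "prob E < 1"
  shows "\<exists>\<omega>\<in>space M. P \<omega> \<and> \<omega> \<notin> E"
proof (rule ccontr)
  assume "\<not> ?thesis"
  then have "AE \<omega> in M. \<omega> \<in> E"
    using assms(1) AE_space by (auto elim: eventually_elim2)
  then have "prob E = 1" using assms(2) by (simp add: prob_eq_1)
  then show False using assms(3) by simp
qed

lemma (in prob_space) AE_tendsto_imp_prob_tendsto:
  fixes X :: "nat \<Rightarrow> 'a \<Rightarrow> real"
  assumes [measurable]: "\<And>n. X n \<in> borel_measurable M" and lim: "AE \<omega> in M. (\<lambda>n. X n \<omega>) \<longlonglongrightarrow> c" and "0 < \<epsilon>"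
  shows "(\<lambda>n. prob {\<omega> \<in> space M. \<epsilon> \<le> \<bar>X n \<omega> - c\<bar>}) \<longlonglongrightarrow> 0"
proof -
  let ?E = "\<lambda>n. {\<omega> \<in> space M. \<epsilon> \<le> \<bar>X n \<omega> - c\<bar>}"
  have "(\<lambda>n. \<integral>\<omega>. indicator (?E n) \<omega> \<partial>M) \<longlonglongrightarrow> (\<integral>\<omega>. 0 \<partial>M :: real)"
  proof (rule integral_dominated_convergence[where w = "\<lambda>_. 1"])
    show "AE \<omega> in M. (\<lambda>n. indicator (?E n) \<omega> :: real) \<longlonglongrightarrow> 0"
      using lim
    proof eventually_elim
      case (elim \<omega>)
      have "\<forall>\<^sub>F n in sequentially. dist (X n \<omega>) c < \<epsilon>" using elim \<open>0 < \<epsilon>\<close> by (rule tendstoD)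
      then have "\<forall>\<^sub>F n in sequentially. indicator (?E n) \<omega> = (0 :: real)"
        by eventually_elim (auto simp: dist_real_def)
      then show ?case by (rule tendsto_eventually)
    qed
  qed auto
  then show ?thesis by simp
qed

lemma scaled_at_top:
  assumes "0 < s"
  shows "filterlim (\<lambda>n. scaled n s) at_top sequentially"
proof -
  have "filterlim (\<lambda>n. real (scaled n s)) at_top sequentially"
  proof (rule filterlim_at_top_mono)
    show "filterlim (\<lambda>n. real n * s - 1) at_top sequentially" using assms by real_asymp
    show "\<forall>\<^sub>F n in sequentially. real n * s - 1 \<le> real (scaled n s)"
      by (intro always_eventually allI) linarith
  qed
  then show ?thesis by (simp add: filterlim_sequentially_iff_filterlim_real)
qed

lemma scaled_mult_le:
  assumes "0 \<le> x" "real k * x \<le> y"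
  shows "k * scaled n x \<le> scaled n y"
proof (rule le_nat_floor)
  have "real (k * scaled n x) \<le> real k * (real n * x)"
    using scaled_le[OF assms(1), of n] by (simp add: mult_left_mono)
  also have "\<dots> \<le> real n * y"
    using mult_left_mono[OF assms(2), of "real n"] by (simp add: ac_simps)
  finally show "real (k * scaled n x) \<le> real n * y" .
qed

lemma multiple_scaled_at_top:
  assumes "0 < x" "1 \<le> k"
  shows "filterlim (\<lambda>n. k * scaled n x) at_top sequentially"
  by (rule filterlim_at_top_mono[OF scaled_at_top[OF assms(1)]])
     (use assms(2) in auto)

text \<open>
  The bound \<open>x \<le> c + \<delta> x\<^sup>2 + [x > c] / (4 \<delta>)\<close> is integrated; the last term vanishes in the limit, and
  then \<open>\<delta>\<close> tends to \<open>0\<close>.  This turns the exactly known mean of the boundary model into a lower bound on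
  its typical size.
\<close>

lemma (in prob_space) mean_limit_le:
  fixes X :: "nat \<Rightarrow> 'a \<Rightarrow> real"
  assumes [measurable]: "\<And>n. X n \<in> borel_measurable M"
    and mean: "\<And>n. (\<integral>\<^sup>+\<omega>. ennreal (X n \<omega>) \<partial>M) = ennreal (e n)" and e: "e \<longlonglongrightarrow> m"
    and square: "\<And>n. (\<integral>\<^sup>+\<omega>. ennreal ((X n \<omega>)\<^sup>2) \<partial>M) \<le> ennreal C" and "0 \<le> C"
    and c: "(\<lambda>n. prob {\<omega> \<in> space M. c < X n \<omega>}) \<longlonglongrightarrow> 0" and "0 \<le> c"
  shows "m \<le> c"
proof -
  have bound: "m \<le> c + \<delta> * C" if "0 < \<delta>" for \<delta>
  proof -
    have "e n \<le> c + \<delta> * C + 1 / (4 * \<delta>) * prob {\<omega> \<in> space M. c < X n \<omega>}" for n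
    proof -
      let ?E = "{\<omega> \<in> space M. c < X n \<omega>}"
      have "ennreal (e n) \<le> (\<integral>\<^sup>+\<omega>. ennreal c + ennreal \<delta> * ennreal ((X n \<omega>)\<^sup>2)
          + ennreal (1 / (4 * \<delta>)) * indicator ?E \<omega> \<partial>M)"
        unfolding mean[symmetric]
      proof (rule nn_integral_mono)
        fix \<omega> assume "\<omega> \<in> space M"
        have "X n \<omega> \<le> c + \<delta> * (X n \<omega>)\<^sup>2 + 1 / (4 * \<delta>) * indicator ?E \<omega>"
        proof (cases "\<omega> \<in> ?E")
          case True
          have "0 \<le> (2 * \<delta> * X n \<omega> - 1)\<^sup>2 / (4 * \<delta>)" using \<open>0 < \<delta>\<close> by simp
          also have "\<dots> = \<delta> * (X n \<omega>)\<^sup>2 - X n \<omega> + 1 / (4 * \<delta>)"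
            using \<open>0 < \<delta>\<close> by (simp add: power2_eq_square field_simps)
          finally show ?thesis using True \<open>0 \<le> c\<close> by simp
        next
          case False
          then have "X n \<omega> \<le> c" using \<open>\<omega> \<in> space M\<close> by auto
          moreover have "0 \<le> \<delta> * (X n \<omega>)\<^sup>2" using \<open>0 < \<delta>\<close> by simp
          ultimately show ?thesis using False by simp
        qed
        then have "ennreal (X n \<omega>) \<le> ennreal (c + \<delta> * (X n \<omega>)\<^sup>2 + 1 / (4 * \<delta>) * indicator ?E \<omega>)"
          by (rule ennreal_leI)
        also have "\<dots> = ennreal c + ennreal \<delta> * ennreal ((X n \<omega>)\<^sup>2) + ennreal (1 / (4 * \<delta>)) * indicator ?E \<omega>"
          using \<open>0 < \<delta>\<close> \<open>0 \<le> c\<close>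
          by (auto simp: ennreal_plus ennreal_mult[symmetric] indicator_def)
        finally show "ennreal (X n \<omega>) \<le> ennreal c + ennreal \<delta> * ennreal ((X n \<omega>)\<^sup>2) + ennreal (1 / (4 * \<delta>)) * indicator ?E \<omega>" .
      qed
      also have "\<dots> = ennreal c + ennreal \<delta> * (\<integral>\<^sup>+\<omega>. ennreal ((X n \<omega>)\<^sup>2) \<partial>M) + ennreal (1 / (4 * \<delta>)) * emeasure M ?E"
        by (simp add: nn_integral_add nn_integral_cmult emeasure_space_1)
      also have "\<dots> \<le> ennreal c + ennreal \<delta> * ennreal C + ennreal (1 / (4 * \<delta>)) * emeasure M ?E"
        by (intro add_mono mult_left_mono square order_refl) simp
      also have "\<dots> = ennreal (c + \<delta> * C + 1 / (4 * \<delta>) * prob ?E)"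
        using \<open>0 < \<delta>\<close> \<open>0 \<le> c\<close> \<open>0 \<le> C\<close>
        by (simp add: emeasure_eq_measure ennreal_plus ennreal_mult[symmetric] del: times_divide_eq_left)
      finally show ?thesis
        using \<open>0 < \<delta>\<close> \<open>0 \<le> c\<close> \<open>0 \<le> C\<close> by (subst (asm) ennreal_le_iff) (auto intro!: add_nonneg_nonneg mult_nonneg_nonneg)
    qed
    moreover have "(\<lambda>n. c + \<delta> * C + 1 / (4 * \<delta>) * prob {\<omega> \<in> space M. c < X n \<omega>}) \<longlonglongrightarrow> c + \<delta> * C + 1 / (4 * \<delta>) * 0"
      by (intro tendsto_intros c)
    ultimately show ?thesis using LIMSEQ_le[OF e] by simp
  qed
  show ?thesis
  proof (rule field_le_epsilon)
    fix x :: real assume "0 < x"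
    have "m \<le> c + (x / (C + 1)) * C" using \<open>0 < x\<close> \<open>0 \<le> C\<close> by (intro bound) simp
    also have "(x / (C + 1)) * C \<le> x" using \<open>0 < x\<close> \<open>0 \<le> C\<close> by (simp add: field_simps)
    finally show "m \<le> c + x" by simp
  qed
qed

section \<open>Stationary ergodic environments\<close>

text \<open>
  The complement of the support is a union of open null sets, of which countably many suffice by the
  Lindelof property.
\<close>

lemma AE_measure_support:
  assumes "prob_space \<eta>" and s [measurable_cong]: "sets \<eta> = sets borel"
  shows "AE x in \<eta>. x \<in> measure_support \<eta>"
proof -
  define F where "F = {U :: real set. open U \<and> emeasure \<eta> U = 0}"
  obtain F' where F': "F' \<subseteq> F" "countable F'" "\<Union>F' = \<Union>F"
    by (rule Lindelof[of F]) (auto simp: F_def)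
  have "(\<Union>U\<in>F'. U) \<in> null_sets \<eta>"
    using F' by (intro null_sets_UN') (auto simp: F_def null_sets_def s)
  then have "AE x in \<eta>. x \<notin> (\<Union>U\<in>F'. U)" by (rule AE_not_in)
  then show ?thesis
  proof eventually_elim
    case (elim x)
    then have "x \<notin> \<Union>F" using F' by simp
    then show ?case by (auto simp: F_def measure_support_def zero_less_iff_neq_zero)
  qed
qed

lemma measure_support_nonneg:
  assumes s: "sets \<eta> = sets borel" and "AE x in \<eta>. 0 < x" and "x \<in> measure_support \<eta>"
  shows "0 \<le> x"
proof (rule ccontr)
  assume "\<not> 0 \<le> x"
  then have "emeasure \<eta> {..<0} > 0" using assms(3) by (auto simp: measure_support_def)
  moreover have "emeasure \<eta> {..<0} = 0"
  proof -
    have "AE x in \<eta>. \<not> x < 0" using assms(2) by eventually_elim simp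
    from emeasure_eq_0_AE[OF this] show ?thesis
      using sets_eq_imp_space_eq[OF s] by (simp add: lessThan_def)
  qed
  ultimately show False by simp
qed

lemma AE_left_endpoint_le:
  assumes "prob_space \<eta>" and "sets \<eta> = sets borel" and "AE x in \<eta>. 0 < x"
  shows "AE x in \<eta>. left_endpoint \<eta> \<le> x"
  using AE_measure_support[OF assms(1,2)]
proof eventually_elim
  case (elim x)
  then show ?case
    unfolding left_endpoint_def using measure_support_nonneg[OF assms(2,3)]
    by (intro cInf_lower) (auto simp: bdd_below_def)
qed

lemma mass_near_left_endpoint:
  assumes "prob_space \<eta>" and s: "sets \<eta> = sets borel" and "AE x in \<eta>. 0 < x" and "0 < \<delta>"
  shows "0 < emeasure \<eta> {..<left_endpoint \<eta> + \<delta>}"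
proof -
  interpret prob_space \<eta> by fact
  have "measure_support \<eta> \<noteq> {}"
    using AE_measure_support[OF assms(1,2)] AE_False by auto
  then obtain x where "x \<in> measure_support \<eta>" "x < left_endpoint \<eta> + \<delta>"
    using cInf_lessD[of "measure_support \<eta>" "left_endpoint \<eta> + \<delta>"] \<open>0 < \<delta>\<close>
    unfolding left_endpoint_def by auto
  then show ?thesis by (auto simp: measure_support_def)
qed

locale ergodic_environment =
  fixes \<mu> :: "((nat \<Rightarrow> real) \<times> (nat \<Rightarrow> real)) measure"
  assumes prob_mu: "prob_space \<mu>" and sets_mu [measurable_cong]: "sets \<mu> = sets env_space"
    and ergodic: "\<And>k l. 1 \<le> k \<Longrightarrow> 1 \<le> l \<Longrightarrow> ergodic_map \<mu> (shift2 k l)"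
    and endpoints: "0 < left_endpoint (law_a \<mu>) + left_endpoint (law_b \<mu>)"
begin

sublocale mu: prob_space \<mu> by (rule prob_mu)

abbreviation "\<alpha> \<equiv> left_endpoint (law_a \<mu>)"
abbreviation "\<beta> \<equiv> left_endpoint (law_b \<mu>)"

lemma space_mu: "space \<mu> = space env_space"
  by (rule sets_eq_imp_space_eq[OF sets_mu])

lemma space_mu_pos:
  assumes "e \<in> space \<mu>" "1 \<le> i"
  shows "0 < fst e i" "0 < snd e i"
  using assms unfolding space_mu env_space_def pos_seq_space_def
  by (auto simp: space_pair_measure space_PiM PiE_iff space_restrict_space)

lemma measurable_component_pos_seq:
  "1 \<le> i \<Longrightarrow> (\<lambda>c. c i) \<in> borel_measurable pos_seq_space"
  unfolding pos_seq_space_def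
  by (rule measurable_compose[OF measurable_component_singleton[of i]])
     (auto intro: measurable_restrict_space1)

lemma measurable_fst_snd [measurable]:
  assumes "1 \<le> i"
  shows "(\<lambda>e. fst e i) \<in> borel_measurable \<mu>" "(\<lambda>e. snd e i) \<in> borel_measurable \<mu>"
proof -
  have "fst \<in> measurable \<mu> pos_seq_space" "snd \<in> measurable \<mu> pos_seq_space"
    unfolding measurable_cong_sets[OF sets_mu refl] env_space_def by measurable
  then show "(\<lambda>e. fst e i) \<in> borel_measurable \<mu>" "(\<lambda>e. snd e i) \<in> borel_measurable \<mu>"
    using measurable_component_pos_seq[OF assms] by (auto intro: measurable_compose)
qed

lemma measurable_seq_shift: "seq_shift k \<in> measurable pos_seq_space pos_seq_space"
  unfolding seq_shift_def pos_seq_space_def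
  by (intro measurable_restrict measurable_component_singleton) auto

lemma measurable_shift2 [measurable]: "shift2 k l \<in> measurable \<mu> \<mu>"
proof -
  have "shift2 k l \<in> measurable env_space env_space"
    unfolding shift2_def env_space_def map_prod_def
    using measurable_seq_shift by measurable
  then show ?thesis using sets_mu measurable_cong_sets by blast
qed

lemma shift2_shift2: "shift2 k l (shift2 k' l' e) = shift2 (k + k') (l + l') e"
  by (cases e) (auto simp: shift2_def seq_shift_def fun_eq_iff ac_simps)

lemma fst_snd_shift2:
  "1 \<le> i \<Longrightarrow> fst (shift2 k l e) i = fst e (i + k)"
  "1 \<le> i \<Longrightarrow> snd (shift2 k l e) i = snd e (i + l)"
  by (cases e; simp add: shift2_def seq_shift_def)+

text \<open>
  Stationarity is postulated only for positive shifts of both sequences.  It extends to all shifts, in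
  particular to those that move one sequence only, by composing with a shift of both sequences by one.
\<close>

lemma distr_shift2: "distr \<mu> \<mu> (shift2 k l) = \<mu>"
proof -
  have st: "distr \<mu> \<mu> (shift2 (Suc i) (Suc j)) = \<mu>" for i j
    using ergodic[of "Suc i" "Suc j"] by (simp add: ergodic_map_def stationary_map_def)
  have "distr \<mu> \<mu> (shift2 k l) = distr (distr \<mu> \<mu> (shift2 1 1)) \<mu> (shift2 k l)"
    using st[of 0 0] by simp
  also have "\<dots> = distr \<mu> \<mu> (shift2 (Suc k) (Suc l))"
    by (subst distr_distr) (auto simp: comp_def shift2_shift2)
  also have "\<dots> = \<mu>" by (rule st)
  finally show ?thesis .
qed

lemma AE_shift2:
  assumes "AE e in \<mu>. P e"
  shows "AE e in \<mu>. P (shift2 k l e)"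
proof -
  have "AE e in distr \<mu> \<mu> (shift2 k l). P e" unfolding distr_shift2 by (rule assms)
  then show ?thesis by (rule AE_distrD[OF measurable_shift2])
qed

lemma law_a_eq: "law_a \<mu> = distr \<mu> borel (\<lambda>e. fst e 1)"
  and law_b_eq: "law_b \<mu> = distr \<mu> borel (\<lambda>e. snd e 1)"
  by (auto simp: law_a_def law_b_def case_prod_beta')

lemma sets_laws [simp]: "sets (law_a \<mu>) = sets borel" "sets (law_b \<mu>) = sets borel"
  by (simp_all add: law_a_def law_b_def)

lemma prob_laws: "prob_space (law_a \<mu>)" "prob_space (law_b \<mu>)"
  unfolding law_a_eq law_b_eq by (auto intro!: mu.prob_space_distr)

lemma AE_laws: "AE x in law_a \<mu>. 0 < x" "AE x in law_b \<mu>. 0 < x"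
  unfolding law_a_eq law_b_eq by (subst AE_distr_iff; auto intro!: AE_I2 space_mu_pos)+

lemma AE_ge_endpoints: "AE e in \<mu>. \<forall>i\<ge>1. \<alpha> \<le> fst e i \<and> \<beta> \<le> snd e i"
proof -
  have "AE x in distr \<mu> borel (\<lambda>e. fst e 1). \<alpha> \<le> x"
    by (subst law_a_eq[symmetric]) (intro AE_left_endpoint_le prob_laws AE_laws sets_laws)
  then have a: "AE e in \<mu>. \<alpha> \<le> fst e 1" by (rule AE_distrD[rotated]) simp
  have "AE x in distr \<mu> borel (\<lambda>e. snd e 1). \<beta> \<le> x"
    by (subst law_b_eq[symmetric]) (intro AE_left_endpoint_le prob_laws AE_laws sets_laws)
  then have "AE e in \<mu>. \<beta> \<le> snd e 1" by (rule AE_distrD[rotated]) simp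
  with a
  have "AE e in \<mu>. \<alpha> \<le> fst e 1 \<and> \<beta> \<le> snd e 1" by eventually_elim simp
  from AE_shift2[OF this]
  have "AE e in \<mu>. \<alpha> \<le> fst e (1 + i) \<and> \<beta> \<le> snd e (1 + i)" for i
    by (simp add: fst_snd_shift2)
  then have "AE e in \<mu>. \<forall>i. \<alpha> \<le> fst e (1 + i) \<and> \<beta> \<le> snd e (1 + i)"
    by (simp add: AE_all_countable)
  then show ?thesis
    by eventually_elim (metis le_Suc_ex)
qed

lemma near_endpoints:
  assumes "0 < \<delta>"
  shows "0 < mu.prob {e \<in> space \<mu>. fst e 1 < \<alpha> + \<delta>}" "0 < mu.prob {e \<in> space \<mu>. snd e 1 < \<beta> + \<delta>}"
proof -
  have "0 < emeasure (law_a \<mu>) {..<\<alpha> + \<delta>}" "0 < emeasure (law_b \<mu>) {..<\<beta> + \<delta>}"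
    by (intro mass_near_left_endpoint prob_laws AE_laws sets_laws assms)+
  moreover have "emeasure (law_a \<mu>) {..<\<alpha> + \<delta>} = mu.prob {e \<in> space \<mu>. fst e 1 < \<alpha> + \<delta>}"
    by (subst law_a_eq, subst emeasure_distr) (auto simp: vimage_def Int_def mu.emeasure_eq_measure conj_commute)
  moreover have "emeasure (law_b \<mu>) {..<\<beta> + \<delta>} = mu.prob {e \<in> space \<mu>. snd e 1 < \<beta> + \<delta>}"
    by (subst law_b_eq, subst emeasure_distr) (auto simp: vimage_def Int_def mu.emeasure_eq_measure conj_commute)
  ultimately show "0 < mu.prob {e \<in> space \<mu>. fst e 1 < \<alpha> + \<delta>}" "0 < mu.prob {e \<in> space \<mu>. snd e 1 < \<beta> + \<delta>}"
    by simp_all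
qed

lemma integral_shifted:
  fixes h :: "(nat \<Rightarrow> real) \<times> (nat \<Rightarrow> real) \<Rightarrow> real"
  assumes [measurable]: "h \<in> borel_measurable \<mu>"
  shows "(\<integral>e. h (shift2 k l e) \<partial>\<mu>) = (\<integral>e. h e \<partial>\<mu>)"
  using integral_distr[OF measurable_shift2 assms, of k l] distr_shift2 by simp

text \<open>
  The two sequences of an environment play symmetric roles, with \<open>fst\<close>, \<open>\<alpha>\<close>, \<open>z\<close> exchanged for
  \<open>snd\<close>, \<open>\<beta>\<close>, \<open>- z\<close>.  This predicate collects what the arguments common to both of them use.
\<close>

definition coordinate :: "((nat \<Rightarrow> real) \<times> (nat \<Rightarrow> real) \<Rightarrow> nat \<Rightarrow> real) \<Rightarrow> real \<Rightarrow> bool" where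
  "coordinate h \<theta> \<longleftrightarrow>
     (\<forall>i\<ge>1. (\<lambda>e. h e i) \<in> borel_measurable \<mu>) \<and>
     (\<forall>k e. \<forall>i\<ge>1. h (shift2 k k e) i = h e (i + k)) \<and>
     (AE e in \<mu>. \<forall>i\<ge>1. \<theta> \<le> h e i)"

lemma coordinate_fst: "coordinate fst \<alpha>" and coordinate_snd: "coordinate snd \<beta>"
  unfolding coordinate_def using AE_ge_endpoints by (auto simp: fst_snd_shift2 elim: AE_mp)

definition mean_inverse where "mean_inverse h z = (\<integral>e. 1 / (h e 1 + z) \<partial>\<mu>)"

definition A where "A z = mean_inverse fst z"
definition B where "B z = mean_inverse snd (- z)"

lemma coordinateD:
  assumes "coordinate h \<theta>"
  shows "1 \<le> i \<Longrightarrow> (\<lambda>e. h e i) \<in> borel_measurable \<mu>"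
    and "1 \<le> i \<Longrightarrow> h (shift2 k k e) i = h e (i + k)"
    and "AE e in \<mu>. \<forall>i\<ge>1. \<theta> \<le> h e i"
  using assms unfolding coordinate_def by blast+

lemma AE_inverse_bounds:
  assumes "coordinate h \<theta>" and "- \<theta> < z"
  shows "AE e in \<mu>. \<forall>i\<ge>1. 0 \<le> 1 / (h e i + z) \<and> 1 / (h e i + z) \<le> 1 / (\<theta> + z)"
  using coordinateD(3)[OF assms(1)]
proof (eventually_elim, intro allI impI)
  fix e i assume "\<forall>i\<ge>1. \<theta> \<le> h e i" "(1::nat) \<le> i"
  then have "\<theta> \<le> h e i" by blast
  then show "0 \<le> 1 / (h e i + z) \<and> 1 / (h e i + z) \<le> 1 / (\<theta> + z)"
    using assms(2) by (auto intro!: divide_left_mono mult_pos_pos)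
qed

lemma has_bochner_integral_inverse:
  assumes h: "coordinate h \<theta>" and z: "- \<theta> < z" and i: "1 \<le> i"
  shows "has_bochner_integral \<mu> (\<lambda>e. 1 / (h e i + z)) (mean_inverse h z)"
proof -
  note [measurable] = coordinateD(1)[OF h i] coordinateD(1)[OF h order_refl]
  have "AE e in \<mu>. norm (1 / (h e i + z)) \<le> 1 / (\<theta> + z)"
    using AE_inverse_bounds[OF h z] by eventually_elim (use i in simp)
  then have int: "integrable \<mu> (\<lambda>e. 1 / (h e i + z))"
    by (intro mu.integrable_const_bound[where B = "1 / (\<theta> + z)"]) auto
  have "(\<integral>e. 1 / (h e i + z) \<partial>\<mu>) = (\<integral>e. 1 / (h (shift2 (i - 1) (i - 1) e) 1 + z) \<partial>\<mu>)"
    using i coordinateD(2)[OF h order_refl, of "i - 1"] by simp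
  also have "\<dots> = mean_inverse h z"
    unfolding mean_inverse_def by (rule integral_shifted) measurable
  finally show ?thesis using int by (simp add: has_bochner_integral_iff)
qed

lemma mean_inverse_nonneg:
  assumes "coordinate h \<theta>" and "- \<theta> < z"
  shows "0 \<le> mean_inverse h z"
  unfolding mean_inverse_def using AE_inverse_bounds[OF assms]
  by (intro integral_nonneg_AE, eventually_elim) simp

lemma inverse_lipschitz:
  fixes x y :: real
  assumes "0 < \<kappa>" "\<kappa> \<le> x" "\<kappa> \<le> y"
  shows "\<bar>1 / x - 1 / y\<bar> \<le> \<bar>x - y\<bar> / \<kappa>\<^sup>2"
proof -
  have "1 / x - 1 / y = (y - x) / (x * y)" using assms by (simp add: field_simps)
  moreover have "\<kappa>\<^sup>2 \<le> x * y" using assms by (auto simp: power2_eq_square intro!: mult_mono)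
  ultimately show ?thesis using assms
    by (auto simp: abs_mult abs_minus_commute intro!: divide_left_mono mult_pos_pos)
qed

lemma mean_inverse_lipschitz:
  assumes h: "coordinate h \<theta>" and "0 < \<kappa>" "\<kappa> \<le> \<theta> + z" "\<kappa> \<le> \<theta> + z'"
  shows "\<bar>mean_inverse h z - mean_inverse h z'\<bar> \<le> \<bar>z - z'\<bar> / \<kappa>\<^sup>2"
proof -
  let ?d = "\<lambda>e. 1 / (h e 1 + z) - 1 / (h e 1 + z')"
  have hb: "has_bochner_integral \<mu> ?d (mean_inverse h z - mean_inverse h z')"
    using assms by (intro has_bochner_integral_diff has_bochner_integral_inverse[OF h]) auto
  then have int: "integrable \<mu> ?d" by (simp add: has_bochner_integral_iff)
  have "\<bar>mean_inverse h z - mean_inverse h z'\<bar> \<le> (\<integral>e. \<bar>?d e\<bar> \<partial>\<mu>)"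
    using has_bochner_integral_integral_eq[OF hb] integral_abs_bound[of \<mu> ?d] by simp
  also have "\<dots> \<le> (\<integral>e. \<bar>z - z'\<bar> / \<kappa>\<^sup>2 \<partial>\<mu>)"
  proof (rule integral_mono_AE)
    show "AE e in \<mu>. \<bar>?d e\<bar> \<le> \<bar>z - z'\<bar> / \<kappa>\<^sup>2"
      using coordinateD(3)[OF h]
    proof eventually_elim
      case (elim e)
      then have "\<theta> \<le> h e 1" by simp
      then show ?case using inverse_lipschitz[of \<kappa> "h e 1 + z" "h e 1 + z'"] assms by simp
    qed
  qed (use int in auto)
  finally show ?thesis by (simp add: mu.prob_space)
qed

lemma coordinate_funpow:
  assumes "coordinate h \<theta>"
  shows "1 \<le> n \<Longrightarrow> h ((shift2 1 1 ^^ i) e) n = h e (n + i)"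
  by (induction i arbitrary: n) (use coordinateD(2)[OF assms, of _ 1] in simp_all)

text \<open>
  The ergodic theorem for bounded functions applies to \<open>1 / (h e 1 + z)\<close> once its denominator is truncated
  below at \<open>\<theta> + z\<close>, which changes it on a null set only.
\<close>

lemma average_inverse:
  assumes h: "coordinate h \<theta>" and z: "- \<theta> < z"
  shows "AE e in \<mu>. (\<lambda>n. (\<Sum>i = 1..n. 1 / (h e i + z)) / real n) \<longlonglongrightarrow> mean_inverse h z"
proof -
  note [measurable] = coordinateD(1)[OF h order_refl]
  let ?f = "\<lambda>e. 1 / max (\<theta> + z) (h e 1 + z)"
  have lim: "AE e in \<mu>. (\<lambda>n. (\<Sum>i<n. ?f ((shift2 1 1 ^^ i) e)) / real n) \<longlonglongrightarrow> (\<integral>e. ?f e \<partial>\<mu>)"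
  proof (rule ergodic_averages_tendsto[OF prob_mu ergodic, where K = "1 / (\<theta> + z)"])
    show "?f \<in> borel_measurable \<mu>" by measurable
  qed (use z in \<open>auto intro!: divide_left_mono mult_pos_pos simp: less_max_iff_disj\<close>)
  have eq: "(\<integral>e. ?f e \<partial>\<mu>) = mean_inverse h z"
    unfolding mean_inverse_def
  proof (rule integral_cong_AE)
    show "AE e in \<mu>. ?f e = 1 / (h e 1 + z)"
      using coordinateD(3)[OF h] by eventually_elim (simp add: max_absorb2)
  qed measurable
  show ?thesis
    using lim coordinateD(3)[OF h]
  proof eventually_elim
    case (elim e)
    have "?f ((shift2 1 1 ^^ i) e) = 1 / (h e (Suc i) + z)" for i
      using elim(2) coordinate_funpow[OF h, of 1 i e] by (simp add: max_absorb2)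
    then have "(\<Sum>i<n. ?f ((shift2 1 1 ^^ i) e)) = (\<Sum>i = 1..n. 1 / (h e i + z))" for n
      by (simp add: sum.atLeast1_atMost_eq)
    then show ?case using elim(1) unfolding eq by simp
  qed
qed

lemma has_bochner_integral_inverse_fst:
  "- \<alpha> < z \<Longrightarrow> 1 \<le> i \<Longrightarrow> has_bochner_integral \<mu> (\<lambda>e. 1 / (fst e i + z)) (A z)"
  unfolding A_def by (rule has_bochner_integral_inverse[OF coordinate_fst])

lemma has_bochner_integral_inverse_snd:
  "z < \<beta> \<Longrightarrow> 1 \<le> i \<Longrightarrow> has_bochner_integral \<mu> (\<lambda>e. 1 / (snd e i - z)) (B z)"
  unfolding B_def using has_bochner_integral_inverse[OF coordinate_snd, of "- z" i] by simp

lemma A_nonneg: "- \<alpha> < z \<Longrightarrow> 0 \<le> A z" and B_nonneg: "z < \<beta> \<Longrightarrow> 0 \<le> B z"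
  unfolding A_def B_def
  by (auto intro: mean_inverse_nonneg[OF coordinate_fst] mean_inverse_nonneg[OF coordinate_snd])

lemma A_lipschitz:
  "0 < \<kappa> \<Longrightarrow> \<kappa> \<le> \<alpha> + z \<Longrightarrow> \<kappa> \<le> \<alpha> + z' \<Longrightarrow> \<bar>A z - A z'\<bar> \<le> \<bar>z - z'\<bar> / \<kappa>\<^sup>2"
  unfolding A_def by (rule mean_inverse_lipschitz[OF coordinate_fst])

lemma B_lipschitz:
  "0 < \<kappa> \<Longrightarrow> \<kappa> \<le> \<beta> - z \<Longrightarrow> \<kappa> \<le> \<beta> - z' \<Longrightarrow> \<bar>B z - B z'\<bar> \<le> \<bar>z - z'\<bar> / \<kappa>\<^sup>2"
  unfolding B_def using mean_inverse_lipschitz[OF coordinate_snd, of \<kappa> "- z" "- z'"]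
  by (simp add: abs_minus_commute)

end

section \<open>Exponential weights in a random environment\<close>

context ergodic_environment
begin

abbreviation \<Omega> :: "(((nat \<Rightarrow> real) \<times> (nat \<Rightarrow> real)) \<times> (nat \<times> nat \<Rightarrow> real)) measure" where
  "\<Omega> \<equiv> \<mu> \<Otimes>\<^sub>M noise"

sublocale om: pair_prob_space \<mu> noise ..

text \<open>
  The rates \<open>a\<^sub>i + b\<^sub>j\<close> with the convention \<open>a\<^sub>0 = - z\<close> and \<open>b\<^sub>0 = z\<close>.  The origin, where they would add up
  to \<open>0\<close>, gets the rate \<open>1\<close>; its weight never enters a passage time.
\<close>

definition rate :: "real \<Rightarrow> (nat \<Rightarrow> real) \<times> (nat \<Rightarrow> real) \<Rightarrow> nat \<times> nat \<Rightarrow> real" where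
  "rate z e k = (if k = (0, 0) then 1
     else (if fst k = 0 then - z else fst e (fst k)) + (if snd k = 0 then z else snd e (snd k)))"

definition weight :: "real \<Rightarrow> ((nat \<Rightarrow> real) \<times> (nat \<Rightarrow> real)) \<times> (nat \<times> nat \<Rightarrow> real) \<Rightarrow> nat \<times> nat \<Rightarrow> real" where
  "weight z \<omega> k = snd \<omega> k / rate z (fst \<omega>) k"

definition passage :: "((nat \<Rightarrow> real) \<times> (nat \<Rightarrow> real)) \<times> (nat \<times> nat \<Rightarrow> real) \<Rightarrow> nat \<Rightarrow> nat \<Rightarrow> real" where
  "passage \<omega> = last_passage (\<lambda>(i, j). snd \<omega> (i, j) / (fst (fst \<omega>) i + snd (fst \<omega>) j))"

definition shift :: "nat \<Rightarrow> nat \<Rightarrow> ((nat \<Rightarrow> real) \<times> (nat \<Rightarrow> real)) \<times> (nat \<times> nat \<Rightarrow> real)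
    \<Rightarrow> ((nat \<Rightarrow> real) \<times> (nat \<Rightarrow> real)) \<times> (nat \<times> nat \<Rightarrow> real)" where
  "shift k l = (\<lambda>(e, \<xi>). (shift2 k l e, shift_weights k l \<xi>))"

lemma rate_simps:
  "1 \<le> i \<Longrightarrow> rate z e (i, 0) = fst e i + z"
  "1 \<le> j \<Longrightarrow> rate z e (0, j) = snd e j - z"
  "1 \<le> i \<Longrightarrow> 1 \<le> j \<Longrightarrow> rate z e (i, j) = fst e i + snd e j"
  "rate z e (0, 0) = 1"
  by (auto simp: rate_def)

text \<open>
  The interior weights do not depend on \<open>z\<close>, so any convenient parameter may be chosen in the boundary.
\<close>

lemma passage_eq: "passage \<omega> m n = last_passage (weight z \<omega>) m n"
  unfolding passage_def by (rule last_passage_cong) (auto simp: weight_def rate_simps)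

lemma passage_shift: "passage (shift k l \<omega>) m n = last_passage (shift_weights k l (weight z \<omega>)) m n"
  unfolding passage_def
  by (rule last_passage_cong)
     (auto simp: weight_def rate_simps shift_weights_def shift_def fst_snd_shift2 split: prod.splits)

lemma measurable_rate [measurable]: "(\<lambda>e. rate z e k) \<in> borel_measurable \<mu>"
  by (cases k; cases "fst k = 0"; cases "snd k = 0") (auto simp: rate_def)

lemma measurable_weight [measurable]: "(\<lambda>\<omega>. weight z \<omega> k) \<in> borel_measurable \<Omega>"
  unfolding weight_def by measurable

lemma measurable_passage [measurable]: "(\<lambda>\<omega>. passage \<omega> m n) \<in> borel_measurable \<Omega>"
  unfolding passage_eq[of _ _ _ 0] by measurable

lemma measurable_shift [measurable]: "shift k l \<in> measurable \<Omega> \<Omega>"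
  unfolding shift_def by measurable

lemma distr_shift: "distr \<Omega> \<Omega> (shift k l) = \<Omega>"
proof -
  have "distr \<mu> \<mu> (shift2 k l) \<Otimes>\<^sub>M distr noise noise (shift_weights k l) = distr \<Omega> \<Omega> (shift k l)"
    unfolding shift_def distr_noise_shift
    by (subst pair_measure_distr[symmetric])
       (auto simp: distr_noise_shift intro: prob_space_imp_sigma_finite prob_space_noise)
  then show ?thesis by (simp add: distr_shift2 distr_noise_shift)
qed

lemma prob_shift:
  assumes [measurable]: "Measurable.pred \<Omega> P"
  shows "om.prob {\<omega> \<in> space \<Omega>. P (shift k l \<omega>)} = om.prob {\<omega> \<in> space \<Omega>. P \<omega>}"
proof -
  have "om.prob {\<omega> \<in> space \<Omega>. P \<omega>} = measure (distr \<Omega> \<Omega> (shift k l)) {\<omega> \<in> space \<Omega>. P \<omega>}"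
    by (simp add: distr_shift)
  also have "\<dots> = om.prob (shift k l -` {\<omega> \<in> space \<Omega>. P \<omega>} \<inter> space \<Omega>)"
    by (rule measure_distr) measurable
  also have "shift k l -` {\<omega> \<in> space \<Omega>. P \<omega>} \<inter> space \<Omega> = {\<omega> \<in> space \<Omega>. P (shift k l \<omega>)}"
    using measurable_space[OF measurable_shift] by auto
  finally show ?thesis ..
qed

lemma AE_rate_pos:
  assumes "- \<alpha> < z" "z < \<beta>"
  shows "AE e in \<mu>. \<forall>k. 0 < rate z e k"
  using AE_ge_endpoints AE_space
proof eventually_elim
  case (elim e)
  show ?case
  proof
    fix k :: "nat \<times> nat"
    obtain i j where k: "k = (i, j)" by (cases k)
    have *: "1 \<le> i \<Longrightarrow> 0 < fst e i \<and> \<alpha> \<le> fst e i" "1 \<le> j \<Longrightarrow> 0 < snd e j \<and> \<beta> \<le> snd e j" for i j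
      using elim space_mu_pos by auto
    show "0 < rate z e k"
      using *(1)[of i] *(2)[of j] assms unfolding k rate_def by (auto simp: Suc_le_eq)
  qed
qed

lemma AE_weight_nonneg:
  assumes "- \<alpha> < z" "z < \<beta>"
  shows "AE \<omega> in \<Omega>. \<forall>k. 0 \<le> weight z \<omega> k"
proof (rule om.AE_pair_measure)
  show "{\<omega> \<in> space \<Omega>. \<forall>k. 0 \<le> weight z \<omega> k} \<in> sets \<Omega>" by measurable
  show "AE e in \<mu>. AE \<xi> in noise. \<forall>k. 0 \<le> weight z (e, \<xi>) k"
    using AE_rate_pos[OF assms]
  proof eventually_elim
    case (elim e)
    show ?case using AE_noise_nonneg
      by eventually_elim (use elim in \<open>auto simp: weight_def intro!: divide_nonneg_pos\<close>)
  qed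
qed

lemma noise_scaled:
  fixes f :: "(nat \<times> nat \<Rightarrow> real) \<Rightarrow> ennreal"
  assumes "\<And>k. 0 < rate z e k" and [measurable]: "f \<in> borel_measurable (PiM UNIV (\<lambda>_. borel))"
  shows "(\<integral>\<^sup>+\<xi>. f (weight z (e, \<xi>)) \<partial>noise) = (\<integral>\<^sup>+w. f w \<partial>PiM UNIV (\<lambda>k. exp_law (rate z e k)))"
proof -
  have m: "(\<lambda>\<xi> k. \<xi> k / rate z e k) \<in> measurable noise (PiM UNIV (\<lambda>_. borel))"
    by (rule measurable_PiM_single') auto
  show ?thesis
    unfolding distr_noise_scale[where r = "rate z e", OF assms(1), symmetric]
    by (subst nn_integral_distr[OF m]) (auto simp: weight_def[abs_def])
qed

text \<open>
  Given the environment, the mean is known from \<open>boundary_passage_moments\<close>; by stationarity each term of it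
  contributes \<open>A z\<close> or \<open>B z\<close> to the average over the environment.
\<close>

lemma boundary_mean:
  assumes z: "- \<alpha> < z" "z < \<beta>"
  shows "(\<integral>\<^sup>+\<omega>. ennreal (boundary_passage (weight z \<omega>) m n) \<partial>\<Omega>) = ennreal (real m * A z + real n * B z)"
proof -
  let ?B = "PiM UNIV (\<lambda>_. borel) :: (nat \<times> nat \<Rightarrow> real) measure"
  have bm [measurable]: "(\<lambda>w. boundary_passage w m n) \<in> borel_measurable ?B" by measurable
  have "(\<integral>\<^sup>+\<omega>. ennreal (boundary_passage (weight z \<omega>) m n) \<partial>\<Omega>)
      = (\<integral>\<^sup>+e. \<integral>\<^sup>+\<xi>. ennreal (boundary_passage (weight z (e, \<xi>)) m n) \<partial>noise \<partial>\<mu>)"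
    by (subst noise.nn_integral_fst[symmetric]) auto
  also have "\<dots> = (\<integral>\<^sup>+e. ennreal ((\<Sum>i = 1..m. 1 / (fst e i + z)) + (\<Sum>j = 1..n. 1 / (snd e j - z))) \<partial>\<mu>)"
  proof (rule nn_integral_cong_AE)
    show "AE e in \<mu>. (\<integral>\<^sup>+\<xi>. ennreal (boundary_passage (weight z (e, \<xi>)) m n) \<partial>noise)
      = ennreal ((\<Sum>i = 1..m. 1 / (fst e i + z)) + (\<Sum>j = 1..n. 1 / (snd e j - z)))"
      using AE_rate_pos[OF z]
    proof eventually_elim
      case (elim e)
      let ?P = "PiM UNIV (\<lambda>k. exp_law (rate z e k))"
      have r: "0 < rate z e k" for k using elim by blast
      have add: "rate z e (i, j) = rate z e (i, 0) + rate z e (0, j)" if "1 \<le> i" "1 \<le> j" for i j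
        using that by (simp add: rate_simps)
      note mom = boundary_passage_moments[where r = "rate z e", OF r add]
      have nn: "AE w in ?P. 0 \<le> boundary_passage w m n"
      proof -
        have "AE w in distr noise ?B (\<lambda>\<xi> k. \<xi> k / rate z e k). 0 \<le> boundary_passage w m n"
        proof (subst AE_distr_iff)
          show "(\<lambda>\<xi> k. \<xi> k / rate z e k) \<in> measurable noise ?B" by (rule measurable_PiM_single') auto
          show "AE \<xi> in noise. 0 \<le> boundary_passage (\<lambda>k. \<xi> k / rate z e k) m n"
            using AE_noise_nonneg
          proof eventually_elim
            case (elim \<xi>)
            have nn: "0 \<le> \<xi> k / rate z e k" for k
              using divide_nonneg_pos[OF spec[OF elim] r] .
            show ?case
              using last_passage_nonneg[of "\<lambda>k. \<xi> k / rate z e k", OF nn]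
                last_passage_le_boundary_passage[of "\<lambda>k. \<xi> k / rate z e k", OF nn] by (rule order_trans)
          qed
        qed auto
        then show ?thesis unfolding distr_noise_scale[where r = "rate z e", OF r] .
      qed
      have "(\<integral>\<^sup>+\<xi>. ennreal (boundary_passage (weight z (e, \<xi>)) m n) \<partial>noise)
          = (\<integral>\<^sup>+w. ennreal (boundary_passage w m n) \<partial>?P)"
        by (rule noise_scaled[OF r]) measurable
      also have "\<dots> = ennreal ((\<Sum>i = 1..m. 1 / rate z e (i, 0)) + (\<Sum>j = 1..n. 1 / rate z e (0, j)))"
        using nn mom(1) by (subst nn_integral_eq_integral) (auto simp: has_bochner_integral_iff)
      finally show ?case by (simp add: rate_simps)
    qed
  qed
  also have "\<dots> = ennreal (real m * A z + real n * B z)"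
  proof -
    have h: "has_bochner_integral \<mu> (\<lambda>e. (\<Sum>i = 1..m. 1 / (fst e i + z)) + (\<Sum>j = 1..n. 1 / (snd e j - z)))
      ((\<Sum>i = 1..m. A z) + (\<Sum>j = 1..n. B z))"
      by (intro has_bochner_integral_add has_bochner_integral_sum has_bochner_integral_inverse_fst
          has_bochner_integral_inverse_snd z) auto
    have nn: "AE e in \<mu>. 0 \<le> (\<Sum>i = 1..m. 1 / (fst e i + z)) + (\<Sum>j = 1..n. 1 / (snd e j - z))"
      using AE_rate_pos[OF z]
    proof eventually_elim
      case (elim e)
      then show ?case
        by (intro add_nonneg_nonneg sum_nonneg)
          (auto simp: rate_simps[symmetric] less_imp_le)
    qed
    show ?thesis
      using h nn by (subst nn_integral_eq_integral) (auto simp: has_bochner_integral_iff)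
  qed
  finally show ?thesis .
qed

lemma boundary_second_moment:
  assumes "0 < \<kappa>" "\<kappa> \<le> \<alpha> + z" "\<kappa> \<le> \<beta> - z"
  shows "(\<integral>\<^sup>+\<omega>. ennreal ((boundary_passage (weight z \<omega>) m n)\<^sup>2) \<partial>\<Omega>) \<le> ennreal (2 / \<kappa>\<^sup>2 * (real (m + n))\<^sup>2)"
proof -
  have z: "- \<alpha> < z" "z < \<beta>" using assms by auto
  have "(\<integral>\<^sup>+\<omega>. ennreal ((boundary_passage (weight z \<omega>) m n)\<^sup>2) \<partial>\<Omega>)
      = (\<integral>\<^sup>+e. \<integral>\<^sup>+\<xi>. ennreal ((boundary_passage (weight z (e, \<xi>)) m n)\<^sup>2) \<partial>noise \<partial>\<mu>)"
    by (subst noise.nn_integral_fst[symmetric]) auto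
  also have "\<dots> \<le> (\<integral>\<^sup>+e. ennreal (2 / \<kappa>\<^sup>2 * (real (m + n))\<^sup>2) \<partial>\<mu>)"
  proof (rule nn_integral_mono_AE)
    show "AE e in \<mu>. (\<integral>\<^sup>+\<xi>. ennreal ((boundary_passage (weight z (e, \<xi>)) m n)\<^sup>2) \<partial>noise)
      \<le> ennreal (2 / \<kappa>\<^sup>2 * (real (m + n))\<^sup>2)"
      using AE_rate_pos[OF z] AE_ge_endpoints
    proof eventually_elim
      case (elim e)
      let ?P = "PiM UNIV (\<lambda>k. exp_law (rate z e k))"
      have r: "0 < rate z e k" for k using elim by blast
      have add: "rate z e (i, j) = rate z e (i, 0) + rate z e (0, j)" if "1 \<le> i" "1 \<le> j" for i j
        using that by (simp add: rate_simps)
      note mom = boundary_passage_moments[where r = "rate z e" and m = m and n = n, OF r add]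
      have bd: "2 / (fst e i + z)\<^sup>2 \<le> 2 / \<kappa>\<^sup>2" "2 / (snd e i - z)\<^sup>2 \<le> 2 / \<kappa>\<^sup>2" if "1 \<le> i" for i
      proof -
        have "\<kappa> \<le> fst e i + z" "\<kappa> \<le> snd e i - z" using elim(2) that assms by fastforce+
        then show "2 / (fst e i + z)\<^sup>2 \<le> 2 / \<kappa>\<^sup>2" "2 / (snd e i - z)\<^sup>2 \<le> 2 / \<kappa>\<^sup>2"
          using \<open>0 < \<kappa>\<close> by (auto intro!: divide_left_mono power_mono mult_pos_pos)
      qed
      have "(\<integral>\<^sup>+\<xi>. ennreal ((boundary_passage (weight z (e, \<xi>)) m n)\<^sup>2) \<partial>noise)
          = (\<integral>\<^sup>+w. ennreal ((boundary_passage w m n)\<^sup>2) \<partial>?P)"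
        by (rule noise_scaled[OF r]) measurable
      also have "\<dots> = ennreal (\<integral>w. (boundary_passage w m n)\<^sup>2 \<partial>?P)"
        using mom(2) by (intro nn_integral_eq_integral) auto
      also have "\<dots> \<le> ennreal (real (m + n) * ((\<Sum>i = 1..m. 2 / (rate z e (i, 0))\<^sup>2) + (\<Sum>j = 1..n. 2 / (rate z e (0, j))\<^sup>2)))"
        using mom(3) by (rule ennreal_leI)
      also have "\<dots> \<le> ennreal (real (m + n) * ((\<Sum>i = 1..m. 2 / \<kappa>\<^sup>2) + (\<Sum>j = 1..n. 2 / \<kappa>\<^sup>2)))"
        using bd by (intro ennreal_leI mult_left_mono add_mono sum_mono) (auto simp: rate_simps)
      also have "\<dots> = ennreal (2 / \<kappa>\<^sup>2 * (real (m + n))\<^sup>2)"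
        by (intro arg_cong[where f = ennreal]) (simp add: power2_eq_square algebra_simps add_divide_distrib)
      finally show ?case .
    qed
  qed
  also have "\<dots> = ennreal (2 / \<kappa>\<^sup>2 * (real (m + n))\<^sup>2)" by (simp add: mu.emeasure_space_1)
  finally show ?thesis .
qed

end

section \<open>A law of large numbers along lines\<close>

context ergodic_environment
begin

lemma AE_environment:
  assumes "AE e in \<mu>. P e"
  shows "AE \<omega> in \<Omega>. P (fst \<omega>)"
proof -
  have "AE e in distr \<Omega> \<mu> fst. P e"
    by (subst noise.distr_pair_fst) (rule assms)
  then show ?thesis by (rule AE_distrD[rotated]) simp
qed

lemma AE_noise_nonneg': "AE \<omega> in \<Omega>. \<forall>k. 0 \<le> snd \<omega> k"
  by (rule om.AE_pair_measure) (use AE_noise_nonneg in auto)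

text \<open>
  The noise is replaced by its mean at the cost of a deviation that is small in probability, uniformly in
  the environment; what remains is an average over the environment alone.
\<close>

lemma weighted_noise_average:
  fixes c :: "nat \<Rightarrow> (nat \<Rightarrow> real) \<times> (nat \<Rightarrow> real) \<Rightarrow> real"
  assumes k: "inj k" and c [measurable]: "\<And>i. 1 \<le> i \<Longrightarrow> c i \<in> borel_measurable \<mu>"
    and bound: "AE e in \<mu>. \<forall>i\<ge>1. 0 \<le> c i e \<and> c i e \<le> C"
    and lim: "AE e in \<mu>. (\<lambda>n. (\<Sum>i = 1..n. c i e) / real n) \<longlonglongrightarrow> m" and "0 < \<epsilon>"
  shows "(\<lambda>n. om.prob {\<omega> \<in> space \<Omega>. \<epsilon> \<le> \<bar>(\<Sum>i = 1..n. c i (fst \<omega>) * snd \<omega> (k i)) / real n - m\<bar>}) \<longlonglongrightarrow> 0"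
proof -
  let ?X = "\<lambda>n \<omega>. (\<Sum>i = 1..n. c i (fst \<omega>) * snd \<omega> (k i)) / real n"
  let ?Y = "\<lambda>n \<omega>. (\<Sum>i = 1..n. c i (fst \<omega>)) / real n"
  let ?Z = "\<lambda>n \<omega>. \<Sum>i = 1..n. c i (fst \<omega>) * (snd \<omega> (k i) - 1)"
  let ?E = "\<lambda>n. {\<omega> \<in> space \<Omega>. \<epsilon> \<le> \<bar>?X n \<omega> - m\<bar>}"
  let ?F = "\<lambda>n. {\<omega> \<in> space \<Omega>. \<epsilon> / 2 \<le> \<bar>?Y n \<omega> - m\<bar>}"
  let ?G = "\<lambda>n. {\<omega> \<in> space \<Omega>. \<epsilon> / 2 * real n \<le> \<bar>?Z n \<omega>\<bar>}"
  have cm [measurable]: "(\<lambda>\<omega>. c i (fst \<omega>)) \<in> borel_measurable \<Omega>" if "i \<in> {1..n}" for i n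
    using that by (intro measurable_compose[OF measurable_fst c]) auto
  have Em [measurable]: "?E n \<in> sets \<Omega>" "?F n \<in> sets \<Omega>" "?G n \<in> sets \<Omega>" for n
    by measurable
  have F0: "(\<lambda>n. om.prob (?F n)) \<longlonglongrightarrow> 0"
    using \<open>0 < \<epsilon>\<close> by (intro om.AE_tendsto_imp_prob_tendsto AE_environment[OF lim]) measurable
  have G: "om.prob (?G n) \<le> C\<^sup>2 / ((\<epsilon> / 2)\<^sup>2 * real n)" if n: "1 \<le> n" for n
  proof -
    have "emeasure \<Omega> (?G n) = (\<integral>\<^sup>+e. emeasure noise (Pair e -` ?G n) \<partial>\<mu>)"
      by (rule noise.emeasure_pair_measure_alt) (rule Em)
    also have "\<dots> \<le> (\<integral>\<^sup>+e. ennreal (C\<^sup>2 / ((\<epsilon> / 2)\<^sup>2 * real n)) \<partial>\<mu>)"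
    proof (rule nn_integral_mono_AE)
      show "AE e in \<mu>. emeasure noise (Pair e -` ?G n) \<le> ennreal (C\<^sup>2 / ((\<epsilon> / 2)\<^sup>2 * real n))"
        using bound AE_space
      proof eventually_elim
        case (elim e)
        have "Pair e -` ?G n = {\<xi> \<in> space noise. \<epsilon> / 2 * real n \<le> \<bar>\<Sum>i = 1..n. c i e * (\<xi> (k i) - 1)\<bar>}"
          using elim(2) by (auto simp: space_pair_measure)
        then show ?case
          using noise_weighted_sum_deviation[OF k, of "\<lambda>i. c i e" C "\<epsilon> / 2" n] elim(1) \<open>0 < \<epsilon>\<close> n
          by (auto simp: noise.emeasure_eq_measure intro!: ennreal_leI)
      qed
    qed
    also have "\<dots> = ennreal (C\<^sup>2 / ((\<epsilon> / 2)\<^sup>2 * real n))" by (simp add: mu.emeasure_space_1)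
    finally show ?thesis
      by (simp add: om.emeasure_eq_measure ennreal_le_iff)
  qed
  have sub: "?E n \<subseteq> ?F n \<union> ?G n" if n: "1 \<le> n" for n
  proof
    fix \<omega> assume \<omega>: "\<omega> \<in> ?E n"
    have "?X n \<omega> - m = (?Y n \<omega> - m) + ?Z n \<omega> / real n"
      by (simp add: sum_subtractf right_diff_distrib diff_divide_distrib)
    then have "\<epsilon> \<le> \<bar>?Y n \<omega> - m\<bar> + \<bar>?Z n \<omega>\<bar> / real n"
      using \<omega> abs_triangle_ineq[of "?Y n \<omega> - m" "?Z n \<omega> / real n"] by auto
    then have "\<epsilon> / 2 \<le> \<bar>?Y n \<omega> - m\<bar> \<or> \<epsilon> / 2 \<le> \<bar>?Z n \<omega>\<bar> / real n" by linarith
    then show "\<omega> \<in> ?F n \<union> ?G n" using \<omega> n by (auto simp: field_simps)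
  qed
  have le: "om.prob (?E n) \<le> om.prob (?F n) + C\<^sup>2 / ((\<epsilon> / 2)\<^sup>2 * real n)" if "1 \<le> n" for n
  proof -
    have "om.prob (?E n) \<le> om.prob (?F n \<union> ?G n)"
      by (intro om.finite_measure_mono sub that) auto
    also have "\<dots> \<le> om.prob (?F n) + om.prob (?G n)" by (rule measure_Un_le) auto
    finally show ?thesis using G[OF that] by linarith
  qed
  show ?thesis
  proof (rule tendsto_sandwich[OF _ _ tendsto_const])
    show "\<forall>\<^sub>F n in sequentially. om.prob (?E n) \<le> om.prob (?F n) + C\<^sup>2 / ((\<epsilon> / 2)\<^sup>2 * real n)"
      using eventually_ge_at_top[of 1] by eventually_elim (rule le)
    have "(\<lambda>n. C\<^sup>2 / (\<epsilon> / 2)\<^sup>2 * (1 / real n)) \<longlonglongrightarrow> 0"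
      by (intro tendsto_mult_right_zero lim_1_over_n)
    then have "(\<lambda>n. C\<^sup>2 / ((\<epsilon> / 2)\<^sup>2 * real n)) \<longlonglongrightarrow> 0" by simp
    with F0 show "(\<lambda>n. om.prob (?F n) + C\<^sup>2 / ((\<epsilon> / 2)\<^sup>2 * real n)) \<longlonglongrightarrow> 0"
      using tendsto_add by fastforce
  qed simp
qed

lemma line_average:
  assumes h: "coordinate h \<theta>" and z: "- \<theta> < z" and "inj k" and "0 < \<epsilon>"
  shows "(\<lambda>n. om.prob {\<omega> \<in> space \<Omega>.
    \<epsilon> \<le> \<bar>(\<Sum>i = 1..n. snd \<omega> (k i) / (h (fst \<omega>) i + z)) / real n - mean_inverse h z\<bar>}) \<longlonglongrightarrow> 0"
proof -
  have m: "(\<lambda>e. 1 / (h e i + z)) \<in> borel_measurable \<mu>" if "1 \<le> i" for i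
    using coordinateD(1)[OF h that] by measurable
  from weighted_noise_average[OF \<open>inj k\<close> m AE_inverse_bounds[OF h z] average_inverse[OF h z] \<open>0 < \<epsilon>\<close>]
  show ?thesis by simp
qed

lemma row_average:
  assumes "- \<alpha> < z" and "0 < \<epsilon>"
  shows "(\<lambda>n. om.prob {\<omega> \<in> space \<Omega>. \<epsilon> \<le> \<bar>(\<Sum>i = 1..n. snd \<omega> (i, j) / (fst (fst \<omega>) i + z)) / real n - A z\<bar>}) \<longlonglongrightarrow> 0"
  unfolding A_def using assms by (intro line_average[OF coordinate_fst]) (auto simp: inj_def)

lemma column_average:
  assumes "z < \<beta>" and "0 < \<epsilon>"
  shows "(\<lambda>n. om.prob {\<omega> \<in> space \<Omega>. \<epsilon> \<le> \<bar>(\<Sum>j = 1..n. snd \<omega> (i, j) / (snd (fst \<omega>) j - z)) / real n - B z\<bar>}) \<longlonglongrightarrow> 0"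
  unfolding B_def using line_average[OF coordinate_snd, of "- z" "\<lambda>j. (i, j)" \<epsilon>] assms by (simp add: inj_def)

end

section \<open>The shape function and its upper bound\<close>

locale shape_environment = ergodic_environment +
  fixes g :: "real \<Rightarrow> real \<Rightarrow> ennreal"
  assumes shape: "is_shape_function \<mu> g"
begin

text \<open>
  The interior rates are positive everywhere on the environment space, so this holds without exceptional
  null set.
\<close>

lemma quenched_law_eq:
  assumes e: "e \<in> space \<mu>"
  shows "quenched_law e = distr noise (PiM ({1..} \<times> {1..}) (\<lambda>_. borel))
    (\<lambda>\<xi>. \<lambda>k\<in>{1..} \<times> {1..}. \<xi> k / (fst e (fst k) + snd e (snd k)))" (is "_ = distr noise ?B ?f")
proof -
  let ?S = "{1..} \<times> {1..} :: (nat \<times> nat) set"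
  define r where "r k = (if k \<in> ?S then fst e (fst k) + snd e (snd k) else 1)" for k
  have r: "0 < r k" for k
    using space_mu_pos[OF e] by (auto simp: r_def add_pos_pos)
  have m: "(\<lambda>\<xi> k. \<xi> k / r k) \<in> measurable noise (PiM UNIV (\<lambda>_. borel))"
    by (rule measurable_PiM_single') auto
  have "quenched_law e = PiM ?S (\<lambda>k. exp_law (r k))"
    unfolding quenched_law_def by (cases e) (auto simp: r_def intro!: PiM_cong)
  also have "\<dots> = distr (PiM UNIV (\<lambda>k. exp_law (r k))) (PiM ?S (\<lambda>k. exp_law (r k))) (\<lambda>w. \<lambda>k\<in>?S. w k)"
    by (rule distr_PiM_reindex[where f = "\<lambda>k. k", symmetric]) (auto intro: prob_space_exponential_density r)
  also have "\<dots> = distr (distr noise (PiM UNIV (\<lambda>_. borel)) (\<lambda>\<xi> k. \<xi> k / r k)) ?B (\<lambda>w. \<lambda>k\<in>?S. w k)"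
    unfolding distr_noise_scale[where r = r, OF r]
    by (rule distr_cong[OF refl _ refl]) (rule sets_PiM_cong, auto)
  also have "\<dots> = distr noise ?B (\<lambda>\<xi>. \<lambda>k\<in>?S. \<xi> k / r k)"
    using m by (subst distr_distr) (auto simp: comp_def)
  also have "\<dots> = distr noise ?B ?f"
    by (intro distr_cong) (auto simp: r_def fun_eq_iff)
  finally show ?thesis .
qed

text \<open>
  For fixed \<open>s\<close> and \<open>t\<close> the convergence is a measurable event, so that its almost sure occurrence under the
  annealed law passes to almost every environment and noise.
\<close>

lemma AE_passage_limit:
  assumes "0 < s" "0 < t"
  shows "AE \<omega> in \<Omega>. (\<lambda>n. ennreal (passage \<omega> (scaled n s) (scaled n t) / real n)) \<longlonglongrightarrow> g s t"
proof -
  let ?S = "{1..} \<times> {1..} :: (nat \<times> nat) set"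
  let ?B = "PiM ?S (\<lambda>_. borel) :: (nat \<times> nat \<Rightarrow> real) measure"
  let ?f = "\<lambda>e \<xi>. \<lambda>k\<in>?S. \<xi> k / (fst e (fst k) + snd e (snd k)) :: real"
  let ?X = "\<lambda>n w. ennreal (last_passage w (scaled n s) (scaled n t) / real n)"
  have fm: "case_prod ?f \<in> measurable \<Omega> ?B"
    unfolding case_prod_beta' by (rule measurable_restrict) (auto simp: Suc_le_eq)
  have kernel: "quenched_law \<in> measurable \<mu> (subprob_algebra ?B)"
  proof (subst measurable_cong[OF quenched_law_eq])
    show "(\<lambda>e. distr noise ?B (?f e)) \<in> measurable \<mu> (subprob_algebra ?B)"
      by (rule measurable_distr2[OF fm])
         (auto simp: space_subprob_algebra prob_space_imp_subprob_space prob_space_noise)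
  qed
  have Xm [measurable]: "?X n \<in> borel_measurable ?B" for n
    by (intro measurable_compose[OF _ measurable_ennreal] borel_measurable_divide measurable_last_passage) auto
  have pm: "Measurable.pred ?B (\<lambda>w. (\<lambda>n. ?X n w) \<longlonglongrightarrow> g s t)"
    by measurable
  have "AE w in annealed_law \<mu>. (\<lambda>n. ?X n w) \<longlonglongrightarrow> g s t"
    using shape unfolding is_shape_function_def
  proof eventually_elim
    case (elim w)
    then have "(\<lambda>n. ereal (last_passage w (scaled n s) (scaled n t) / real n)) \<longlonglongrightarrow> enn2ereal (g s t)"
      using assms by blast
    then have "(\<lambda>n. e2ennreal (ereal (last_passage w (scaled n s) (scaled n t) / real n))) \<longlonglongrightarrow> e2ennreal (enn2ereal (g s t))"
      by (rule tendsto_e2ennrealI)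
    then show ?case by simp
  qed
  then have "AE e in \<mu>. AE w in quenched_law e. (\<lambda>n. ?X n w) \<longlonglongrightarrow> g s t"
    unfolding annealed_law_def AE_bind[OF kernel pm] .
  then have ae: "AE e in \<mu>. AE \<xi> in noise. (\<lambda>n. ennreal (passage (e, \<xi>) (scaled n s) (scaled n t) / real n)) \<longlonglongrightarrow> g s t"
    using AE_space
  proof eventually_elim
    case (elim e)
    have "?f e \<in> measurable noise ?B" by (rule measurable_restrict) simp
    then have "AE \<xi> in noise. (\<lambda>n. ?X n (?f e \<xi>)) \<longlonglongrightarrow> g s t"
      using elim(1) unfolding quenched_law_eq[OF elim(2)] by (rule AE_distrD)
    moreover have "last_passage (?f e \<xi>) m n = passage (e, \<xi>) m n" for \<xi> m n
      unfolding passage_def by (rule last_passage_cong) auto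
    ultimately show ?case by simp
  qed
  show ?thesis
    by (rule om.AE_pair_measure[OF _ ae]) measurable
qed

lemma exists_interior_parameter: "\<exists>z. - \<alpha> < z \<and> z < \<beta>"
  using endpoints by (intro exI[of _ "(\<beta> - \<alpha>) / 2"]) (auto simp: field_simps)

lemma AE_passage_nonneg: "AE \<omega> in \<Omega>. \<forall>m n. 0 \<le> passage \<omega> m n"
  and AE_passage_mono:
    "AE \<omega> in \<Omega>. \<forall>m n m' n'. m \<le> m' \<longrightarrow> n \<le> n' \<longrightarrow> passage \<omega> m n \<le> passage \<omega> m' n'"
  and AE_passage_superadditive:
    "AE \<omega> in \<Omega>. \<forall>m n m' n'. passage \<omega> m n + passage (shift m n \<omega>) m' n' \<le> passage \<omega> (m + m') (n + n')"
proof -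
  obtain z where "- \<alpha> < z" "z < \<beta>" using exists_interior_parameter by auto
  from AE_weight_nonneg[OF this] have w: "AE \<omega> in \<Omega>. \<forall>k. 0 \<le> weight z \<omega> k" .
  show "AE \<omega> in \<Omega>. \<forall>m n. 0 \<le> passage \<omega> m n"
    using w by eventually_elim (auto simp only: passage_eq[where z = z] intro!: last_passage_nonneg)
  show "AE \<omega> in \<Omega>. \<forall>m n m' n'. m \<le> m' \<longrightarrow> n \<le> n' \<longrightarrow> passage \<omega> m n \<le> passage \<omega> m' n'"
    using w by eventually_elim (auto simp only: passage_eq[where z = z] intro!: last_passage_mono)
  show "AE \<omega> in \<Omega>. \<forall>m n m' n'. passage \<omega> m n + passage (shift m n \<omega>) m' n' \<le> passage \<omega> (m + m') (n + n')"
    unfolding passage_shift[where z = z] unfolding passage_eq[where z = z]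
    using w by eventually_elim (auto intro!: last_passage_superadditive)
qed

definition drift where "drift z s t = s * A z + t * B z"

text \<open>
  The passage times are dominated by those of the boundary model, whose means are known.  Fatou's lemma then
  bounds \<open>g\<close>, and in particular shows that it is finite.
\<close>

lemma g_le:
  assumes "0 < s" "0 < t" and z: "- \<alpha> < z" "z < \<beta>"
  shows "g s t \<le> ennreal (drift z s t)"
proof -
  let ?X = "\<lambda>n \<omega>. ennreal (passage \<omega> (scaled n s) (scaled n t) / real n)"
  let ?a = "\<lambda>n. (real (scaled n s) / real n) * A z + (real (scaled n t) / real n) * B z"
  have "g s t = (\<integral>\<^sup>+\<omega>. g s t \<partial>\<Omega>)" by (simp add: om.emeasure_space_1)
  also have "\<dots> = (\<integral>\<^sup>+\<omega>. liminf (\<lambda>n. ?X n \<omega>) \<partial>\<Omega>)"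
    using AE_passage_limit[OF assms(1,2)]
    by (intro nn_integral_cong_AE, eventually_elim) (simp add: lim_imp_Liminf)
  also have "\<dots> \<le> liminf (\<lambda>n. \<integral>\<^sup>+\<omega>. ?X n \<omega> \<partial>\<Omega>)"
    by (rule nn_integral_liminf) measurable
  also have "\<dots> \<le> liminf (\<lambda>n. ennreal (?a n))"
  proof (rule Liminf_mono, rule always_eventually, rule allI)
    fix n
    have "(\<integral>\<^sup>+\<omega>. ?X n \<omega> \<partial>\<Omega>)
        \<le> (\<integral>\<^sup>+\<omega>. ennreal (1 / real n) * ennreal (boundary_passage (weight z \<omega>) (scaled n s) (scaled n t)) \<partial>\<Omega>)"
      using AE_weight_nonneg[OF z]
    proof (intro nn_integral_mono_AE, eventually_elim)
      case (elim \<omega>)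
      then have "passage \<omega> (scaled n s) (scaled n t) \<le> boundary_passage (weight z \<omega>) (scaled n s) (scaled n t)"
        unfolding passage_eq[of _ _ _ z] by (intro last_passage_le_boundary_passage) blast
      then show ?case
        by (auto simp: ennreal_mult'[symmetric] intro!: ennreal_leI divide_right_mono)
    qed
    also have "\<dots> = ennreal (1 / real n) * ennreal (real (scaled n s) * A z + real (scaled n t) * B z)"
      by (subst nn_integral_cmult) (auto simp: boundary_mean[OF z])
    also have "\<dots> = ennreal (?a n)"
      by (subst ennreal_mult'[symmetric]) (auto simp: add_divide_distrib)
    finally show "(\<integral>\<^sup>+\<omega>. ?X n \<omega> \<partial>\<Omega>) \<le> ennreal (?a n)" .
  qed
  also have "\<dots> = ennreal (drift z s t)"
    unfolding drift_def using assms
    by (intro lim_imp_Liminf tendsto_ennrealI tendsto_add tendsto_mult tendsto_const scaled_tendsto) auto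
  finally show ?thesis .
qed

definition \<gamma> where "\<gamma> s t = enn2real (g s t)"

lemma g_eq: "0 < s \<Longrightarrow> 0 < t \<Longrightarrow> g s t = ennreal (\<gamma> s t)"
proof -
  assume "0 < s" "0 < t"
  obtain z where "- \<alpha> < z" "z < \<beta>" using exists_interior_parameter by auto
  from g_le[OF \<open>0 < s\<close> \<open>0 < t\<close> this] have "g s t < top" by (rule le_less_trans) simp
  then show ?thesis by (simp add: \<gamma>_def)
qed

lemma \<gamma>_nonneg: "0 \<le> \<gamma> s t" by (simp add: \<gamma>_def)

lemma drift_nonneg: "0 < s \<Longrightarrow> 0 < t \<Longrightarrow> - \<alpha> < z \<Longrightarrow> z < \<beta> \<Longrightarrow> 0 \<le> drift z s t"
  unfolding drift_def by (intro add_nonneg_nonneg mult_nonneg_nonneg A_nonneg B_nonneg) auto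

lemma AE_passage_tendsto:
  assumes "0 < s" "0 < t"
  shows "AE \<omega> in \<Omega>. (\<lambda>n. passage \<omega> (scaled n s) (scaled n t) / real n) \<longlonglongrightarrow> \<gamma> s t"
  using AE_passage_limit[OF assms] AE_passage_nonneg
proof eventually_elim
  case (elim \<omega>)
  have nn: "\<forall>\<^sub>F n in sequentially. 0 \<le> passage \<omega> (scaled n s) (scaled n t) / real n"
    using elim(2) by (intro always_eventually allI divide_nonneg_nonneg) auto
  show ?case
    using elim(1) unfolding g_eq[OF assms] by (rule tendsto_ennrealD[OF _ nn \<gamma>_nonneg])
qed

text \<open>
  The shifts may depend on \<open>n\<close>: only the law of the passage time matters, and each shift preserves it.
\<close>

lemma prob_passage_deviation:
  assumes "0 < s" "0 < t" "0 < \<epsilon>"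
  shows "(\<lambda>n. om.prob {\<omega> \<in> space \<Omega>. \<epsilon> \<le> \<bar>passage (shift (k n) (l n) \<omega>) (scaled n s) (scaled n t) / real n - \<gamma> s t\<bar>}) \<longlonglongrightarrow> 0"
proof -
  have eq: "om.prob {\<omega> \<in> space \<Omega>. \<epsilon> \<le> \<bar>passage (shift (k n) (l n) \<omega>) (scaled n s) (scaled n t) / real n - \<gamma> s t\<bar>}
    = om.prob {\<omega> \<in> space \<Omega>. \<epsilon> \<le> \<bar>passage \<omega> (scaled n s) (scaled n t) / real n - \<gamma> s t\<bar>}" for n
    by (rule prob_shift[where P = "\<lambda>\<omega>. \<epsilon> \<le> \<bar>passage \<omega> (scaled n s) (scaled n t) / real n - \<gamma> s t\<bar>"]) measurable
  show ?thesis
    unfolding eq by (intro om.AE_tendsto_imp_prob_tendsto AE_passage_tendsto assms) measurable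
qed

section \<open>Superadditivity and homogeneity\<close>

text \<open>
  Superadditivity holds for the passage times at every scale, with the second one started at a corner that moves with
  \<open>n\<close>.  As convergence in probability is insensitive to that shift, it passes to the limit.
\<close>

lemma \<gamma>_superadditive:
  assumes pos: "0 < s" "0 < t" "0 < s'" "0 < t'"
  shows "\<gamma> s t + \<gamma> s' t' \<le> \<gamma> (s + s') (t + t')"
proof (rule field_le_epsilon)
  fix e :: real assume "0 < e"
  define \<epsilon> where "\<epsilon> = e / 3"
  have \<epsilon>: "0 < \<epsilon>" using \<open>0 < e\<close> by (simp add: \<epsilon>_def)
  let ?E = "\<lambda>k l s t n. {\<omega> \<in> space \<Omega>. \<epsilon> \<le> \<bar>passage (shift (k n) (l n) \<omega>) (scaled n s) (scaled n t) / real n - \<gamma> s t\<bar>}"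
  let ?E1 = "?E (\<lambda>_. 0) (\<lambda>_. 0) s t"
  let ?E2 = "?E (\<lambda>n. scaled n s) (\<lambda>n. scaled n t) s' t'"
  let ?E3 = "?E (\<lambda>_. 0) (\<lambda>_. 0) (s + s') (t + t')"
  have "(\<lambda>n. om.prob (?E1 n) + om.prob (?E2 n) + om.prob (?E3 n)) \<longlonglongrightarrow> 0 + 0 + 0"
    using pos \<epsilon> by (intro tendsto_add prob_passage_deviation) auto
  then have "\<forall>\<^sub>F n in sequentially. om.prob (?E1 n) + om.prob (?E2 n) + om.prob (?E3 n) < 1"
    by (rule order_tendstoD) simp
  then obtain n where n: "om.prob (?E1 n) + om.prob (?E2 n) + om.prob (?E3 n) < 1" "1 \<le> n"
    using eventually_happens'[OF _ eventually_conj[OF _ eventually_ge_at_top[of 1]]] sequentially_bot by blast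
  have [measurable]: "?E1 n \<in> sets \<Omega>" "?E2 n \<in> sets \<Omega>" "?E3 n \<in> sets \<Omega>" by measurable
  have "om.prob (?E1 n \<union> ?E2 n \<union> ?E3 n) < 1"
    using n(1) measure_Un_le[of "?E1 n" \<Omega> "?E2 n"] measure_Un_le[of "?E1 n \<union> ?E2 n" \<Omega> "?E3 n"]
    by force
  from om.exists_outside_event[OF AE_conjI[OF AE_passage_mono AE_passage_superadditive] _ this]
  obtain \<omega> where \<omega>: "\<omega> \<in> space \<Omega>" "\<omega> \<notin> ?E1 n \<union> ?E2 n \<union> ?E3 n"
    and mono: "\<forall>m n m' n'. m \<le> m' \<longrightarrow> n \<le> n' \<longrightarrow> passage \<omega> m n \<le> passage \<omega> m' n'"
    and super: "\<forall>m n m' n'. passage \<omega> m n + passage (shift m n \<omega>) m' n' \<le> passage \<omega> (m + m') (n + n')"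
    by auto
  have sh: "passage (shift 0 0 \<omega>) m n = passage \<omega> m n" for m n
    unfolding passage_def by (rule last_passage_cong) (auto simp: shift_def shift_weights_def fst_snd_shift2 split: prod.splits)
  have le: "scaled n s + scaled n s' \<le> scaled n (s + s')" "scaled n t + scaled n t' \<le> scaled n (t + t')"
    using pos by (simp_all add: nat_add_distrib[symmetric] distrib_left le_floor_add nat_mono)
  have "passage \<omega> (scaled n s) (scaled n t) + passage (shift (scaled n s) (scaled n t) \<omega>) (scaled n s') (scaled n t')
      \<le> passage \<omega> (scaled n (s + s')) (scaled n (t + t'))"
    using order_trans[OF super[rule_format] mono[rule_format, OF le]] .
  then have key: "passage \<omega> (scaled n s) (scaled n t) / real n
      + passage (shift (scaled n s) (scaled n t) \<omega>) (scaled n s') (scaled n t') / real n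
      \<le> passage \<omega> (scaled n (s + s')) (scaled n (t + t')) / real n"
    unfolding add_divide_distrib[symmetric] by (intro divide_right_mono) auto
  show "\<gamma> s t + \<gamma> s' t' \<le> \<gamma> (s + s') (t + t') + e"
  proof -
    have "\<bar>passage \<omega> (scaled n s) (scaled n t) / real n - \<gamma> s t\<bar> < \<epsilon>"
      "\<bar>passage (shift (scaled n s) (scaled n t) \<omega>) (scaled n s') (scaled n t') / real n - \<gamma> s' t'\<bar> < \<epsilon>"
      "\<bar>passage \<omega> (scaled n (s + s')) (scaled n (t + t')) / real n - \<gamma> (s + s') (t + t')\<bar> < \<epsilon>"
      using \<omega> by (simp_all only: sh Un_iff mem_Collect_eq de_Morgan_disj not_le simp_thms)
    with key show ?thesis
      unfolding \<epsilon>_def abs_less_iff by linarith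
  qed
qed

text \<open>
  Along the subsequence \<open>\<lfloor>n c\<rfloor>\<close> the passage times at \<open>(s, t)\<close> are bounded by those at \<open>(c s, c t)\<close> along \<open>n\<close>.
\<close>

lemma \<gamma>_scale:
  assumes pos: "0 < s" "0 < t" "0 < c"
  shows "c * \<gamma> s t \<le> \<gamma> (c * s) (c * t)"
proof -
  have "AE \<omega> in \<Omega>. c * \<gamma> s t \<le> \<gamma> (c * s) (c * t)"
    using AE_passage_mono AE_passage_tendsto[OF pos(1,2)] AE_passage_tendsto[OF mult_pos_pos[OF pos(3,1)] mult_pos_pos[OF pos(3,2)]]
  proof eventually_elim
    case (elim \<omega>)
    have 1: "(\<lambda>n. passage \<omega> (scaled n (c * s)) (scaled n (c * t)) / real n) \<longlonglongrightarrow> \<gamma> (c * s) (c * t)"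
      using elim(3) .
    have 2: "(\<lambda>N. passage \<omega> (scaled N s) (scaled N t) / real N) \<longlonglongrightarrow> \<gamma> s t"
      using elim(2) .
    have 3: "(\<lambda>n. (real (scaled n c) / real n) * (passage \<omega> (scaled (scaled n c) s) (scaled (scaled n c) t) / real (scaled n c)))
        \<longlonglongrightarrow> c * \<gamma> s t"
      using pos by (intro tendsto_mult scaled_tendsto filterlim_compose[OF 2 scaled_at_top]) auto
    have mono: "passage \<omega> (scaled (scaled n c) s) (scaled (scaled n c) t) \<le> passage \<omega> (scaled n (c * s)) (scaled n (c * t))" for n
    proof -
      have "scaled (scaled n c) x \<le> scaled n (c * x)" if "0 < x" for x
      proof -
        have "real (scaled n c) * x \<le> real n * c * x"
          using that scaled_le[of c n] pos by (intro mult_right_mono) auto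
        then show ?thesis by (intro nat_mono floor_mono) (simp add: mult.assoc)
      qed
      then show ?thesis using elim(1) pos by blast
    qed
    have "\<forall>\<^sub>F n in sequentially. 1 \<le> scaled n c"
      using scaled_at_top[OF pos(3)] by (auto simp: filterlim_at_top)
    then have "\<forall>\<^sub>F n in sequentially. (real (scaled n c) / real n) * (passage \<omega> (scaled (scaled n c) s) (scaled (scaled n c) t) / real (scaled n c))
        \<le> passage \<omega> (scaled n (c * s)) (scaled n (c * t)) / real n"
    proof eventually_elim
      case (elim n)
      have "passage \<omega> (scaled (scaled n c) s) (scaled (scaled n c) t) / real n \<le> passage \<omega> (scaled n (c * s)) (scaled n (c * t)) / real n"
        by (intro divide_right_mono mono) simp
      moreover have "real k / y * (x / real k) = x / y" if "1 \<le> k" for k :: nat and x y :: real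
        using that by simp
      ultimately show ?case using elim by presburger
    qed
    then show ?case by (intro tendsto_le[OF _ 1 3]) auto
  qed
  then show ?thesis using prob_space.AE_const[OF om.prob_space_axioms] by simp
qed

section \<open>Lower bounds from a single row or column\<close>

text \<open>
  As \<open>\<gamma>\<close> is deterministic, it is enough that the lower bound by the sums \<open>S\<close> holds on an event of positive
  probability, the complement of \<open>E\<close>.
\<close>

lemma line_bound:
  assumes pos: "0 < x" "0 < y" and x': "0 < x'"
    and [measurable]: "E \<in> sets \<Omega>" and E: "om.prob E < 1"
    and [measurable]: "\<And>m. (\<lambda>\<omega>. S \<omega> m) \<in> borel_measurable \<Omega>"
    and avg: "\<And>\<epsilon>. 0 < \<epsilon> \<Longrightarrow> (\<lambda>m. om.prob {\<omega> \<in> space \<Omega>. \<epsilon> \<le> \<bar>S \<omega> m / real m - c\<bar>}) \<longlonglongrightarrow> 0"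
    and line: "AE \<omega> in \<Omega>. \<omega> \<notin> E \<longrightarrow>
      (\<forall>n. 1 \<le> scaled n x \<longrightarrow> 1 \<le> scaled n y \<longrightarrow> S \<omega> (scaled n x') \<le> passage \<omega> (scaled n x) (scaled n y))"
  shows "x' * c \<le> \<gamma> x y"
proof -
  have key: "x' * c \<le> \<gamma> x y + \<epsilon> * (2 + x')" if \<epsilon>: "0 < \<epsilon>" for \<epsilon>
  proof -
    let ?E2 = "\<lambda>n. {\<omega> \<in> space \<Omega>. \<epsilon> \<le> \<bar>passage \<omega> (scaled n x) (scaled n y) / real n - \<gamma> x y\<bar>}"
    let ?E3 = "\<lambda>m. {\<omega> \<in> space \<Omega>. \<epsilon> \<le> \<bar>S \<omega> m / real m - c\<bar>}"
    have [measurable]: "?E2 n \<in> sets \<Omega>" "?E3 m \<in> sets \<Omega>" for n m by measurable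
    have "(\<lambda>n. om.prob E + (om.prob (?E2 n) + om.prob (?E3 (scaled n x')))) \<longlonglongrightarrow> om.prob E + (0 + 0)"
    proof (intro tendsto_add tendsto_const)
      show "(\<lambda>n. om.prob (?E2 n)) \<longlonglongrightarrow> 0"
        using pos \<epsilon> by (intro om.AE_tendsto_imp_prob_tendsto AE_passage_tendsto) auto
      show "(\<lambda>n. om.prob (?E3 (scaled n x'))) \<longlonglongrightarrow> 0"
        by (rule filterlim_compose[OF avg[OF \<epsilon>] scaled_at_top[OF x']])
    qed
    then have "\<forall>\<^sub>F n in sequentially. om.prob E + (om.prob (?E2 n) + om.prob (?E3 (scaled n x'))) < 1"
      by (rule order_tendstoD) (use E in simp)
    moreover have "\<forall>\<^sub>F n in sequentially. x' * (c - \<epsilon>) - \<epsilon> < real (scaled n x') / real n * (c - \<epsilon>)"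
      by (rule order_tendstoD(1)[OF tendsto_mult[OF scaled_tendsto tendsto_const]]) (use x' \<epsilon> in auto)
    moreover have "\<forall>\<^sub>F n in sequentially. 1 \<le> scaled n x" "\<forall>\<^sub>F n in sequentially. 1 \<le> scaled n y"
        "\<forall>\<^sub>F n in sequentially. 1 \<le> scaled n x'"
      using scaled_at_top[OF pos(1)] scaled_at_top[OF pos(2)] scaled_at_top[OF x'] by (auto simp: filterlim_at_top)
    ultimately have "\<forall>\<^sub>F n in sequentially. om.prob E + (om.prob (?E2 n) + om.prob (?E3 (scaled n x'))) < 1 \<and>
        x' * (c - \<epsilon>) - \<epsilon> < real (scaled n x') / real n * (c - \<epsilon>) \<and> 1 \<le> scaled n x \<and> 1 \<le> scaled n y \<and> 1 \<le> scaled n x'"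
      by eventually_elim (intro conjI)
    then obtain n where n: "om.prob E + (om.prob (?E2 n) + om.prob (?E3 (scaled n x'))) < 1"
        "x' * (c - \<epsilon>) - \<epsilon> < real (scaled n x') / real n * (c - \<epsilon>)" "1 \<le> scaled n x" "1 \<le> scaled n y" "1 \<le> scaled n x'"
      using eventually_happens'[OF sequentially_bot] by blast
    let ?m = "scaled n x'"
    have "om.prob (E \<union> (?E2 n \<union> ?E3 ?m)) \<le> om.prob E + om.prob (?E2 n \<union> ?E3 ?m)"
      by (rule measure_Un_le) measurable
    also have "om.prob (?E2 n \<union> ?E3 ?m) \<le> om.prob (?E2 n) + om.prob (?E3 ?m)"
      by (rule measure_Un_le) measurable
    finally have less: "om.prob (E \<union> (?E2 n \<union> ?E3 ?m)) < 1" using n(1) by linarith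
    have "E \<union> (?E2 n \<union> ?E3 ?m) \<in> sets \<Omega>" by measurable
    from om.exists_outside_event[OF line this less]
    obtain \<omega> where \<omega>: "\<omega> \<in> space \<Omega>" "\<omega> \<notin> E \<union> (?E2 n \<union> ?E3 ?m)"
      and l: "\<omega> \<notin> E \<longrightarrow>
        (\<forall>n. 1 \<le> scaled n x \<longrightarrow> 1 \<le> scaled n y \<longrightarrow> S \<omega> (scaled n x') \<le> passage \<omega> (scaled n x) (scaled n y))"
      by blast
    have notE: "\<omega> \<notin> E" and dev: "\<bar>passage \<omega> (scaled n x) (scaled n y) / real n - \<gamma> x y\<bar> < \<epsilon>"
      and avg: "\<bar>S \<omega> ?m / real ?m - c\<bar> < \<epsilon>"
      using \<omega> by (simp_all only: Un_iff mem_Collect_eq de_Morgan_disj not_le simp_thms)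
    have S: "S \<omega> ?m / real n \<le> passage \<omega> (scaled n x) (scaled n y) / real n"
      using l[rule_format, OF notE n(3,4)] by (rule divide_right_mono) simp
    have "real ?m * (c - \<epsilon>) \<le> S \<omega> ?m"
    proof -
      have "c - \<epsilon> \<le> S \<omega> ?m / real ?m" using avg unfolding abs_diff_less_iff by (intro less_imp_le) blast
      moreover have "0 < real ?m" using n(5) by linarith
      ultimately show ?thesis by (subst (asm) pos_le_divide_eq) (simp_all only: mult.commute)
    qed
    from divide_right_mono[OF this, of "real n"]
    have "real ?m / real n * (c - \<epsilon>) \<le> S \<omega> ?m / real n" by simp
    then have "x' * (c - \<epsilon>) - \<epsilon> \<le> \<gamma> x y + \<epsilon>"
      using S n(2) dev by linarith
    then show ?thesis by (simp add: algebra_simps)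
  qed
  show ?thesis
  proof (rule field_le_epsilon)
    fix \<epsilon> :: real assume "0 < \<epsilon>"
    then show "x' * c \<le> \<gamma> x y + \<epsilon>" using key[of "\<epsilon> / (2 + x')"] x' by simp
  qed
qed

lemma measurable_environment [measurable]:
  "1 \<le> i \<Longrightarrow> (\<lambda>\<omega>. fst (fst \<omega>) i) \<in> borel_measurable \<Omega>"
  "1 \<le> i \<Longrightarrow> (\<lambda>\<omega>. snd (fst \<omega>) i) \<in> borel_measurable \<Omega>"
  by (rule measurable_compose[OF measurable_fst], simp)+

lemma prob_environment:
  assumes "{e \<in> space \<mu>. P e} \<in> sets \<mu>"
  shows "om.prob {\<omega> \<in> space \<Omega>. P (fst \<omega>)} = mu.prob {e \<in> space \<mu>. P e}"
proof -
  have "mu.prob {e \<in> space \<mu>. P e} = measure (distr \<Omega> \<mu> fst) {e \<in> space \<mu>. P e}"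
    by (simp add: noise.distr_pair_fst)
  also have "\<dots> = om.prob (fst -` {e \<in> space \<mu>. P e} \<inter> space \<Omega>)"
    using assms by (intro measure_distr) auto
  also have "fst -` {e \<in> space \<mu>. P e} \<inter> space \<Omega> = {\<omega> \<in> space \<Omega>. P (fst \<omega>)}"
    by (auto simp: space_pair_measure)
  finally show ?thesis ..
qed

text \<open>
  The line is the first row if \<open>h = fst\<close>, \<open>h' = snd\<close>, and the first column if these are exchanged.  With positive
  probability its own parameter satisfies \<open>h' e 1 < \<theta>' + \<delta>\<close>, and then the weights along it are at least
  those with rates \<open>h e i + \<theta>' + \<delta>\<close>.
\<close>

lemma coordinate_line_bound:
  assumes pos: "0 < x" "0 < y" "0 < x'" "0 < \<delta>"
    and h: "coordinate h \<theta>" and h': "coordinate h' \<theta>'" and \<theta>: "0 < \<theta> + \<theta>'" and "inj k"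
    and near: "0 < mu.prob {e \<in> space \<mu>. h' e 1 < \<theta>' + \<delta>}"
    and hpos: "\<And>e i. e \<in> space \<mu> \<Longrightarrow> 1 \<le> i \<Longrightarrow> 0 < h e i" "\<And>e. e \<in> space \<mu> \<Longrightarrow> 0 < h' e 1"
    and line: "AE \<omega> in \<Omega>. \<forall>n. 1 \<le> scaled n x \<longrightarrow> 1 \<le> scaled n y \<longrightarrow>
      (\<Sum>i = 1..scaled n x'. snd \<omega> (k i) / (h (fst \<omega>) i + h' (fst \<omega>) 1)) \<le> passage \<omega> (scaled n x) (scaled n y)"
  shows "x' * mean_inverse h (\<theta>' + \<delta>) \<le> \<gamma> x y"
proof (rule line_bound[OF pos(1-3), where E = "{\<omega> \<in> space \<Omega>. \<theta>' + \<delta> \<le> h' (fst \<omega>) 1}"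
      and S = "\<lambda>\<omega> m. \<Sum>i = 1..m. snd \<omega> (k i) / (h (fst \<omega>) i + (\<theta>' + \<delta>))"])
  have m [measurable]: "(\<lambda>e. h' e 1) \<in> borel_measurable \<mu>" by (rule coordinateD(1)[OF h' order_refl])
  have [measurable]: "(\<lambda>\<omega>. h' (fst \<omega>) 1) \<in> borel_measurable \<Omega>" by (rule measurable_compose[OF measurable_fst m])
  show "{\<omega> \<in> space \<Omega>. \<theta>' + \<delta> \<le> h' (fst \<omega>) 1} \<in> sets \<Omega>" by measurable
  show "(\<lambda>\<omega>. \<Sum>i = 1..m. snd \<omega> (k i) / (h (fst \<omega>) i + (\<theta>' + \<delta>))) \<in> borel_measurable \<Omega>" for m
    by (intro borel_measurable_sum borel_measurable_divide borel_measurable_add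
        measurable_compose[OF measurable_fst coordinateD(1)[OF h]]) auto
  show "(\<lambda>m. om.prob {\<omega> \<in> space \<Omega>. \<epsilon> \<le> \<bar>(\<Sum>i = 1..m. snd \<omega> (k i) / (h (fst \<omega>) i + (\<theta>' + \<delta>))) / real m
      - mean_inverse h (\<theta>' + \<delta>)\<bar>}) \<longlonglongrightarrow> 0" if "0 < \<epsilon>" for \<epsilon>
    using \<theta> pos that \<open>inj k\<close> by (intro line_average[OF h]) auto
  have "{e \<in> space \<mu>. \<theta>' + \<delta> \<le> h' e 1} = space \<mu> - {e \<in> space \<mu>. h' e 1 < \<theta>' + \<delta>}" by auto
  moreover have m: "{e \<in> space \<mu>. \<theta>' + \<delta> \<le> h' e 1} \<in> sets \<mu>" "{e \<in> space \<mu>. h' e 1 < \<theta>' + \<delta>} \<in> sets \<mu>"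
    by measurable
  ultimately show "om.prob {\<omega> \<in> space \<Omega>. \<theta>' + \<delta> \<le> h' (fst \<omega>) 1} < 1"
    using near prob_environment[OF m(1)] mu.prob_compl[OF m(2)] by simp
  show "AE \<omega> in \<Omega>. \<omega> \<notin> {\<omega> \<in> space \<Omega>. \<theta>' + \<delta> \<le> h' (fst \<omega>) 1} \<longrightarrow>
      (\<forall>n. 1 \<le> scaled n x \<longrightarrow> 1 \<le> scaled n y \<longrightarrow>
        (\<Sum>i = 1..scaled n x'. snd \<omega> (k i) / (h (fst \<omega>) i + (\<theta>' + \<delta>))) \<le> passage \<omega> (scaled n x) (scaled n y))"
    using AE_space AE_noise_nonneg' line
  proof (eventually_elim, intro impI allI)
    fix \<omega> n
    assume \<omega>: "\<omega> \<in> space \<Omega>" and nn: "\<forall>k. 0 \<le> snd \<omega> k"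
      and line: "\<forall>n. 1 \<le> scaled n x \<longrightarrow> 1 \<le> scaled n y \<longrightarrow>
        (\<Sum>i = 1..scaled n x'. snd \<omega> (k i) / (h (fst \<omega>) i + h' (fst \<omega>) 1)) \<le> passage \<omega> (scaled n x) (scaled n y)"
      and notE: "\<omega> \<notin> {\<omega> \<in> space \<Omega>. \<theta>' + \<delta> \<le> h' (fst \<omega>) 1}"
      and n: "1 \<le> scaled n x" "1 \<le> scaled n y"
    have e: "fst \<omega> \<in> space \<mu>" using \<omega> by (auto simp: space_pair_measure)
    have near: "h' (fst \<omega>) 1 < \<theta>' + \<delta>" using notE \<omega> by (simp only: mem_Collect_eq simp_thms not_le)
    have "(\<Sum>i = 1..scaled n x'. snd \<omega> (k i) / (h (fst \<omega>) i + (\<theta>' + \<delta>)))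
        \<le> (\<Sum>i = 1..scaled n x'. snd \<omega> (k i) / (h (fst \<omega>) i + h' (fst \<omega>) 1))"
    proof (rule sum_mono)
      fix i assume "i \<in> {1..scaled n x'}"
      then have "0 < h (fst \<omega>) i" "0 < h' (fst \<omega>) 1" using hpos e by auto
      then show "snd \<omega> (k i) / (h (fst \<omega>) i + (\<theta>' + \<delta>)) \<le> snd \<omega> (k i) / (h (fst \<omega>) i + h' (fst \<omega>) 1)"
        using near nn[rule_format, of "k i"] by (intro divide_left_mono mult_pos_pos) auto
    qed
    also have "\<dots> \<le> passage \<omega> (scaled n x) (scaled n y)" by (rule line[rule_format, OF n])
    finally show "(\<Sum>i = 1..scaled n x'. snd \<omega> (k i) / (h (fst \<omega>) i + (\<theta>' + \<delta>)))
      \<le> passage \<omega> (scaled n x) (scaled n y)" .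
  qed
qed

text \<open>
  The bound does not depend on the height \<open>y\<close>, so it can be used in arbitrarily thin strips.
\<close>

lemma row_bound:
  assumes "0 < x" "0 < y" "0 < \<delta>"
  shows "x * A (\<beta> + \<delta>) \<le> \<gamma> x y"
  unfolding A_def
proof (rule coordinate_line_bound[OF assms(1,2,1,3) coordinate_fst coordinate_snd endpoints, where k = "\<lambda>i. (i, 1)"])
  show "AE \<omega> in \<Omega>. \<forall>n. 1 \<le> scaled n x \<longrightarrow> 1 \<le> scaled n y \<longrightarrow>
      (\<Sum>i = 1..scaled n x. snd \<omega> (i, 1) / (fst (fst \<omega>) i + snd (fst \<omega>) 1)) \<le> passage \<omega> (scaled n x) (scaled n y)"
    using AE_passage_mono
  proof (eventually_elim, intro allI impI)
    fix \<omega> n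
    assume mono: "\<forall>m n m' n'. m \<le> m' \<longrightarrow> n \<le> n' \<longrightarrow> passage \<omega> m n \<le> passage \<omega> m' n'" and "1 \<le> scaled n y"
    have "(\<Sum>i = 1..scaled n x. snd \<omega> (i, 1) / (fst (fst \<omega>) i + snd (fst \<omega>) 1)) \<le> passage \<omega> (scaled n x) 1"
      unfolding passage_def
      using row_le_last_passage[of "\<lambda>(i, j). snd \<omega> (i, j) / (fst (fst \<omega>) i + snd (fst \<omega>) j)" "scaled n x"] by simp
    also have "\<dots> \<le> passage \<omega> (scaled n x) (scaled n y)"
      by (rule mono[rule_format, OF order_refl \<open>1 \<le> scaled n y\<close>])
    finally show "(\<Sum>i = 1..scaled n x. snd \<omega> (i, 1) / (fst (fst \<omega>) i + snd (fst \<omega>) 1))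
      \<le> passage \<omega> (scaled n x) (scaled n y)" .
  qed
qed (use near_endpoints(2)[OF assms(3)] space_mu_pos in \<open>auto simp: inj_def\<close>)

lemma column_bound:
  assumes "0 < x" "0 < y" "0 < \<delta>"
  shows "y * B (- \<alpha> - \<delta>) \<le> \<gamma> x y"
proof -
  have "y * mean_inverse snd (\<alpha> + \<delta>) \<le> \<gamma> x y"
  proof (rule coordinate_line_bound[OF assms(1,2,2,3) coordinate_snd coordinate_fst, where k = "\<lambda>j. (1, j)"])
    show "AE \<omega> in \<Omega>. \<forall>n. 1 \<le> scaled n x \<longrightarrow> 1 \<le> scaled n y \<longrightarrow>
        (\<Sum>j = 1..scaled n y. snd \<omega> (1, j) / (snd (fst \<omega>) j + fst (fst \<omega>) 1)) \<le> passage \<omega> (scaled n x) (scaled n y)"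
      using AE_passage_mono
    proof (eventually_elim, intro allI impI)
      fix \<omega> n
      assume mono: "\<forall>m n m' n'. m \<le> m' \<longrightarrow> n \<le> n' \<longrightarrow> passage \<omega> m n \<le> passage \<omega> m' n'" and "1 \<le> scaled n x"
      have "(\<Sum>j = 1..scaled n y. snd \<omega> (1, j) / (snd (fst \<omega>) j + fst (fst \<omega>) 1)) \<le> passage \<omega> 1 (scaled n y)"
        unfolding passage_def
        using column_le_last_passage[of "\<lambda>(i, j). snd \<omega> (i, j) / (fst (fst \<omega>) i + snd (fst \<omega>) j)" "scaled n y"]
        by (simp add: add.commute)
      also have "\<dots> \<le> passage \<omega> (scaled n x) (scaled n y)"
        by (rule mono[rule_format, OF \<open>1 \<le> scaled n x\<close> order_refl])
      finally show "(\<Sum>j = 1..scaled n y. snd \<omega> (1, j) / (snd (fst \<omega>) j + fst (fst \<omega>) 1))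
        \<le> passage \<omega> (scaled n x) (scaled n y)" .
    qed
  qed (use endpoints near_endpoints(1)[OF assms(3)] space_mu_pos in \<open>auto simp: inj_def\<close>)
  then show ?thesis by (simp add: B_def add.commute)
qed

section \<open>Exit points of the boundary model\<close>

text \<open>
  Bookkeeping for one block: \<open>X\<close> is the boundary passage time, \<open>S\<close> the sum over the axis up to the end of block
  \<open>l\<close>, and \<open>L\<close> the passage time from the beginning of that block.
\<close>

lemma exit_term_le:
  assumes "0 \<le> a" "0 < s" "0 < \<epsilon>" "1 \<le> M" "l < M" "1 \<le> n"
    and u: "1 \<le> (u::nat)" "real u \<le> real n * (s / real M)"
    and S: "\<bar>S / real ((l + 1) * u) - a\<bar> < \<epsilon> / s" and L: "\<bar>L / real n - c\<bar> < \<epsilon>" and X: "X \<le> S + L"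
  shows "X / real n \<le> real (l + 1) * (s / real M) * a + c + 2 * \<epsilon>"
proof -
  let ?k = "real ((l + 1) * u)"
  have k: "0 < ?k" using u(1) by (intro of_nat_0_less_iff[THEN iffD2]) simp
  have kn: "?k \<le> real n * (real (l + 1) * (s / real M))"
    using mult_left_mono[OF u(2), of "real (l + 1)"] by (simp only: of_nat_mult mult.left_commute of_nat_0_le_iff simp_thms)
  have lM: "real (l + 1) * (s / real M) \<le> s"
  proof -
    have "real (l + 1) / real M \<le> 1" using assms by simp
    then show ?thesis using mult_right_mono[of "real (l + 1) / real M" 1 s] assms by simp
  qed
  have "S / ?k < a + \<epsilon> / s" using S unfolding abs_diff_less_iff by blast
  then have "S < (a + \<epsilon> / s) * ?k" using k by (simp only: pos_divide_less_eq)
  also have "\<dots> \<le> (a + \<epsilon> / s) * (real n * (real (l + 1) * (s / real M)))"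
    using kn assms by (intro mult_left_mono) auto
  finally have "S \<le> real n * ((a + \<epsilon> / s) * (real (l + 1) * (s / real M)))" by (simp add: ac_simps)
  also have "\<dots> \<le> real n * (real (l + 1) * (s / real M) * a + \<epsilon>)"
  proof (rule mult_left_mono)
    have "\<epsilon> / s * (real (l + 1) * (s / real M)) \<le> \<epsilon> / s * s"
      using lM assms by (intro mult_left_mono) auto
    also have "\<epsilon> / s * s = \<epsilon>" using assms by simp
    finally show "(a + \<epsilon> / s) * (real (l + 1) * (s / real M)) \<le> real (l + 1) * (s / real M) * a + \<epsilon>"
      unfolding distrib_right mult.commute[of a] by linarith
  qed simp
  finally have S': "S \<le> real n * (real (l + 1) * (s / real M) * a + \<epsilon>)" .
  have "L / real n < c + \<epsilon>" using L unfolding abs_diff_less_iff by blast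
  then have L': "L \<le> real n * (c + \<epsilon>)" using \<open>1 \<le> n\<close> by (simp add: pos_divide_less_eq mult.commute less_imp_le)
  have "X \<le> real n * (real (l + 1) * (s / real M) * a + c + 2 * \<epsilon>)"
    using X S' L' by (simp add: algebra_simps)
  then show ?thesis using \<open>1 \<le> n\<close> by (simp add: pos_divide_le_eq mult.commute)
qed

text \<open>
  If all alternatives were smaller than the drift by \<open>\<epsilon>\<close>, the boundary passage time would with high
  probability be smaller than its mean by a fixed fraction of \<open>n\<close>, which \<open>mean_limit_le\<close> excludes.  The
  rectangle has sides \<open>M u\<close> and \<open>M v\<close>, exact multiples of the block lengths \<open>u = \<lfloor>n s / M\<rfloor>\<close> and
  \<open>v = \<lfloor>n t / M\<rfloor>\<close>, so that all rounding goes in the favourable direction.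
\<close>

lemma drift_le_exit_value:
  assumes pos: "0 < s" "0 < t" "0 < \<epsilon>" and z: "- \<alpha> < z" "z < \<beta>" and M: "1 \<le> M"
  shows "\<exists>l<M. drift z s t \<le> real (l + 1) * (s / real M) * A z + \<gamma> (s * real (M - l) / real M) t + \<epsilon> \<or>
               drift z s t \<le> real (l + 1) * (t / real M) * B z + \<gamma> s (t * real (M - l) / real M) + \<epsilon>"
proof (rule ccontr)
  let ?p = "\<lambda>l. s * real (M - l) / real M" and ?q = "\<lambda>l. t * real (M - l) / real M"
  assume "\<not> ?thesis"
  then have far: "real (l + 1) * (s / real M) * A z + \<gamma> (?p l) t + \<epsilon> < drift z s t"
      "real (l + 1) * (t / real M) * B z + \<gamma> s (?q l) + \<epsilon> < drift z s t" if "l < M" for l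
    using that by (auto simp: not_le)
  define c where "c = drift z s t - \<epsilon> / 2"
  define \<eta> where "\<eta> = \<epsilon> / 8"
  have \<eta>: "0 < \<eta>" using pos by (simp add: \<eta>_def)
  define \<kappa> where "\<kappa> = min (\<alpha> + z) (\<beta> - z)"
  have \<kappa>: "0 < \<kappa>" "\<kappa> \<le> \<alpha> + z" "\<kappa> \<le> \<beta> - z" using z by (auto simp: \<kappa>_def)
  have AB: "0 \<le> A z" "0 \<le> B z" using A_nonneg B_nonneg z by auto
  have pq: "0 < ?p l" "0 < ?q l" if "l < M" for l using that pos M by simp_all
  have sM: "0 < s / real M" "0 < t / real M" using pos M by simp_all
  let ?u = "\<lambda>n. scaled n (s / real M)" and ?v = "\<lambda>n. scaled n (t / real M)"
  let ?G = "\<lambda>n \<omega>. boundary_passage (weight z \<omega>) (M * ?u n) (M * ?v n)"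
  let ?X = "\<lambda>n \<omega>. ?G n \<omega> / real n"
  let ?e = "\<lambda>n. real M * (real (?u n) / real n) * A z + real M * (real (?v n) / real n) * B z"
  let ?S = "\<lambda>\<omega> m. \<Sum>i = 1..m. snd \<omega> (i, 0) / (fst (fst \<omega>) i + z)"
  let ?T = "\<lambda>\<omega> m. \<Sum>j = 1..m. snd \<omega> (0, j) / (snd (fst \<omega>) j - z)"
  let ?E1 = "\<lambda>l n. {\<omega> \<in> space \<Omega>. \<eta> / s \<le> \<bar>?S \<omega> ((l + 1) * ?u n) / real ((l + 1) * ?u n) - A z\<bar>}"
  let ?E2 = "\<lambda>l n. {\<omega> \<in> space \<Omega>. \<eta> \<le> \<bar>passage (shift (l * ?u n) 0 \<omega>) (scaled n (?p l)) (scaled n t) / real n - \<gamma> (?p l) t\<bar>}"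
  let ?E3 = "\<lambda>l n. {\<omega> \<in> space \<Omega>. \<eta> / t \<le> \<bar>?T \<omega> ((l + 1) * ?v n) / real ((l + 1) * ?v n) - B z\<bar>}"
  let ?E4 = "\<lambda>l n. {\<omega> \<in> space \<Omega>. \<eta> \<le> \<bar>passage (shift 0 (l * ?v n) \<omega>) (scaled n s) (scaled n (?q l)) / real n - \<gamma> s (?q l)\<bar>}"
  let ?E = "\<lambda>l n. (?E1 l n \<union> ?E2 l n) \<union> (?E3 l n \<union> ?E4 l n)"
  have [measurable]: "(\<lambda>\<omega>. ?S \<omega> m) \<in> borel_measurable \<Omega>" "(\<lambda>\<omega>. ?T \<omega> m) \<in> borel_measurable \<Omega>" for m
    by (intro borel_measurable_sum borel_measurable_divide borel_measurable_add borel_measurable_diff measurable_environment; auto)+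
  have Em [measurable]: "?E1 l n \<in> sets \<Omega>" "?E2 l n \<in> sets \<Omega>" "?E3 l n \<in> sets \<Omega>" "?E4 l n \<in> sets \<Omega>" for l n
    by measurable
  have bad: "(\<lambda>n. \<Sum>l<M. (om.prob (?E1 l n) + om.prob (?E2 l n)) + (om.prob (?E3 l n) + om.prob (?E4 l n))) \<longlonglongrightarrow> 0"
  proof (rule tendsto_null_sum)
    fix l assume "l \<in> {..<M}"
    then have l: "l < M" by simp
    have "(\<lambda>n. om.prob (?E1 l n)) \<longlonglongrightarrow> 0"
      using pos \<eta> sM by (intro filterlim_compose[OF row_average[OF z(1)] multiple_scaled_at_top]) auto
    moreover have "(\<lambda>n. om.prob (?E3 l n)) \<longlonglongrightarrow> 0"
      using pos \<eta> sM by (intro filterlim_compose[OF column_average[OF z(2)] multiple_scaled_at_top]) auto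
    moreover have "(\<lambda>n. om.prob (?E2 l n)) \<longlonglongrightarrow> 0"
      by (rule prob_passage_deviation[where k = "\<lambda>n. l * ?u n" and l = "\<lambda>_. 0", OF pq(1)[OF l] pos(2) \<eta>])
    moreover have "(\<lambda>n. om.prob (?E4 l n)) \<longlonglongrightarrow> 0"
      by (rule prob_passage_deviation[where k = "\<lambda>_. 0" and l = "\<lambda>n. l * ?v n", OF pos(1) pq(2)[OF l] \<eta>])
    ultimately show "(\<lambda>n. (om.prob (?E1 l n) + om.prob (?E2 l n)) + (om.prob (?E3 l n) + om.prob (?E4 l n))) \<longlonglongrightarrow> 0"
      by (intro tendsto_add_zero)
  qed
  have Xc: "(\<lambda>n. om.prob {\<omega> \<in> space \<Omega>. c < ?X n \<omega>}) \<longlonglongrightarrow> 0"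
  proof (rule tendsto_sandwich[OF _ _ tendsto_const bad])
    have "\<forall>\<^sub>F n in sequentially. 1 \<le> ?u n" "\<forall>\<^sub>F n in sequentially. 1 \<le> ?v n"
      using scaled_at_top[OF sM(1)] scaled_at_top[OF sM(2)] by (auto simp: filterlim_at_top)
    then show "\<forall>\<^sub>F n in sequentially. om.prob {\<omega> \<in> space \<Omega>. c < ?X n \<omega>}
      \<le> (\<Sum>l<M. (om.prob (?E1 l n) + om.prob (?E2 l n)) + (om.prob (?E3 l n) + om.prob (?E4 l n)))"
      using eventually_ge_at_top[of 1]
    proof eventually_elim
      case (elim n)
      have u: "1 \<le> ?u n" "real (?u n) \<le> real n * (s / real M)" and v: "1 \<le> ?v n" "real (?v n) \<le> real n * (t / real M)"
        using elim(1,2) scaled_le[OF less_imp_le[OF sM(1)]] scaled_le[OF less_imp_le[OF sM(2)]] by blast+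
      have n: "1 \<le> n" using elim by simp
      have "AE \<omega> in \<Omega>. \<omega> \<in> {\<omega> \<in> space \<Omega>. c < ?X n \<omega>} \<longrightarrow> \<omega> \<in> (\<Union>l<M. ?E l n)"
        using AE_weight_nonneg[OF z]
      proof (eventually_elim, intro impI)
        fix \<omega>
        assume w: "\<forall>k. 0 \<le> weight z \<omega> k" and \<omega>: "\<omega> \<in> {\<omega> \<in> space \<Omega>. c < ?X n \<omega>}"
        show "\<omega> \<in> (\<Union>l<M. ?E l n)"
        proof (rule ccontr)
          assume out: "\<omega> \<notin> (\<Union>l<M. ?E l n)"
          have w': "0 \<le> weight z \<omega> k" for k using w by blast
          have w'': "0 \<le> shift_weights a b (weight z \<omega>) k" for a b k by (cases k) (simp add: shift_weights_def w')
          have sp: "\<omega> \<in> space \<Omega>" using \<omega> by simp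
          have sums: "(\<Sum>i = 1..m. weight z \<omega> (i, 0)) = ?S \<omega> m" "(\<Sum>j = 1..m. weight z \<omega> (0, j)) = ?T \<omega> m" for m
            by (intro sum.cong; simp add: weight_def rate_simps)+
          obtain l where l: "l < M" and alt: "?G n \<omega> \<le> ?S \<omega> ((l + 1) * ?u n)
                + last_passage (shift_weights (l * ?u n) 0 (weight z \<omega>)) ((M - l) * ?u n) (M * ?v n) \<or>
              ?G n \<omega> \<le> ?T \<omega> ((l + 1) * ?v n)
                + last_passage (shift_weights 0 (l * ?v n) (weight z \<omega>)) (M * ?u n) ((M - l) * ?v n)"
            using boundary_passage_exit_block[of "weight z \<omega>", OF w' M u(1) v(1)] unfolding sums by blast
          have nE: "\<omega> \<notin> ?E1 l n" "\<omega> \<notin> ?E2 l n" "\<omega> \<notin> ?E3 l n" "\<omega> \<notin> ?E4 l n" using out l by blast+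
          have dev: "\<bar>?S \<omega> ((l + 1) * ?u n) / real ((l + 1) * ?u n) - A z\<bar> < \<eta> / s"
              "\<bar>passage (shift (l * ?u n) 0 \<omega>) (scaled n (?p l)) (scaled n t) / real n - \<gamma> (?p l) t\<bar> < \<eta>"
              "\<bar>?T \<omega> ((l + 1) * ?v n) / real ((l + 1) * ?v n) - B z\<bar> < \<eta> / t"
              "\<bar>passage (shift 0 (l * ?v n) \<omega>) (scaled n s) (scaled n (?q l)) / real n - \<gamma> s (?q l)\<bar> < \<eta>"
            using nE sp by (simp_all only: mem_Collect_eq simp_thms not_le)
          have full: "M * ?u n \<le> scaled n s" "M * ?v n \<le> scaled n t"
            using pos M by (intro scaled_mult_le; simp)+
          have part: "(M - l) * ?u n \<le> scaled n (?p l)" "(M - l) * ?v n \<le> scaled n (?q l)"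
            using pos M by (intro scaled_mult_le; simp add: ac_simps)+
          from alt have "?X n \<omega> \<le> real (l + 1) * (s / real M) * A z + \<gamma> (?p l) t + 2 * \<eta> \<or>
              ?X n \<omega> \<le> real (l + 1) * (t / real M) * B z + \<gamma> s (?q l) + 2 * \<eta>"
          proof
            assume le: "?G n \<omega> \<le> ?S \<omega> ((l + 1) * ?u n)
                + last_passage (shift_weights (l * ?u n) 0 (weight z \<omega>)) ((M - l) * ?u n) (M * ?v n)"
            have "last_passage (shift_weights (l * ?u n) 0 (weight z \<omega>)) ((M - l) * ?u n) (M * ?v n)
                \<le> passage (shift (l * ?u n) 0 \<omega>) (scaled n (?p l)) (scaled n t)"
              unfolding passage_shift[where z = z] by (intro last_passage_mono w'' part full)
            with le have "?G n \<omega> \<le> ?S \<omega> ((l + 1) * ?u n) + passage (shift (l * ?u n) 0 \<omega>) (scaled n (?p l)) (scaled n t)"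
              by linarith
            from exit_term_le[OF AB(1) pos(1) \<eta> M l n u dev(1,2) this] show ?thesis ..
          next
            assume le: "?G n \<omega> \<le> ?T \<omega> ((l + 1) * ?v n)
                + last_passage (shift_weights 0 (l * ?v n) (weight z \<omega>)) (M * ?u n) ((M - l) * ?v n)"
            have "last_passage (shift_weights 0 (l * ?v n) (weight z \<omega>)) (M * ?u n) ((M - l) * ?v n)
                \<le> passage (shift 0 (l * ?v n) \<omega>) (scaled n s) (scaled n (?q l))"
              unfolding passage_shift[where z = z] by (intro last_passage_mono w'' part full)
            with le have "?G n \<omega> \<le> ?T \<omega> ((l + 1) * ?v n) + passage (shift 0 (l * ?v n) \<omega>) (scaled n s) (scaled n (?q l))"
              by linarith
            from exit_term_le[OF AB(2) pos(2) \<eta> M l n v dev(3,4) this] show ?thesis ..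
          qed
          then have "?X n \<omega> \<le> c" using far[OF l] pos unfolding c_def \<eta>_def by argo
          then show False using \<omega> by simp
        qed
      qed
      then have "om.prob {\<omega> \<in> space \<Omega>. c < ?X n \<omega>} \<le> om.prob (\<Union>l<M. ?E l n)"
        by (rule om.finite_measure_mono_AE) measurable
      also have "\<dots> \<le> (\<Sum>l<M. om.prob (?E l n))"
        by (rule measure_UNION_le) auto
      also have "\<dots> \<le> (\<Sum>l<M. (om.prob (?E1 l n) + om.prob (?E2 l n)) + (om.prob (?E3 l n) + om.prob (?E4 l n)))"
        by (intro sum_mono order_trans[OF measure_Un_le] add_mono measure_Un_le sets.Un Em)
      finally show ?case .
    qed
  qed simp
  have "drift z s t \<le> c"
  proof (rule om.mean_limit_le[where X = ?X and e = ?e and C = "2 / \<kappa>\<^sup>2 * (s + t)\<^sup>2"])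
    show "?X n \<in> borel_measurable \<Omega>" for n by measurable
    show "(\<integral>\<^sup>+\<omega>. ennreal (?X n \<omega>) \<partial>\<Omega>) = ennreal (?e n)" for n
    proof -
      have "(\<integral>\<^sup>+\<omega>. ennreal (?X n \<omega>) \<partial>\<Omega>) = (\<integral>\<^sup>+\<omega>. ennreal (1 / real n) * ennreal (?G n \<omega>) \<partial>\<Omega>)"
        by (simp add: ennreal_mult'[symmetric])
      also have "\<dots> = ennreal (1 / real n) * ennreal (real (M * ?u n) * A z + real (M * ?v n) * B z)"
        by (subst nn_integral_cmult) (auto simp only: boundary_mean[OF z], measurable)
      also have "\<dots> = ennreal (?e n)"
        by (subst ennreal_mult'[symmetric]) (auto simp: add_divide_distrib)
      finally show ?thesis .
    qed
    have "?e \<longlonglongrightarrow> real M * (s / real M) * A z + real M * (t / real M) * B z"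
      using sM by (intro tendsto_add tendsto_mult tendsto_const scaled_tendsto) auto
    then show "?e \<longlonglongrightarrow> drift z s t" using M by (simp add: drift_def)
    show "(\<integral>\<^sup>+\<omega>. ennreal ((?X n \<omega>)\<^sup>2) \<partial>\<Omega>) \<le> ennreal (2 / \<kappa>\<^sup>2 * (s + t)\<^sup>2)" for n
    proof -
      have "(\<integral>\<^sup>+\<omega>. ennreal ((?X n \<omega>)\<^sup>2) \<partial>\<Omega>) = (\<integral>\<^sup>+\<omega>. ennreal ((1 / real n)\<^sup>2) * ennreal ((?G n \<omega>)\<^sup>2) \<partial>\<Omega>)"
        by (simp add: ennreal_mult'[symmetric] power_divide)
      also have "\<dots> = ennreal ((1 / real n)\<^sup>2) * (\<integral>\<^sup>+\<omega>. ennreal ((?G n \<omega>)\<^sup>2) \<partial>\<Omega>)"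
        by (rule nn_integral_cmult) measurable
      also have "\<dots> \<le> ennreal ((1 / real n)\<^sup>2) * ennreal (2 / \<kappa>\<^sup>2 * (real (M * ?u n + M * ?v n))\<^sup>2)"
        by (intro mult_left_mono boundary_second_moment \<kappa>) simp
      also have "\<dots> = ennreal (2 / \<kappa>\<^sup>2 * (real (M * ?u n + M * ?v n) / real n)\<^sup>2)"
        by (subst ennreal_mult'[symmetric]) (auto simp: power_divide)
      also have "\<dots> \<le> ennreal (2 / \<kappa>\<^sup>2 * (s + t)\<^sup>2)"
      proof (intro ennreal_leI mult_left_mono power_mono)
        have "real (M * ?u n) \<le> real n * s" "real (M * ?v n) \<le> real n * t"
          using mult_left_mono[OF scaled_le, of "s / real M" "real M" n] mult_left_mono[OF scaled_le, of "t / real M" "real M" n] sM M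
          by (simp_all add: ac_simps)
        then have "real (M * ?u n + M * ?v n) \<le> (s + t) * real n" by (simp add: algebra_simps)
        then show "real (M * ?u n + M * ?v n) / real n \<le> s + t"
          using pos by (cases "n = 0") (simp_all add: pos_divide_le_eq del: of_nat_add of_nat_mult)
      qed (use \<kappa> in auto)
      finally show ?thesis .
    qed
    have "0 \<le> s * A z / real M" using pos AB by simp
    then show "0 \<le> c" using far(1)[of 0] M pos \<gamma>_nonneg[of "?p 0" t] unfolding c_def by simp
  qed (use Xc in auto)
  then show False using pos by (simp add: c_def)
qed

section \<open>The variational formula\<close>

text \<open>
  The linear function \<open>drift z\<close>, which lies above \<open>\<gamma>\<close>, comes within \<open>\<epsilon>\<close> of it at a point of the half-open segment
  from \<open>(0, t)\<close> to \<open>(s, t)\<close>; in \<open>right_touch\<close>, of the segment from \<open>(s, 0)\<close> to \<open>(s, t)\<close>.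
\<close>

definition left_touch where
  "left_touch s t \<epsilon> z \<longleftrightarrow> (\<exists>p. 0 < p \<and> p \<le> s \<and> drift z p t - \<epsilon> \<le> \<gamma> p t)"

definition right_touch where
  "right_touch s t \<epsilon> z \<longleftrightarrow> (\<exists>q. 0 < q \<and> q \<le> t \<and> drift z s q - \<epsilon> \<le> \<gamma> s q)"

text \<open>
  With \<open>x = s - p\<close>, the alternative \<open>D z s t \<le> x A z + \<gamma> p t\<close> says \<open>D z p t \<le> \<gamma> p t\<close> by linearity; the length
  of one block is absorbed in \<open>\<epsilon>\<close> by taking \<open>M\<close> large.
\<close>

lemma left_or_right_touch:
  assumes pos: "0 < s" "0 < t" "0 < \<epsilon>" and z: "- \<alpha> < z" "z < \<beta>"
  shows "left_touch s t \<epsilon> z \<or> right_touch s t \<epsilon> z"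
proof -
  obtain M :: nat where M: "2 * (s * A z + t * B z) / \<epsilon> < real M" using reals_Archimedean2 by blast
  have AB: "0 \<le> s * A z" "0 \<le> t * B z" using A_nonneg B_nonneg z pos by auto
  have "0 \<le> 2 * (s * A z + t * B z) / \<epsilon>" using AB pos by simp
  then have M1: "1 \<le> M" using M by linarith
  then have M0: "0 < real M" by simp
  have "2 * (s * A z + t * B z) < \<epsilon> * real M" using M pos by (simp add: pos_divide_less_eq mult.commute)
  then have "2 * (s * A z) \<le> \<epsilon> * real M" "2 * (t * B z) \<le> \<epsilon> * real M" using AB by simp_all
  then have small: "s * A z / real M \<le> \<epsilon> / 2" "t * B z / real M \<le> \<epsilon> / 2"
    using M0 by (simp_all add: pos_divide_le_eq)
  have rest: "x * real (M - l) / real M + real (l + 1) * (x / real M) = x + x / real M"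
      "0 < x * real (M - l) / real M" "x * real (M - l) / real M \<le> x" if "l < M" "0 < x" for l x
  proof -
    have "real (M - l) = real M - real l" using that by simp
    then show "x * real (M - l) / real M + real (l + 1) * (x / real M) = x + x / real M"
      using M0 by (simp add: field_simps)
    show "0 < x * real (M - l) / real M" using that M0 by simp
    show "x * real (M - l) / real M \<le> x" using that M0 by (simp add: pos_divide_le_eq)
  qed
  obtain l where l: "l < M" and
    "drift z s t \<le> real (l + 1) * (s / real M) * A z + \<gamma> (s * real (M - l) / real M) t + \<epsilon> / 2 \<or>
     drift z s t \<le> real (l + 1) * (t / real M) * B z + \<gamma> s (t * real (M - l) / real M) + \<epsilon> / 2"
    using drift_le_exit_value[OF pos(1,2) half_gt_zero[OF pos(3)] z M1] by blast
  then show ?thesis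
  proof (elim disjE)
    assume le: "drift z s t \<le> real (l + 1) * (s / real M) * A z + \<gamma> (s * real (M - l) / real M) t + \<epsilon> / 2"
    let ?p = "s * real (M - l) / real M"
    have "?p * A z = s * A z + s * A z / real M - real (l + 1) * (s / real M) * A z"
      using arg_cong[OF rest(1)[OF l pos(1)], of "\<lambda>x. x * A z"] by (simp add: distrib_right)
    then have "drift z ?p t - \<epsilon> \<le> \<gamma> ?p t" using le small(1) unfolding drift_def by argo
    then show ?thesis unfolding left_touch_def using rest(2,3)[OF l pos(1)] by blast
  next
    assume le: "drift z s t \<le> real (l + 1) * (t / real M) * B z + \<gamma> s (t * real (M - l) / real M) + \<epsilon> / 2"
    let ?q = "t * real (M - l) / real M"
    have "?q * B z = t * B z + t * B z / real M - real (l + 1) * (t / real M) * B z"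
      using arg_cong[OF rest(1)[OF l pos(2)], of "\<lambda>x. x * B z"] by (simp add: distrib_right)
    then have "drift z s ?q - \<epsilon> \<le> \<gamma> s ?q" using le small(2) unfolding drift_def by argo
    then show ?thesis unfolding right_touch_def using rest(2,3)[OF l pos(2)] by blast
  qed
qed

text \<open>
  The point \<open>(s, t)\<close> is a combination \<open>x (p, t) + y (s, q)\<close> with \<open>x\<close> and \<open>y\<close> in \<open>(0, 1]\<close>, unless one of the
  touching points is \<open>(s, t)\<close> itself.  Superadditivity and homogeneity bound \<open>\<gamma> s t\<close> below by the same
  combination of nearly linear values.
\<close>

lemma opposite_touches:
  assumes pos: "0 < s" "0 < t" "0 < \<epsilon>" and L: "left_touch s t \<epsilon> z1" and R: "right_touch s t \<epsilon> z2"
    and c: "c \<le> drift z1 s t" "c \<le> drift z2 s t" and close: "s * \<bar>A z1 - A z2\<bar> + t * \<bar>B z1 - B z2\<bar> \<le> \<epsilon>"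
  shows "c - 3 * \<epsilon> \<le> \<gamma> s t"
proof -
  obtain p where p: "0 < p" "p \<le> s" "drift z1 p t - \<epsilon> \<le> \<gamma> p t" using L by (auto simp: left_touch_def)
  obtain q where q: "0 < q" "q \<le> t" "drift z2 s q - \<epsilon> \<le> \<gamma> s q" using R by (auto simp: right_touch_def)
  show ?thesis
  proof (cases "p = s \<or> q = t")
    case True
    then show ?thesis using p q c pos by auto
  next
    case False
    then have lt: "p < s" "q < t" using p q by auto
    define d where "d = s * t - p * q"
    have d: "0 < d" unfolding d_def using mult_strict_mono[OF lt] p q pos by simp
    define x where "x = s * (t - q) / d"
    define y where "y = t * (s - p) / d"
    have xy: "0 < x" "0 < y" using lt pos d by (simp_all add: x_def y_def)
    have "s * (t - q) * p + t * (s - p) * s = s * d" "s * (t - q) * t + t * (s - p) * q = t * d"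
      by (simp_all add: d_def algebra_simps)
    moreover have "x * p + y * s = (s * (t - q) * p + t * (s - p) * s) / d"
      "x * t + y * q = (s * (t - q) * t + t * (s - p) * q) / d"
      by (simp_all add: x_def y_def add_divide_distrib)
    ultimately have sums: "x * p + y * s = s" "x * t + y * q = t"
      using d by simp_all
    have "x \<le> 1" "y \<le> 1"
      using d p q lt mult_right_mono[of p s q] mult_left_mono[of q t p] unfolding x_def y_def d_def
      by (simp_all add: pos_divide_le_eq algebra_simps)
    have "x * \<gamma> p t + y * \<gamma> s q \<le> \<gamma> (x * p) (x * t) + \<gamma> (y * s) (y * q)"
      by (intro add_mono \<gamma>_scale p q xy pos)
    also have "\<dots> \<le> \<gamma> (x * p + y * s) (x * t + y * q)"
      using xy p q pos by (intro \<gamma>_superadditive) auto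
    finally have "x * \<gamma> p t + y * \<gamma> s q \<le> \<gamma> s t" unfolding sums .
    moreover have "x * (drift z1 p t - \<epsilon>) + y * (drift z2 s q - \<epsilon>) \<le> x * \<gamma> p t + y * \<gamma> s q"
      using p q xy by (intro add_mono mult_left_mono) auto
    moreover have "drift z1 s q - \<epsilon> \<le> drift z2 s q"
    proof -
      have "q * \<bar>B z1 - B z2\<bar> \<le> t * \<bar>B z1 - B z2\<bar>" using q by (intro mult_right_mono) auto
      moreover have "s * (A z1 - A z2) \<le> s * \<bar>A z1 - A z2\<bar>" "q * (B z1 - B z2) \<le> q * \<bar>B z1 - B z2\<bar>"
        using pos q by (auto intro!: mult_left_mono)
      ultimately show ?thesis using close unfolding drift_def by (simp add: algebra_simps)
    qed
    then have "y * (drift z1 s q - \<epsilon>) \<le> y * drift z2 s q" using xy by (intro mult_left_mono) auto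
    moreover have "x * drift z1 p t + y * drift z1 s q = drift z1 s t"
    proof -
      have "x * drift z1 p t + y * drift z1 s q = drift z1 (x * p + y * s) (x * t + y * q)"
        by (simp add: drift_def algebra_simps)
      then show ?thesis unfolding sums .
    qed
    moreover have "x * \<epsilon> \<le> \<epsilon>" "y * \<epsilon> \<le> \<epsilon>" using \<open>x \<le> 1\<close> \<open>y \<le> 1\<close> pos by simp_all
    ultimately show ?thesis using c(1) unfolding right_diff_distrib by linarith
  qed
qed

lemma small_loss:
  fixes x \<epsilon> :: real
  assumes "0 < \<epsilon>"
  obtains k where "0 < k" "k < 1" "x - \<epsilon> \<le> (1 - k) * x"
proof
  let ?k = "min (1 / 2) (\<epsilon> / (\<bar>x\<bar> + 1))"
  show "0 < ?k" "?k < 1" using assms by auto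
  have "?k * x \<le> ?k * \<bar>x\<bar>" using assms by (intro mult_left_mono) auto
  also have "\<dots> \<le> \<epsilon> / (\<bar>x\<bar> + 1) * \<bar>x\<bar>" by (intro mult_right_mono) auto
  also have "\<dots> \<le> \<epsilon>" using assms by (simp add: pos_divide_le_eq algebra_simps)
  finally show "x - \<epsilon> \<le> (1 - ?k) * x" by (simp add: algebra_simps)
qed

text \<open>
  The segment from \<open>(p, t)\<close> to \<open>(s, t)\<close> is replaced by a strip of negligible height \<open>k t\<close>.
\<close>

lemma superadditive_strip:
  fixes h :: "real \<Rightarrow> real \<Rightarrow> real"
  assumes super: "\<And>s t s' t'. 0 < s \<Longrightarrow> 0 < t \<Longrightarrow> 0 < s' \<Longrightarrow> 0 < t' \<Longrightarrow> h s t + h s' t' \<le> h (s + s') (t + t')"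
    and scale: "\<And>c s t. 0 < s \<Longrightarrow> 0 < t \<Longrightarrow> 0 < c \<Longrightarrow> c * h s t \<le> h (c * s) (c * t)"
    and strip: "\<And>x y. 0 < x \<Longrightarrow> 0 < y \<Longrightarrow> x * a \<le> h x y"
    and "0 \<le> a" and p: "0 < p" "p \<le> s" and "0 < t" "0 < \<epsilon>"
  shows "h p t + (s - p) * a - \<epsilon> \<le> h s t"
proof -
  obtain k where k: "0 < k" "k < 1" "h p t - \<epsilon> \<le> (1 - k) * h p t" using small_loss[OF \<open>0 < \<epsilon>\<close>] .
  let ?r = "s - (1 - k) * p"
  have "(1 - k) * p < p" using k p by simp
  then have r: "0 < ?r" "s - p \<le> ?r" using p by linarith+
  have "(1 - k) * h p t + ?r * a \<le> h ((1 - k) * p) ((1 - k) * t) + h ?r (k * t)"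
    using k p r \<open>0 < t\<close> by (intro add_mono scale strip) auto
  also have "\<dots> \<le> h ((1 - k) * p + ?r) ((1 - k) * t + k * t)"
    using k p r \<open>0 < t\<close> by (intro super) auto
  also have "\<dots> = h s t" by (simp add: algebra_simps)
  finally have "(1 - k) * h p t + ?r * a \<le> h s t" .
  moreover have "(s - p) * a \<le> ?r * a" using r \<open>0 \<le> a\<close> by (intro mult_right_mono)
  ultimately show ?thesis using k(3) by linarith
qed

lemma scaled_difference_le:
  fixes x y p s \<epsilon> :: real
  assumes "0 < p" "p \<le> s" "s * \<bar>x - y\<bar> \<le> \<epsilon>"
  shows "(s - p) * x - \<epsilon> \<le> (s - p) * y"
proof -
  have "(s - p) * (x - y) \<le> (s - p) * \<bar>x - y\<bar>" using assms by (intro mult_left_mono) auto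
  also have "\<dots> \<le> s * \<bar>x - y\<bar>" using assms by (intro mult_right_mono) auto
  finally show ?thesis using assms(3) by (simp add: algebra_simps)
qed

text \<open>
  The touching direction is completed to \<open>(s, t)\<close> by the direction \<open>(1, 0)\<close>, in which a single row contributes at
  speed \<open>A (\<beta> + \<delta>)\<close>, almost the same as \<open>A z\<close>.
\<close>

lemma left_touch_near_right_end:
  assumes pos: "0 < s" "0 < t" "0 < \<epsilon>" "0 < \<delta>" and L: "left_touch s t \<epsilon> z"
    and c: "c \<le> drift z s t" and close: "s * \<bar>A z - A (\<beta> + \<delta>)\<bar> \<le> \<epsilon>"
  shows "c - 3 * \<epsilon> \<le> \<gamma> s t"
proof -
  obtain p where p: "0 < p" "p \<le> s" "drift z p t - \<epsilon> \<le> \<gamma> p t" using L by (auto simp: left_touch_def)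
  have "0 \<le> A (\<beta> + \<delta>)" using endpoints pos by (intro A_nonneg) simp
  then have "\<gamma> p t + (s - p) * A (\<beta> + \<delta>) - \<epsilon> \<le> \<gamma> s t"
    by (intro superadditive_strip[of \<gamma>] \<gamma>_superadditive \<gamma>_scale row_bound p pos) auto
  then show ?thesis
    using c p(3) scaled_difference_le[OF p(1,2) close] unfolding drift_def by (simp add: algebra_simps)
qed

lemma right_touch_near_left_end:
  assumes pos: "0 < s" "0 < t" "0 < \<epsilon>" "0 < \<delta>" and R: "right_touch s t \<epsilon> z"
    and c: "c \<le> drift z s t" and close: "t * \<bar>B z - B (- \<alpha> - \<delta>)\<bar> \<le> \<epsilon>"
  shows "c - 3 * \<epsilon> \<le> \<gamma> s t"
proof -
  obtain q where q: "0 < q" "q \<le> t" "drift z s q - \<epsilon> \<le> \<gamma> s q" using R by (auto simp: right_touch_def)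
  have "0 \<le> B (- \<alpha> - \<delta>)" using endpoints pos by (intro B_nonneg) simp
  then have "\<gamma> s q + (t - q) * B (- \<alpha> - \<delta>) - \<epsilon> \<le> \<gamma> s t"
    by (intro superadditive_strip[of "\<lambda>y x. \<gamma> x y"] \<gamma>_superadditive \<gamma>_scale column_bound q pos) auto
  then show ?thesis
    using c q(3) scaled_difference_le[OF q(1,2) close] unfolding drift_def by (simp add: algebra_simps)
qed

text \<open>
  Suppose that the bound fails.  Then nearby parameters cannot touch on opposite sides, so the side is a
  locally constant function on an interval, hence constant; and the parameters close to the two ends
  exclude both values.
\<close>

lemma \<gamma>_ge:
  assumes pos: "0 < s" "0 < t" and c: "\<And>z. - \<alpha> < z \<Longrightarrow> z < \<beta> \<Longrightarrow> c \<le> drift z s t"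
  shows "c \<le> \<gamma> s t"
proof (rule ccontr)
  assume "\<not> c \<le> \<gamma> s t"
  define \<epsilon> where "\<epsilon> = (c - \<gamma> s t) / 4"
  have \<epsilon>: "0 < \<epsilon>" and contra: "\<not> c - 3 * \<epsilon> \<le> \<gamma> s t"
    using \<open>\<not> c \<le> \<gamma> s t\<close> by (auto simp: \<epsilon>_def field_simps)
  let ?D = "{- \<alpha><..<\<beta>}"
  have one_side: "left_touch s t \<epsilon> z \<or> right_touch s t \<epsilon> z" if "z \<in> ?D" for z
    using left_or_right_touch[OF pos \<epsilon>] that by simp
  have separated: "\<not> (left_touch s t \<epsilon> z1 \<and> right_touch s t \<epsilon> z2)"
    if "z1 \<in> ?D" "z2 \<in> ?D" "s * \<bar>A z1 - A z2\<bar> + t * \<bar>B z1 - B z2\<bar> \<le> \<epsilon>" for z1 z2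
    using opposite_touches[OF pos \<epsilon> _ _ c c that(3)] that contra by auto
  have local_const: "\<forall>a\<in>?D. \<forall>\<^sub>F b in at a within ?D. left_touch s t \<epsilon> a = left_touch s t \<epsilon> b"
  proof
    fix a assume a: "a \<in> ?D"
    define \<kappa> where "\<kappa> = min (\<alpha> + a) (\<beta> - a) / 2"
    have \<kappa>: "0 < \<kappa>" using a by (auto simp: \<kappa>_def)
    define r where "r = min \<kappa> (\<epsilon> * \<kappa>\<^sup>2 / (s + t))"
    have r: "0 < r" using \<kappa> \<epsilon> pos by (simp add: r_def)
    \<comment> \<open>Within distance \<open>r\<close> of \<open>a\<close> the bound by the Lipschitz constant \<open>1 / \<kappa>\<^sup>2\<close> is at most \<open>\<epsilon>\<close>.\<close>
    have "\<forall>\<^sub>F b in at a within ?D. dist b a < r \<and> b \<in> ?D"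
      using r by (auto simp: eventually_at)
    then show "\<forall>\<^sub>F b in at a within ?D. left_touch s t \<epsilon> a = left_touch s t \<epsilon> b"
    proof eventually_elim
      case (elim b)
      then have b: "\<bar>a - b\<bar> < \<kappa>" "\<bar>a - b\<bar> \<le> \<epsilon> * \<kappa>\<^sup>2 / (s + t)" by (auto simp: r_def dist_real_def abs_minus_commute)
      have \<kappa>2: "2 * \<kappa> \<le> \<alpha> + a" "2 * \<kappa> \<le> \<beta> - a" by (auto simp: \<kappa>_def)
      have "\<bar>A a - A b\<bar> \<le> \<bar>a - b\<bar> / \<kappa>\<^sup>2" "\<bar>B a - B b\<bar> \<le> \<bar>a - b\<bar> / \<kappa>\<^sup>2"
        using \<kappa> \<kappa>2 b(1) by (intro A_lipschitz B_lipschitz; linarith)+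
      then have "s * \<bar>A a - A b\<bar> + t * \<bar>B a - B b\<bar> \<le> s * (\<bar>a - b\<bar> / \<kappa>\<^sup>2) + t * (\<bar>a - b\<bar> / \<kappa>\<^sup>2)"
        using pos by (intro add_mono mult_left_mono) auto
      also have "\<dots> = (s + t) * \<bar>a - b\<bar> / \<kappa>\<^sup>2" by (simp add: algebra_simps add_divide_distrib)
      also have "\<dots> \<le> \<epsilon>" using b(2) pos \<kappa> by (simp add: pos_le_divide_eq pos_divide_le_eq mult.commute)
      finally have close: "s * \<bar>A a - A b\<bar> + t * \<bar>B a - B b\<bar> \<le> \<epsilon>" .
      then have close': "s * \<bar>A b - A a\<bar> + t * \<bar>B b - B a\<bar> \<le> \<epsilon>" by (simp only: abs_minus_commute)
      show ?case
        using separated[OF a _ close] separated[OF _ a close'] one_side[OF a] one_side[of b] elim by blast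
    qed
  qed
  have const: "left_touch s t \<epsilon> z1 = left_touch s t \<epsilon> z2" if "z1 \<in> ?D" "z2 \<in> ?D" for z1 z2
    by (rule connected_local_const[OF _ that local_const]) simp
  define \<kappa> where "\<kappa> = (\<alpha> + \<beta>) / 2"
  have \<kappa>: "0 < \<kappa>" using endpoints by (simp add: \<kappa>_def)
  define r where "r = min \<kappa> (\<epsilon> * \<kappa>\<^sup>2 / (2 * (s + t)))"
  have r12: "0 < r" "r \<le> \<kappa>" and "r \<le> \<epsilon> * \<kappa>\<^sup>2 / (2 * (s + t))"
    using \<kappa> \<epsilon> pos by (auto simp: r_def)
  then have "r * (2 * (s + t)) \<le> \<epsilon> * \<kappa>\<^sup>2" using pos by (simp add: pos_le_divide_eq)
  then have r: "0 < r" "r \<le> \<kappa>" "2 * r * (s + t) \<le> \<epsilon> * \<kappa>\<^sup>2" using r12 by (simp_all only: ac_simps)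
  have small: "x * (2 * r / \<kappa>\<^sup>2) \<le> \<epsilon>" if "0 < x" "x \<le> s + t" for x
  proof -
    have "x * (2 * r) \<le> (s + t) * (2 * r)" using that r by (intro mult_right_mono) auto
    also have "\<dots> \<le> \<epsilon> * \<kappa>\<^sup>2" using r(3) by (simp add: ac_simps)
    finally show ?thesis using \<kappa> by (simp add: pos_divide_le_eq)
  qed
  have ends: "\<beta> - r \<in> ?D" "- \<alpha> + r \<in> ?D" using r \<kappa> by (auto simp: \<kappa>_def)
  show False
  proof (cases "left_touch s t \<epsilon> (\<beta> - r)")
    case True
    have "\<bar>A (\<beta> - r) - A (\<beta> + r)\<bar> \<le> \<bar>(\<beta> - r) - (\<beta> + r)\<bar> / \<kappa>\<^sup>2"
      using \<kappa> r by (intro A_lipschitz) (auto simp: \<kappa>_def)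
    also have "\<bar>(\<beta> - r) - (\<beta> + r)\<bar> = 2 * r" using r by simp
    finally have "s * \<bar>A (\<beta> - r) - A (\<beta> + r)\<bar> \<le> s * (2 * r / \<kappa>\<^sup>2)" using pos by (intro mult_left_mono) auto
    also have "\<dots> \<le> \<epsilon>" using pos by (intro small) auto
    finally show False
      using left_touch_near_right_end[OF pos \<epsilon> r(1) True, of c] c[of "\<beta> - r"] ends contra by simp
  next
    case False
    then have "\<not> left_touch s t \<epsilon> (- \<alpha> + r)" using const[OF ends] by simp
    then have R: "right_touch s t \<epsilon> (- \<alpha> + r)" using one_side ends by blast
    have "\<bar>B (- \<alpha> + r) - B (- \<alpha> - r)\<bar> \<le> \<bar>(- \<alpha> + r) - (- \<alpha> - r)\<bar> / \<kappa>\<^sup>2"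
      using \<kappa> r by (intro B_lipschitz) (auto simp: \<kappa>_def)
    also have "\<bar>(- \<alpha> + r) - (- \<alpha> - r)\<bar> = 2 * r" using r by simp
    finally have "t * \<bar>B (- \<alpha> + r) - B (- \<alpha> - r)\<bar> \<le> t * (2 * r / \<kappa>\<^sup>2)" using pos by (intro mult_left_mono) auto
    also have "\<dots> \<le> \<epsilon>" using pos by (intro small) auto
    finally show False
      using right_touch_near_left_end[OF pos \<epsilon> r(1) R, of c] c[of "- \<alpha> + r"] ends contra by simp
  qed
qed

theorem shape_formula:
  assumes pos: "0 < s" "0 < t"
  shows "g s t = (INF z\<in>{- \<alpha><..<\<beta>}. ennreal (drift z s t))"
proof (rule antisym)
  show "g s t \<le> (INF z\<in>{- \<alpha><..<\<beta>}. ennreal (drift z s t))"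
    using g_le[OF pos] by (intro INF_greatest) auto
  show "(INF z\<in>{- \<alpha><..<\<beta>}. ennreal (drift z s t)) \<le> g s t" (is "?I \<le> _")
  proof -
    obtain z where z: "- \<alpha> < z" "z < \<beta>" using exists_interior_parameter by auto
    have "?I \<le> ennreal (drift z s t)" using z by (intro INF_lower) simp
    then have "?I < top" by (rule le_less_trans) simp
    then obtain c where c: "0 \<le> c" "?I = ennreal c" by (cases ?I) auto
    have "c \<le> drift z s t" if "- \<alpha> < z" "z < \<beta>" for z
    proof -
      have "?I \<le> ennreal (drift z s t)" using that by (intro INF_lower) simp
      then show ?thesis unfolding c(2) using drift_nonneg[OF pos that] by (simp add: ennreal_le_iff)
    qed
    then have "c \<le> \<gamma> s t" by (rule \<gamma>_ge[OF pos])
    then show ?thesis unfolding c(2) g_eq[OF pos] by (rule ennreal_leI)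
  qed
qed

end

theorem theorem2p1:
  fixes \<mu> :: "((nat \<Rightarrow> real) \<times> (nat \<Rightarrow> real)) measure"
    and g :: "real \<Rightarrow> real \<Rightarrow> ennreal"
  assumes "prob_space \<mu>"
    and "sets \<mu> = sets env_space"
    and "stationary_map (distr \<mu> pos_seq_space fst) (seq_shift 1)"
    and "stationary_map (distr \<mu> pos_seq_space snd) (seq_shift 1)"
    and "\<And>k l. k \<ge> 1 \<Longrightarrow> l \<ge> 1 \<Longrightarrow> ergodic_map \<mu> (shift2 k l)"
    and "is_shape_function \<mu> g"
    and "left_endpoint (law_a \<mu>) + left_endpoint (law_b \<mu>) > 0"
  shows "\<forall>s>0. \<forall>t>0. g s t =
    (INF z\<in>{- left_endpoint (law_a \<mu>)<..<left_endpoint (law_b \<mu>)}.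
       ennreal (s * (\<integral>(a, b). 1 / (a 1 + z) \<partial>\<mu>) + t * (\<integral>(a, b). 1 / (b 1 - z) \<partial>\<mu>)))"
proof -
  interpret shape_environment \<mu> g
    using assms unfolding shape_environment_def ergodic_environment_def shape_environment_axioms_def by auto
  have "drift z s t = s * (\<integral>(a, b). 1 / (a 1 + z) \<partial>\<mu>) + t * (\<integral>(a, b). 1 / (b 1 - z) \<partial>\<mu>)" for z s t
    by (simp add: drift_def A_def B_def mean_inverse_def case_prod_beta')
  then show ?thesis using shape_formula by simp
qed

end
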